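(* Let $K$ be the $2$-uniform tiling of the plane whose vertex types are $[3^1,4^2,6^1]$ and $[3^1,4^1,6^1,4^1]$. If $X$ is a map on the torus that is a quotient $X=K/\Gamma$ of $K$, then the vertices of $X$ form at most $9$ orbits under ${\rm Aut}(X)$.
   Context: A map is a polyhedral map: a cellular embedding of a connected graph in a closed surface such that the intersection of any two distinct faces is empty, a single vertex, or a single edge. For a vertex $u$, the faces containing $u$ form a cyclic sequence (the face-cycle at $u$); if this cyclic sequence consists of consecutive blocks of $n_1$ $p_1$-gons, then $n_2$ $p_2$-gons, ..., then $n_k$ $p_k$-gons, with cyclically consecutive $p_i$ distinct, then $u$ is said to have type $[p_1^{n_1},\dots,p_k^{n_k}]$ (defined up to cyclic shift and reversal). A $2$-uniform tiling is an edge-to-edge tiling of the Euclidean plane $\mathbb{R}^2$ by regular polygons whose symmetry group has exactly two orbits on the set of vertices; viewed as a map on the plane, its vertices have (at most) two types, listed as $[W;Z]$. (Up to isomorphism there are exactly $20$ such tilings; there is exactly one with the vertex types named in the claim.) For a map $K$ on the plane, a quotient of $K$ on the torus is a map $X$ on the torus together with a polyhedral covering map $\eta:K\to X$ with $X=K/\Gamma$, where $\Gamma\le {\rm Aut}(K)$ is a subgroup acting without fixed vertices, edges or faces and $K/\Gamma$ is homeomorphic to the torus. ${\rm Aut}(X)$ denotes the automorphism group of the map $X$, acting on its vertex set $V(X)$. *)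

theory Defs
  imports "HOL-Analysis.Analysis"
begin

text \<open>A tile is represented by its (finite) set of corners; the closed tile is its convex hull.\<close>

definition regular_polygon :: "nat \<Rightarrow> complex set \<Rightarrow> bool" where
  "regular_polygon n S \<longleftrightarrow> 3 \<le> n \<and>
     (\<exists>c r \<theta>. 0 < r \<and> S = {c + of_real r * cis (\<theta> + 2 * pi * real k / real n) | k. k < n})"

definition poly_edges :: "complex set \<Rightarrow> complex set set" where
  "poly_edges P = {{a, b} | a b. a \<in> P \<and> b \<in> P \<and> a \<noteq> b \<and>
                                  closed_segment a b \<subseteq> frontier (convex hull P)}"

definition edge_to_edge_regular_tiling :: "complex set set \<Rightarrow> bool" where
  "edge_to_edge_regular_tiling T \<longleftrightarrow>
     (\<forall>P\<in>T. \<exists>n. regular_polygon n P) \<and>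
     (\<Union>P\<in>T. convex hull P) = UNIV \<and>
     (\<forall>P\<in>T. \<forall>Q\<in>T. P \<noteq> Q \<longrightarrow> interior (convex hull P) \<inter> interior (convex hull Q) = {}) \<and>
     (\<forall>P\<in>T. \<forall>Q\<in>T. P \<noteq> Q \<longrightarrow>
         convex hull P \<inter> convex hull Q = {} \<or>
         (\<exists>v\<in>P \<inter> Q. convex hull P \<inter> convex hull Q = {v}) \<or>
         (\<exists>a b. {a, b} \<in> poly_edges P \<and> {a, b} \<in> poly_edges Q \<and>
                convex hull P \<inter> convex hull Q = closed_segment a b))"

definition tiling_vertices :: "complex set set \<Rightarrow> complex set" where
  "tiling_vertices T = \<Union>T"

definition tiling_edges :: "complex set set \<Rightarrow> complex set set" where
  "tiling_edges T = (\<Union>P\<in>T. poly_edges P)"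

definition tiling_symmetries :: "complex set set \<Rightarrow> (complex \<Rightarrow> complex) set" where
  "tiling_symmetries T = {f. (\<forall>x y. dist (f x) (f y) = dist x y) \<and> (\<lambda>P. f ` P) ` T = T}"

definition two_uniform :: "complex set set \<Rightarrow> bool" where
  "two_uniform T \<longleftrightarrow> edge_to_edge_regular_tiling T \<and>
     card {{f v | f. f \<in> tiling_symmetries T} | v. v \<in> tiling_vertices T} = 2"

text \<open>Vertex v has type ts: the tiles at v can be listed cyclically,
  consecutive ones sharing an edge at v, with numbers of sides ts.
  (Cyclic shifts and reversal are automatically allowed, as the listing is existential.)\<close>
definition has_vertex_type :: "complex set set \<Rightarrow> complex \<Rightarrow> nat list \<Rightarrow> bool" where
  "has_vertex_type T v ts \<longleftrightarrow>
     (\<exists>Ps. distinct Ps \<and> set Ps = {P\<in>T. v \<in> P} \<and> length Ps = length ts \<and>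
        (\<forall>i < length Ps. \<exists>w. {v, w} \<in> poly_edges (Ps ! i) \<and>
                              {v, w} \<in> poly_edges (Ps ! ((i + 1) mod length Ps))) \<and>
        map card Ps = ts)"

definition map_auts :: "complex set set \<Rightarrow> (complex \<Rightarrow> complex) set" where
  "map_auts T = {g. bij_betw g (tiling_vertices T) (tiling_vertices T) \<and>
                    (\<forall>x. x \<notin> tiling_vertices T \<longrightarrow> g x = x) \<and>
                    (\<lambda>P. g ` P) ` T = T}"

definition is_subgroup_of :: "('a \<Rightarrow> 'a) set \<Rightarrow> ('a \<Rightarrow> 'a) set \<Rightarrow> bool" where
  "is_subgroup_of \<Gamma> G \<longleftrightarrow> \<Gamma> \<subseteq> G \<and> id \<in> \<Gamma> \<and>
     (\<forall>g\<in>\<Gamma>. \<forall>h\<in>\<Gamma>. g \<circ> h \<in> \<Gamma>) \<and> (\<forall>g\<in>\<Gamma>. inv g \<in> \<Gamma>)"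

definition acts_freely :: "complex set set \<Rightarrow> (complex \<Rightarrow> complex) set \<Rightarrow> bool" where
  "acts_freely T \<Gamma> \<longleftrightarrow> (\<forall>g\<in>\<Gamma>. g \<noteq> id \<longrightarrow>
      (\<forall>v\<in>tiling_vertices T. g v \<noteq> v) \<and>
      (\<forall>e\<in>tiling_edges T. g ` e \<noteq> e) \<and>
      (\<forall>P\<in>T. g ` P \<noteq> P))"

text \<open>Cellular (tile-wise real-affine) extension of a map automorphism to the whole plane.\<close>
definition cell_ext :: "complex set set \<Rightarrow> (complex \<Rightarrow> complex) \<Rightarrow> complex \<Rightarrow> complex" where
  "cell_ext T g x = (THE y. \<exists>P\<in>T. x \<in> convex hull P \<and>
      (\<exists>a b c. (\<forall>v\<in>P. g v = a * v + b * cnj v + c) \<and> y = a * x + b * cnj x + c))"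

definition torus :: "(complex \<times> complex) set" where
  "torus = sphere 0 1 \<times> sphere 0 1"

definition quotient_is_torus :: "complex set set \<Rightarrow> (complex \<Rightarrow> complex) set \<Rightarrow> bool" where
  "quotient_is_torus T \<Gamma> \<longleftrightarrow>
     (\<exists>p. quotient_map euclidean (top_of_set torus) p \<and>
          (\<forall>x y. p x = p y \<longleftrightarrow> (\<exists>g\<in>\<Gamma>. cell_ext T g x = y)))"

definition orb :: "('a \<Rightarrow> 'a) set \<Rightarrow> 'a \<Rightarrow> 'a set" where
  "orb \<Gamma> v = {g v | g. g \<in> \<Gamma>}"

definition quot_vertices :: "complex set set \<Rightarrow> (complex \<Rightarrow> complex) set \<Rightarrow> complex set set" where
  "quot_vertices T \<Gamma> = orb \<Gamma> ` tiling_vertices T"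

definition quot_faces :: "complex set set \<Rightarrow> (complex \<Rightarrow> complex) set \<Rightarrow> complex set set set" where
  "quot_faces T \<Gamma> = (\<lambda>P. orb \<Gamma> ` P) ` T"

definition quotient_polyhedral :: "complex set set \<Rightarrow> (complex \<Rightarrow> complex) set \<Rightarrow> bool" where
  "quotient_polyhedral T \<Gamma> \<longleftrightarrow>
     (\<forall>P\<in>T. inj_on (orb \<Gamma>) P) \<and>
     (\<forall>P\<in>T. \<forall>Q\<in>T. (\<forall>g\<in>\<Gamma>. g ` P \<noteq> Q) \<longrightarrow>
        (let A = orb \<Gamma> ` P \<inter> orb \<Gamma> ` Q in
          A = {} \<or> card A = 1 \<or>
          (\<exists>e\<in>poly_edges P. \<exists>e'\<in>poly_edges Q. (\<exists>g\<in>\<Gamma>. g ` e = e') \<and> A = orb \<Gamma> ` e)))"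

definition quot_auts :: "complex set set \<Rightarrow> (complex \<Rightarrow> complex) set \<Rightarrow> (complex set \<Rightarrow> complex set) set" where
  "quot_auts T \<Gamma> = {\<phi>. bij_betw \<phi> (quot_vertices T \<Gamma>) (quot_vertices T \<Gamma>) \<and>
                       (\<lambda>F. \<phi> ` F) ` quot_faces T \<Gamma> = quot_faces T \<Gamma>}"

definition num_vertex_orbits_quot :: "complex set set \<Rightarrow> (complex \<Rightarrow> complex) set \<Rightarrow> nat" where
  "num_vertex_orbits_quot T \<Gamma> =
     card {{\<phi> u | \<phi>. \<phi> \<in> quot_auts T \<Gamma>} | u. u \<in> quot_vertices T \<Gamma>}"

end

theory Submission
  imports Defs
begin

text \<open>
  Four tiles fit around every vertex, and transitivity of the symmetry group on the vertices of type
  \<open>[3, 4, 6, 4]\<close> forces each triangle to have two corners of type \<open>[3, 4, 4, 6]\<close> and one of type \<open>[3, 4, 6, 4]\<close>.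
  Then the tiles at a vertex determine those at its neighbours, so an orientation preserving isometry
  that matches the tiles at one vertex with those at another is a symmetry of the tiling. All triangles have
  the same orientation up to multiples of 60 degrees, which leaves 3 * 6 oriented vertex types (the type
  \<open>[3, 4, 4, 6]\<close> occurs in two mirror images): vertices with the same oriented type differ by a
  translation, and vertices with opposite oriented types by a point reflection, which leaves 9 classes.

  An automorphism of the map is induced by an isometry. A freely acting one is a translation or a glide
  reflection, and the latter is impossible because the deck group of a covering of the torus by the plane is
  abelian and cocompact. Translations and point reflections therefore normalise the group and act on the quotient.
\<close>

section \<open>Regular polygons\<close>

text \<open>A tile is handled through a directed edge with the tile on its left: corner
  \<open>v\<close>, edge vector \<open>d\<close>, number of sides \<open>n\<close>. Walking along a
  tile or turning about a vertex is multiplication by a root of unity, and claims about neighbours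
  become arithmetic with \<open>\<zeta>\<close> and \<open>\<i>\<close>. Three obstacles shape the
  proof. A vertex type is an unoriented incidence statement, so the counterclockwise order has to be
  recovered from the fact that an edge has at most one tile on each side. Neither a common side
  length nor local finiteness is part of the definition of a tiling; equal sides and connectedness
  come from discs of fixed relative radius covered by the tiles at a vertex. And the local data
  admit triangles with three corners of type \<open>[3, 4, 6, 4]\<close>, as in the 1-uniform tiling
  of that type; here the number of symmetry orbits enters. Glide reflections are excluded by an
  invariant: if one commuted with the whole deck group, the distance from its axis would be
  invariant and, by cocompactness, bounded on the plane.\<close>

definition rou :: "nat \<Rightarrow> complex" where "rou n = cis (2 * pi / real n)"

text \<open>Rotation by the interior angle: it carries the edge leaving a corner counterclockwise to
  the other edge at that corner.\<close>

definition turn :: "nat \<Rightarrow> complex" where "turn n = - inverse (rou n)"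

text \<open>The quotient comes from the geometric sum of the edge vectors \<open>d\<close>,
  \<open>d * rou n\<close>, \<open>d * rou n ^ 2\<close>, ..., so the polygon is traversed
  counterclockwise and lies to the left of its first edge.\<close>

definition ngon :: "nat \<Rightarrow> complex \<Rightarrow> complex \<Rightarrow> complex set" where
  "ngon n v d = (\<lambda>k. v + d * (1 - rou n ^ k) / (1 - rou n)) ` {..<n}"

lemma rou_nz [simp]: "rou n \<noteq> 0"
  by (simp add: rou_def)

lemma norm_rou [simp]: "norm (rou n) = 1"
  by (simp add: rou_def)

lemma norm_turn [simp]: "norm (turn n) = 1"
  by (simp add: turn_def norm_inverse)

lemma turn_nz [simp]: "turn n \<noteq> 0"
  by (simp add: turn_def)

lemma turn_rou [simp]: "turn n * rou n = -1"
  by (simp add: turn_def)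

lemma rou_pow: "rou n ^ k = cis (2 * pi * real k / real n)"
proof -
  have "real k * (2 * pi / real n) = 2 * pi * real k / real n" by simp
  then show ?thesis unfolding rou_def Complex.DeMoivre by metis
qed

lemma rou_pow_n: "n > 0 \<Longrightarrow> rou n ^ n = 1"
  by (simp add: rou_pow)

lemma inj_on_rou_pow: "n > 0 \<Longrightarrow> inj_on (\<lambda>k. rou n ^ k) {..<n}"
  using bij_betw_roots_unity[of n]
  by (simp add: bij_betw_def inj_on_def rou_pow cis_conv_exp mult_ac)

lemma rou_ne_1: "n \<ge> 2 \<Longrightarrow> rou n \<noteq> 1"
  using inj_onD[OF inj_on_rou_pow[of n], of 0 1] by auto

lemma rou_values: "rou 4 = \<i>" "rou 6 = Complex (1/2) (sqrt 3 / 2)" "rou 3 = Complex (-1/2) (sqrt 3 / 2)"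
proof -
  have e: "2 * pi / real 4 = pi / 2" "2 * pi / real 6 = pi / 3" "2 * pi / real 3 = 2 * (pi / 3)" by auto
  show "rou 4 = \<i>" unfolding rou_def e by simp
  show "rou 6 = Complex (1/2) (sqrt 3 / 2)"
    unfolding rou_def e by (simp add: complex_eq_iff cos_60 sin_60)
  show "rou 3 = Complex (-1/2) (sqrt 3 / 2)"
    unfolding rou_def e cis.ctr by (simp only: cos_double sin_double cos_60 sin_60) (simp add: power2_eq_square)
qed

abbreviation \<zeta> :: complex where "\<zeta> \<equiv> rou 6"

lemma zeta_sq: "\<zeta> * \<zeta> = \<zeta> - 1"
  by (simp add: rou_values complex_eq_iff)

lemma zeta_sq': "\<zeta> * (\<zeta> * x) = \<zeta> * x - x"
  by (metis left_diff_distrib mult.assoc mult_1 zeta_sq)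

lemma rou_3: "rou 3 = \<zeta> - 1"
  by (simp add: rou_values complex_eq_iff)

lemma turn_values: "turn 3 = \<zeta>" "turn 4 = \<i>" "turn 6 = \<zeta> - 1"
proof -
  have "(\<zeta> - 1) * - \<zeta> = 1" using zeta_sq by (simp add: algebra_simps)
  then show "turn 3 = \<zeta>" unfolding turn_def rou_3 by (metis inverse_unique minus_minus)
  show "turn 4 = \<i>" by (simp add: turn_def rou_values)
  show "turn 6 = \<zeta> - 1" unfolding turn_def using zeta_sq by (simp add: field_simps)
qed

lemma ngon_start: "n > 0 \<Longrightarrow> v \<in> ngon n v d"
  unfolding ngon_def by (rule image_eqI[of _ _ 0]) auto

lemma ngon_second: "n \<ge> 2 \<Longrightarrow> v + d \<in> ngon n v d"
  unfolding ngon_def by (rule image_eqI[of _ _ 1]) (use rou_ne_1[of n] in auto)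

lemma ngon_shift:
  assumes "n \<ge> 2" shows "ngon n (v + d) (d * rou n) = ngon n v d"
proof -
  have r: "rou n \<noteq> 1" using rou_ne_1 assms by blast
  let ?f = "\<lambda>k. v + d * (1 - rou n ^ k) / (1 - rou n)"
  have "(v + d) + d * rou n * (1 - rou n ^ k) / (1 - rou n) = ?f (Suc k)" for k
    using r by (simp add: divide_simps) (simp add: algebra_simps)
  then have "ngon n (v + d) (d * rou n) = ?f ` (Suc ` {..<n})"
    unfolding ngon_def by (auto simp: image_image)
  also have "Suc ` {..<n} = {1..n}" by (simp add: lessThan_atLeast0 image_Suc_atLeastLessThan atLeastLessThanSuc_atLeastAtMost)
  also have "{1..n} = insert n {1..<n}" using assms by auto
  also have "?f ` \<dots> = insert (?f 0) (?f ` {1..<n})" using assms by (simp add: rou_pow_n)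
  also have "\<dots> = ?f ` insert 0 {1..<n}" by simp
  also have "insert 0 {1..<n} = {..<n}" using assms by auto
  finally show ?thesis unfolding ngon_def .
qed

lemma ngon_shift_back:
  assumes "n \<ge> 2" shows "ngon n (v + d * turn n) (- d * turn n) = ngon n v d"
  using ngon_shift[OF assms, of "v + d * turn n" "- d * turn n"] by (simp add: mult.assoc)

lemma ngon_restart:
  assumes "n \<ge> 2" shows "ngon n (v + d * (1 - rou n ^ k) / (1 - rou n)) (d * rou n ^ k) = ngon n v d"
proof (induction k)
  case (Suc k)
  have r: "rou n \<noteq> 1" using rou_ne_1 assms by blast
  have "v + d * (1 - rou n ^ Suc k) / (1 - rou n) = (v + d * (1 - rou n ^ k) / (1 - rou n)) + d * rou n ^ k"
    using r by (simp add: divide_simps) (simp add: algebra_simps)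
  then show ?case using ngon_shift[OF assms, of "v + d * (1 - rou n ^ k) / (1 - rou n)" "d * rou n ^ k"] Suc
    by (simp add: mult_ac add.assoc)
qed simp

lemma ngon_corner:
  assumes "n \<ge> 2" "w \<in> ngon n v d" obtains e where "norm e = norm d" "ngon n w e = ngon n v d"
proof -
  obtain k where "w = v + d * (1 - rou n ^ k) / (1 - rou n)" using assms(2) unfolding ngon_def by blast
  then have "ngon n w (d * rou n ^ k) = ngon n v d" using ngon_restart[OF assms(1)] by simp
  then show thesis by (rule that[rotated]) (simp add: norm_mult norm_power)
qed

lemma inj_on_ngon:
  assumes "n \<ge> 2" "d \<noteq> 0"
  shows "inj_on (\<lambda>k. v + d * (1 - rou n ^ k) / (1 - rou n)) {..<n}"
  using inj_on_rou_pow[of n] rou_ne_1[of n] assms by (auto simp: inj_on_def)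

lemma card_ngon: "n \<ge> 2 \<Longrightarrow> d \<noteq> 0 \<Longrightarrow> card (ngon n v d) = n"
  unfolding ngon_def using inj_on_ngon by (simp add: card_image)

lemma finite_ngon: "finite (ngon n v d)" by (simp add: ngon_def)

lemma regular_polygon_ngon:
  assumes "regular_polygon n S" obtains v d where "d \<noteq> 0" "S = ngon n v d" "n \<ge> 3"
proof -
  obtain c r \<theta> where n: "3 \<le> n" and r: "0 < r" and
    S: "S = {c + of_real r * cis (\<theta> + 2 * pi * real k / real n) | k. k < n}"
    using assms unfolding regular_polygon_def by blast
  let ?\<rho> = "of_real r * cis \<theta>"
  have r1: "rou n \<noteq> 1" using rou_ne_1 n by simp
  have "c + of_real r * cis (\<theta> + 2 * pi * real k / real n) =
        c + ?\<rho> + (?\<rho> * (rou n - 1)) * (1 - rou n ^ k) / (1 - rou n)" for k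
  proof -
    have "c + of_real r * cis (\<theta> + 2 * pi * real k / real n) = c + ?\<rho> * rou n ^ k"
      by (simp add: rou_pow cis_mult mult.assoc)
    also have "\<dots> = c + ?\<rho> - ?\<rho> * (1 - rou n ^ k)" by (simp add: algebra_simps)
    also have "\<dots> = c + ?\<rho> + (?\<rho> * (rou n - 1)) * (1 - rou n ^ k) / (1 - rou n)"
      using r1 by (simp add: divide_simps) (simp add: algebra_simps)
    finally show ?thesis .
  qed
  then have S': "S = ngon n (c + ?\<rho>) (?\<rho> * (rou n - 1))" unfolding S ngon_def by auto
  have "?\<rho> * (rou n - 1) \<noteq> 0" using r r1 by simp
  then show thesis using that[OF _ S' n] by blast
qed

definition center :: "nat \<Rightarrow> complex \<Rightarrow> complex \<Rightarrow> complex" where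
  "center n v d = v + d / (1 - rou n)"

lemma sum_ngon:
  assumes "n \<ge> 2" "d \<noteq> 0"
  shows "\<Sum>(ngon n v d) = of_nat n * center n v d"
proof -
  have r: "rou n \<noteq> 1" using rou_ne_1 assms by blast
  have "\<Sum>(ngon n v d) = (\<Sum>k<n. v + d * (1 - rou n ^ k) / (1 - rou n))"
    unfolding ngon_def using inj_on_ngon[OF assms] by (simp add: sum.reindex)
  also have "\<dots> = (\<Sum>k<n. center n v d - d / (1 - rou n) * rou n ^ k)"
    unfolding center_def by (intro sum.cong refl) (simp add: diff_divide_distrib ring_distribs)
  also have "\<dots> = of_nat n * center n v d - d / (1 - rou n) * (\<Sum>k<n. rou n ^ k)"
    by (simp add: sum_subtractf sum_distrib_left)
  also have "(\<Sum>k<n. rou n ^ k) = 0"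
    using r assms by (simp add: geometric_sum rou_pow_n)
  finally show ?thesis by simp
qed

text \<open>The corner set determines its centroid, and the centroid together with \<open>v\<close>
  determines the first edge.\<close>

lemma ngon_inject:
  assumes "n \<ge> 2" "d \<noteq> 0" "e \<noteq> 0" "ngon n v d = ngon n v e" shows "d = e"
proof -
  have "of_nat n * center n v d = of_nat n * center n v e"
    using sum_ngon assms by metis
  with rou_ne_1[OF assms(1)] assms(1) show ?thesis by (simp add: center_def)
qed

lemma dist_center_ngon:
  assumes "n \<ge> 2" "x \<in> ngon n v d" shows "dist (center n v d) x = norm (d / (1 - rou n))"
proof -
  obtain k where x: "x = v + d * (1 - rou n ^ k) / (1 - rou n)" using assms unfolding ngon_def by auto
  have "center n v d - x = d / (1 - rou n) * rou n ^ k"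
    unfolding x center_def by (simp add: diff_divide_distrib ring_distribs)
  then show ?thesis by (simp add: dist_norm norm_mult norm_power norm_divide)
qed

lemma ngon_last: "n \<ge> 2 \<Longrightarrow> v + d * turn n \<in> ngon n v d"
  using ngon_start[of n "v + d * turn n" "- d * turn n"] ngon_shift_back[of n v d] by simp

section \<open>Interior points of regular polygons\<close>

lemma Im_turn_pos: assumes "n \<ge> 3" shows "Im (turn n) > 0"
proof -
  have "Im (turn n) = sin (2 * pi / real n)" by (simp add: turn_def rou_def flip: cis_inverse)
  moreover have "0 < 2 * pi / real n" "2 * pi / real n < pi" using assms by (auto simp: field_simps)
  ultimately show ?thesis by (simp add: sin_gt_zero)
qed

text \<open>The point lies strictly inside the triangle formed by \<open>v\<close> and its two
  neighbouring corners.\<close>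

lemma interior_ngon:
  assumes "n \<ge> 3" "d \<noteq> 0" "0 < x" "0 < y" "x + y < 1"
  shows "v + d * (of_real x + of_real y * turn n) \<in> interior (convex hull (ngon n v d))"
proof -
  have "\<not> collinear {v + d, v, v + d * turn n}"
  proof
    assume "collinear {v + d, v, v + d * turn n}"
    then have "collinear {0, d, d * turn n}" using collinear_3[of "v + d" v "v + d * turn n"] by (simp add: NO_MATCH_def)
    then obtain c where "d * turn n = c *\<^sub>R d" using assms(2) by (auto simp: collinear_lemma)
    then have "turn n = of_real c" using assms(2) by (simp add: scaleR_conv_of_real)
    with Im_turn_pos[OF assms(1)] show False by simp
  qed
  note I = interior_convex_hull_3_minimal[OF this DIM_complex]
  have "v + d * (of_real x + of_real y * turn n) = x *\<^sub>R (v + d) + (1 - x - y) *\<^sub>R v + y *\<^sub>R (v + d * turn n)"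
    by (simp add: scaleR_conv_of_real algebra_simps)
  then have "v + d * (of_real x + of_real y * turn n) \<in> interior (convex hull {v + d, v, v + d * turn n})"
    unfolding I by (intro CollectI exI[of _ x] exI[of _ "1 - x - y"] exI[of _ y]) (use assms in simp)
  moreover have "{v + d, v, v + d * turn n} \<subseteq> ngon n v d"
    using assms(1) by (simp add: ngon_start ngon_second ngon_last)
  ultimately show ?thesis by (meson hull_mono interior_mono subsetD)
qed

text \<open>The point does not depend on \<open>n\<close>: it is interior to all three polygons on
  the left of the same edge. Hence only one of them can be a tile.\<close>

lemma witness_interior:
  assumes "n \<in> {3, 4, 6}" "d \<noteq> 0"
  shows "v + d * (1/2 + \<i>/8) \<in> interior (convex hull (ngon n v d))"
proof -
  \<comment> \<open>Coordinates of the point in the real basis \<open>1\<close>,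
    \<open>turn n\<close>.\<close>
  let ?y = "(1/8) / Im (turn n)" and ?x = "1/2 - (1/8) / Im (turn n) * Re (turn n)"
  obtain q where q: "sqrt (3::real) = q" "1 < q" by simp
  have xy: "0 < ?x" "0 < ?y" "?x + ?y < 1"
    using assms q(2) by (auto simp: turn_values rou_values q(1) field_simps)
  have w: "of_real ?x + of_real ?y * turn n = 1/2 + \<i>/8"
    using Im_turn_pos[of n] assms by (auto simp: complex_eq_iff)
  have "n \<ge> 3" using assms by auto
  from interior_ngon[OF this assms(2) xy, of v] show ?thesis unfolding w .
qed

lemma ngon_3: "ngon 3 v d = {v, v + d, v + d * \<zeta>}"
proof -
  have "{..<3} = {0::nat,1,2}" by auto
  moreover have "(1 - rou 3 ^ 2) / (1 - rou 3) = \<zeta>"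
    using rou_ne_1[of 3] by (simp add: divide_simps) (simp add: rou_3 power2_eq_square algebra_simps zeta_sq zeta_sq')
  ultimately show ?thesis unfolding ngon_def times_divide_eq_right[symmetric] using rou_ne_1[of 3]
    by (simp del: times_divide_eq_right)
qed

lemma ngon_4: "ngon 4 v d = {v, v + d, v + d + d * \<i>, v + d * \<i>}"
proof -
  have "{..<4} = {0::nat,1,2,3}" by auto
  moreover have "(1 - rou 4 ^ 2) / (1 - rou 4) = 1 + \<i>" "(1 - rou 4 ^ 3) / (1 - rou 4) = \<i>"
    by (auto simp: rou_values power3_eq_cube power2_eq_square complex_eq_iff Re_divide Im_divide)
  ultimately show ?thesis unfolding ngon_def times_divide_eq_right[symmetric] using rou_ne_1[of 4]
    by (simp add: distrib_left add.assoc del: times_divide_eq_right)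
qed

lemma ngon_6: "ngon 6 v d = {v, v + d, v + d + d * \<zeta>, v + 2 * d * \<zeta>, v + 2 * d * \<zeta> - d, v + d * \<zeta> - d}"
proof -
  have "{..<6} = {0::nat,1,2,3,4,5}" by auto
  moreover have "1 - \<zeta> \<noteq> 0" using rou_ne_1[of 6] by simp
  then have z: "x / (1 - \<zeta>) = \<zeta> * x" for x
    using zeta_sq' by (simp add: field_simps)
  have p: "\<zeta> ^ 2 = \<zeta> - 1" "\<zeta> ^ 3 = -1" "\<zeta> ^ 4 = -\<zeta>" "\<zeta> ^ 5 = 1 - \<zeta>"
    using zeta_sq by (simp_all add: power_numeral_reduce algebra_simps zeta_sq')
  ultimately show ?thesis unfolding ngon_def z
    by (simp add: p algebra_simps zeta_sq zeta_sq')
qed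


section \<open>Edges and diagonals of the polygons\<close>

lemma convex_3:
  assumes "convex S" "a \<in> S" "b \<in> S" "c \<in> S" "0 \<le> x" "0 \<le> y" "0 \<le> z" "x + y + z = 1"
  shows "x *\<^sub>R a + y *\<^sub>R b + z *\<^sub>R c \<in> S"
proof -
  have "convex hull {a, b, c} \<subseteq> S" using assms by (simp add: hull_minimal)
  then show ?thesis using assms by (auto simp: convex_hull_3)
qed

text \<open>The reflections in \<open>c\<close> of \<open>v\<close> and of its two neighbours are
  again corners. So \<open>c\<close> is the midpoint of an interior point near \<open>v\<close> and
  of its reflection, which still lies in the hull.\<close>

lemma even_center_interior:
  assumes "n \<ge> 3" "d \<noteq> 0" "2 * c - v \<in> ngon n v d" "2 * c - v - d \<in> ngon n v d" "2 * c - v - d * turn n \<in> ngon n v d"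
  shows "c \<in> interior (convex hull (ngon n v d))"
proof -
  let ?H = "convex hull (ngon n v d)"
  let ?w = "v + d * (of_real (1/3) + of_real (1/4) * turn n)"
  have w: "?w \<in> interior ?H" by (rule interior_ngon) (use assms in auto)
  \<comment> \<open>The weights of \<open>?w\<close>, now on the reflected corners.\<close>
  let ?w' = "(5/12) *\<^sub>R (2 * c - v) + (1/3) *\<^sub>R (2 * c - v - d) + (1/4) *\<^sub>R (2 * c - v - d * turn n)"
  have "?w' \<in> ?H" by (rule convex_3) (use assms in \<open>auto intro: hull_inc\<close>)
  moreover have "?w' = 2 * c - ?w" by (simp add: scaleR_conv_of_real field_simps)
  ultimately have w': "2 * c - ?w \<in> closure ?H" using closure_subset by auto
  show ?thesis
  proof (cases "?w = c")
    case False
    have "c = midpoint ?w (2 * c - ?w)" by (simp add: midpoint_def scaleR_conv_of_real)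
    then have "c \<in> open_segment ?w (2 * c - ?w)"
      using False by (metis add.commute add_diff_cancel diff_add_cancel midpoint_eq_endpoint(1) midpoint_in_open_segment mult_2 eq_diff_eq)
    with in_interior_closure_convex_segment[OF convex_convex_hull w w'] show ?thesis by blast
  qed (use w in simp)
qed

text \<open>\<open>poly_edges\<close> asks for a chord in the frontier, so every diagonal from
  \<open>v\<close> is excluded by an interior midpoint. For the square and the long diagonal of the
  hexagon this is the centre; for a short diagonal of the hexagon it is halfway between the centre
  and the skipped corner.\<close>

lemma poly_edges_ngon_start:
  assumes n: "n \<in> {3, 4, 6}" and d: "d \<noteq> 0" and e: "{v, w} \<in> poly_edges (ngon n v d)"
  shows "w = v + d \<or> w = v + d * turn n"
proof -
  let ?H = "convex hull (ngon n v d)"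
  have w: "w \<in> ngon n v d" "w \<noteq> v" and seg: "closed_segment v w \<subseteq> frontier ?H"
    using e unfolding poly_edges_def by (auto simp: doubleton_eq_iff closed_segment_commute)
  have mid: "midpoint v w \<notin> interior ?H"
    using seg midpoints_in_convex_hull[of v "{v,w}" w] unfolding segment_convex_hull frontier_def by (auto simp: hull_inc)
  show ?thesis using n
  proof (elim insertE emptyE)
    assume "n = 3"
    with w show ?thesis by (auto simp: ngon_3 turn_values)
  next
    assume n: "n = 4"
    have "v + d * (1 + \<i>) / 2 \<in> interior ?H" unfolding n
      by (rule even_center_interior) (auto simp: ngon_4 turn_values d algebra_simps)
    then have "w \<noteq> v + d + d * \<i>" using mid by (auto simp: midpoint_def scaleR_conv_of_real field_simps)
    with w show ?thesis by (auto simp: n ngon_4 turn_values)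
  next
    assume n: "n = 6"
    have c: "v + d * \<zeta> \<in> interior ?H" unfolding n
      by (rule even_center_interior) (auto simp: ngon_6 turn_values d algebra_simps)
    have m: "midpoint (v + d * \<zeta>) x \<in> interior ?H" if "x \<in> ngon n v d" for x
    proof (cases "x = v + d * \<zeta>")
      case False
      have "x \<in> closure ?H" using that closure_subset hull_inc by (metis subsetD)
      with in_interior_closure_convex_segment[OF convex_convex_hull c this] False show ?thesis
        by (auto simp: midpoint_in_open_segment)
    qed (use c in simp)
    have "midpoint v (v + 2 * d * \<zeta>) = v + d * \<zeta>" by (simp add: midpoint_def scaleR_conv_of_real field_simps)
    then have "w \<noteq> v + 2 * d * \<zeta>" using mid c by auto
    moreover have "midpoint v (v + d + d * \<zeta>) = midpoint (v + d * \<zeta>) (v + d)"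
      by (simp add: midpoint_def scaleR_conv_of_real field_simps)
    then have "w \<noteq> v + d + d * \<zeta>" using mid m[of "v + d"] by (auto simp: n ngon_6)
    moreover have "midpoint v (v + 2 * d * \<zeta> - d) = midpoint (v + d * \<zeta>) (v + d * \<zeta> - d)"
      by (simp add: midpoint_def scaleR_conv_of_real field_simps)
    then have "w \<noteq> v + 2 * d * \<zeta> - d" using mid m[of "v + d * \<zeta> - d"] by (auto simp: n ngon_6)
    ultimately show ?thesis using w by (auto simp: n ngon_6 turn_values algebra_simps)
  qed
qed

lemma poly_edges_ngon:
  assumes n: "n \<in> {3, 4, 6}" and d: "d \<noteq> 0" and e: "{a, b} \<in> poly_edges (ngon n v d)"
  shows "ngon n v d = ngon n a (b - a) \<or> ngon n v d = ngon n b (a - b)"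
proof -
  have n2: "n \<ge> 2" using n by auto
  have "a \<in> ngon n v d" using e unfolding poly_edges_def by (auto simp: doubleton_eq_iff)
  then obtain d' where d': "norm d' = norm d" "ngon n a d' = ngon n v d" using ngon_corner[OF n2] by metis
  then have "d' \<noteq> 0" using d by (metis norm_eq_zero)
  have "{a, b} \<in> poly_edges (ngon n a d')" using e by (simp only: d'(2))
  from poly_edges_ngon_start[OF n \<open>d' \<noteq> 0\<close> this]
  show ?thesis
  proof
    assume "b = a + d'"
    then show ?thesis using d'(2) by simp
  next
    assume "b = a + d' * turn n"
    then have "ngon n b (a - b) = ngon n a d'" using ngon_shift_back[OF n2, of a d'] by simp
    then show ?thesis using d'(2) by simp
  qed
qed

text \<open>The corners lie on a circle, and points strictly inside a chord are strictly closer to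
  the centre.\<close>

lemma poly_edges_corner:
  assumes n: "n \<ge> 2" and ab: "a \<in> ngon n v d" "b \<in> ngon n v d" and x: "x \<in> ngon n v d" "x \<in> closed_segment a b"
  shows "x = a \<or> x = b"
proof (rule ccontr)
  assume "\<not> ?thesis"
  then have "x \<in> open_segment a b" using x by (auto simp: open_segment_def)
  from dist_decreases_open_segment[OF this, of "center n v d"] show False
    using dist_center_ngon[OF n] ab x by auto
qed

text \<open>The frontier of a two-dimensional polytope is the union of its facets. A facet is
  compact, convex and of dimension 1, hence a segment, and its ends are extreme points and so
  corners.\<close>

lemma frontier_polygon_face:
  fixes P :: "complex set"
  assumes "finite P" "interior (convex hull P) \<noteq> {}" "z \<in> frontier (convex hull P)"
  obtains a b where "{a, b} \<in> poly_edges P" "z \<in> closed_segment a b" "closed_segment a b face_of (convex hull P)"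
proof -
  let ?H = "convex hull P"
  have ph: "polyhedron ?H" using assms(1) by (simp add: polytope_convex_hull polytope_imp_polyhedron)
  have rf: "rel_frontier ?H = frontier ?H"
    using assms(2) by (simp add: rel_frontier_nonempty_interior)
  with assms(3) obtain F where F: "F facet_of ?H" "z \<in> F"
    using rel_frontier_of_polyhedron[OF ph] by auto
  then have face: "F face_of ?H" by (simp add: facet_of_imp_face_of)
  have "aff_dim ?H = 2" using aff_dim_nonempty_interior[OF assms(2)] by simp
  then have ad: "aff_dim F = 1" using F by (simp add: facet_of_def)
  have "compact F" using face assms(1) face_of_imp_compact
    by (metis compact_convex_hull convex_convex_hull finite_imp_compact)
  moreover have "convex F" "collinear F" using face face_of_imp_convex ad by (auto simp: collinear_aff_dim)
  ultimately obtain a b where ab: "F = closed_segment a b"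
    using F compact_convex_collinear_segment by (metis empty_iff)
  have "a \<noteq> b" using ad ab by auto
  moreover have "a \<in> P" "b \<in> P"
    using extreme_point_of_face[OF face] extreme_point_of_convex_hull ab extreme_point_of_segment by metis+
  moreover have "closed_segment a b \<subseteq> frontier ?H"
    using F rel_frontier_of_polyhedron[OF ph] rf ab by auto
  ultimately show thesis using that F ab face unfolding poly_edges_def by blast
qed

section \<open>Tiles around a vertex\<close>

text \<open>An isosceles triangle with unit legs and apex angle \<open>\<theta>\<close> has altitude
  \<open>cos (\<theta> / 2)\<close>, at least \<open>sqrt 2 / 2 > 7 / 10\<close>, and so contains
  the sector of radius \<open>7 / 10\<close> at its apex.\<close>

lemma triangle_sector:
  assumes S: "convex S" "v \<in> S" "v + d \<in> S" "v + d * cis \<theta> \<in> S"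
    and \<theta>: "0 < \<theta>" "\<theta> \<le> pi / 2" and t: "0 \<le> t" "t \<le> \<theta>" and \<rho>: "0 \<le> \<rho>" "\<rho> \<le> 7 / 10"
  shows "v + d * (of_real \<rho> * cis t) \<in> S"
proof -
  have s: "0 < sin \<theta>" using \<theta> by (intro sin_gt_zero) auto
  have s2: "0 < sin (\<theta> / 2)" using \<theta> by (intro sin_gt_zero) auto
  \<comment> \<open>Barycentric coordinates of the point, by the law of sines.\<close>
  define x where "x = \<rho> * sin (\<theta> - t) / sin \<theta>"
  define y where "y = \<rho> * sin t / sin \<theta>"
  have x0: "0 \<le> x" unfolding x_def using \<theta> t \<rho> s by (intro divide_nonneg_pos mult_nonneg_nonneg sin_ge_zero) auto
  have y0: "0 \<le> y" unfolding y_def using \<theta> t \<rho> s by (intro divide_nonneg_pos mult_nonneg_nonneg sin_ge_zero) auto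
  have "sin (\<theta> - t) + sin t = 2 * sin (\<theta> / 2) * cos (\<theta> / 2 - t)"
    using sin_plus_sin[of "\<theta> - t" t] by (simp add: diff_divide_distrib)
  also have "\<dots> \<le> 2 * sin (\<theta> / 2) * 1" using s2 by (intro mult_left_mono) auto
  finally have sum: "sin (\<theta> - t) + sin t \<le> 2 * sin (\<theta> / 2)" by simp
  have "cos (pi / 4) \<le> cos (\<theta> / 2)" using \<theta> by (intro cos_monotone_0_pi_le) auto
  moreover have "(7 / 10::real) \<le> sqrt 2 / 2" using real_le_rsqrt[of "14/10" 2] by (simp add: power2_eq_square)
  ultimately have c: "7 / 10 \<le> cos (\<theta> / 2)" by (simp add: cos_45)
  have "\<rho> * (sin (\<theta> - t) + sin t) \<le> cos (\<theta> / 2) * (2 * sin (\<theta> / 2))"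
    using sum c \<rho> t \<theta> by (intro mult_mono) (auto intro!: add_nonneg_nonneg sin_ge_zero)
  also have "\<dots> = sin \<theta>" using sin_double[of "\<theta> / 2"] by simp
  finally have xy: "x + y \<le> 1" unfolding x_def y_def using s by (simp add: field_simps)
  have "of_real (sin \<theta>) * cis t = of_real (sin (\<theta> - t)) + of_real (sin t) * cis \<theta>"
    by (simp add: complex_eq_iff sin_diff algebra_simps)
  then have "cis t = (of_real (sin (\<theta> - t)) + of_real (sin t) * cis \<theta>) / of_real (sin \<theta>)"
    using s by (simp add: field_simps)
  then have "of_real \<rho> * cis t = of_real x + of_real y * cis \<theta>"
    unfolding x_def y_def by (simp add: add_divide_distrib distrib_left)
  then have "v + d * (of_real \<rho> * cis t) = (1 - x - y) *\<^sub>R v + x *\<^sub>R (v + d) + y *\<^sub>R (v + d * cis \<theta>)"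
    by (simp add: scaleR_conv_of_real algebra_simps)
  also have "\<dots> \<in> S" by (rule convex_3) (use S x0 y0 xy in auto)
  finally show ?thesis .
qed

definition angle :: "nat \<Rightarrow> real" where "angle n = pi - 2 * pi / real n"

lemma angle_values: "angle 3 = pi / 3" "angle 4 = pi / 2" "angle 6 = 2 * pi / 3"
  by (auto simp: angle_def)

lemma cis_angle: "cis (angle n) = turn n"
proof -
  have "cis (angle n) = cis pi * cis (- (2 * pi / real n))" unfolding angle_def cis_mult by simp
  then show ?thesis by (simp add: turn_def rou_def flip: cis_inverse)
qed

lemma zeta_cis: "\<zeta> = cis (pi / 3)"
  using cis_angle[of 3] by (simp add: angle_values turn_values)

text \<open>The angle of the hexagon exceeds a right angle; the segment from \<open>v\<close> to the
  centre \<open>v + d * \<zeta>\<close> splits its sector into those of two equilateral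
  triangles.\<close>

lemma ngon_sector:
  assumes n: "n \<in> {3, 4, 6}" and t: "0 \<le> t" "t \<le> angle n" and \<rho>: "0 \<le> \<rho>" "\<rho> \<le> 7 / 10"
  shows "v + d * (of_real \<rho> * cis t) \<in> convex hull (ngon n v d)"
proof -
  have n2: "n \<ge> 2" using n by auto
  have v: "v \<in> convex hull (ngon n v d)" using n2 by (intro hull_inc ngon_start) auto
  have d: "v + d \<in> convex hull (ngon n v d)" using n2 by (intro hull_inc ngon_second) auto
  have l: "v + d * cis (angle n) \<in> convex hull (ngon n v d)"
    using n2 by (simp add: cis_angle hull_inc ngon_last)
  show ?thesis
  proof (cases "n = 6")
    case False
    then show ?thesis using n t \<rho>
      by (intro triangle_sector[OF convex_convex_hull v d l]) (auto simp: angle_values)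
  next
    case True
    have "v \<in> ngon 6 v d" "v + 2 * d * \<zeta> \<in> ngon 6 v d" by (auto simp: ngon_6)
    then have "midpoint v (v + 2 * d * \<zeta>) \<in> convex hull (ngon n v d)"
      unfolding True by (intro midpoints_in_convex_hull hull_inc)
    moreover have "midpoint v (v + 2 * d * \<zeta>) = v + d * \<zeta>"
      by (simp add: midpoint_def scaleR_conv_of_real field_simps)
    ultimately have c: "v + d * \<zeta> \<in> convex hull (ngon n v d)" by simp
    show ?thesis
    proof (cases "t \<le> pi / 3")
      case True
      then show ?thesis using t \<rho> c unfolding zeta_cis
        by (intro triangle_sector[OF convex_convex_hull v d, of "pi / 3"]) auto
    next
      case F: False
      have "v + d * \<zeta> * (of_real \<rho> * cis (t - pi / 3)) \<in> convex hull (ngon n v d)"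
      proof (rule triangle_sector[OF convex_convex_hull v c])
        show "v + d * \<zeta> * cis (pi / 3) \<in> convex hull (ngon n v d)"
          using l True by (simp add: cis_angle turn_values mult.assoc zeta_sq flip: zeta_cis)
      qed (use F t \<rho> True in \<open>auto simp: angle_values\<close>)
      moreover have "\<zeta> * cis (t - pi / 3) = cis t" by (simp add: zeta_cis cis_mult)
      then have "d * \<zeta> * (of_real \<rho> * cis (t - pi / 3)) = d * (of_real \<rho> * cis t)"
        by (metis mult.assoc mult.left_commute)
      ultimately show ?thesis by simp
    qed
  qed
qed

text \<open>\<open>flags d [n\<^sub>0, n\<^sub>1, \<dots>]\<close> lists, counterclockwise from direction \<open>d\<close>, the first edge and the number of sides
  of consecutive regular polygons around a vertex.\<close>
fun flags :: "complex \<Rightarrow> nat list \<Rightarrow> (complex \<times> nat) set" where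
  "flags d [] = {}"
| "flags d (n # ns) = insert (d, n) (flags (d * turn n) ns)"

text \<open>Vertex types read counterclockwise from the triangle: the two mirror images of \<open>[3, 4, 4, 6]\<close>
  are kept apart.\<close>
abbreviation (input) typeAp :: "nat list" where "typeAp \<equiv> [3, 4, 4, 6]"
abbreviation (input) typeAm :: "nat list" where "typeAm \<equiv> [3, 6, 4, 4]"
abbreviation (input) typeB :: "nat list" where "typeB \<equiv> [3, 4, 6, 4]"

section \<open>Oriented tiles around a vertex\<close>

locale tiling_346 =
  fixes T :: "complex set set"
  assumes tiling: "edge_to_edge_regular_tiling T"
    and vertex_types: "\<And>v. v \<in> tiling_vertices T \<Longrightarrow>
          has_vertex_type T v [3, 4, 4, 6] \<or> has_vertex_type T v [3, 4, 6, 4]"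
begin

text \<open>A flag of the tiling: a tile with one of its directed edges, the tile being on the
  left.\<close>

definition F :: "complex \<Rightarrow> complex \<Rightarrow> nat \<Rightarrow> bool" where
  "F v d n \<longleftrightarrow> d \<noteq> 0 \<and> n \<in> {3, 4, 6} \<and> ngon n v d \<in> T"

text \<open>Equality, so that the list accounts for all tiles at \<open>v\<close>. In the three
  types used, \<open>d\<close> is the first edge of the only triangle at \<open>v\<close> and hence
  determined by \<open>v\<close>.\<close>

definition vt :: "complex \<Rightarrow> complex \<Rightarrow> nat list \<Rightarrow> bool" where
  "vt v d X \<longleftrightarrow> {(e, m). F v e m} = flags d X"

lemma F_ge2: "F v d n \<Longrightarrow> 2 \<le> n" "F v d n \<Longrightarrow> 3 \<le> n" "F v d n \<Longrightarrow> d \<noteq> 0" "F v d n \<Longrightarrow> ngon n v d \<in> T"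
  "F v d n \<Longrightarrow> n \<in> {3, 4, 6}"
  by (auto simp: F_def)

lemma tile_regular: "P \<in> T \<Longrightarrow> \<exists>n. regular_polygon n P"
  using tiling by (simp add: edge_to_edge_regular_tiling_def)

lemma tiles_cover: "(\<Union>P\<in>T. convex hull P) = UNIV"
  using tiling by (simp add: edge_to_edge_regular_tiling_def)

lemma tile_ngon_any:
  assumes "P \<in> T" obtains n v d where "d \<noteq> 0" "P = ngon n v d" "n \<ge> 3"
  using tile_regular[OF assms] regular_polygon_ngon by metis

lemma tile_vertex: "P \<in> T \<Longrightarrow> v \<in> P \<Longrightarrow> v \<in> tiling_vertices T"
  by (auto simp: tiling_vertices_def)

lemma tile_card: assumes "P \<in> T" shows "card P \<in> {3, 4, 6}"
proof -
  obtain n v d where nvd: "d \<noteq> 0" "P = ngon n v d" "n \<ge> 3" using tile_ngon_any assms by metis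
  then have "v \<in> P" by (simp add: ngon_start)
  have "card P \<in> set ts" if "has_vertex_type T v ts" for ts
  proof -
    obtain Ps where Ps: "set Ps = {P\<in>T. v \<in> P}" "map card Ps = ts"
      using \<open>has_vertex_type T v ts\<close> unfolding has_vertex_type_def by (elim exE conjE)
    then have "set ts = card ` {P\<in>T. v \<in> P}" by (metis set_map)
    then show ?thesis using assms \<open>v \<in> P\<close> by auto
  qed
  from this[of "[3, 4, 4, 6]"] this[of "[3, 4, 6, 4]"] vertex_types[OF tile_vertex[OF assms \<open>v \<in> P\<close>]]
  show ?thesis by auto
qed

lemma tile_F:
  assumes "P \<in> T" "v \<in> P" obtains d where "P = ngon (card P) v d" "F v d (card P)"
proof -
  obtain n u d where nvd: "d \<noteq> 0" "P = ngon n u d" "n \<ge> 3" using tile_ngon_any assms by metis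
  then have n: "card P = n" using card_ngon by simp
  obtain e where e: "norm e = norm d" "ngon n v e = ngon n u d" using ngon_corner[of n v u d] nvd assms by auto
  have "e \<noteq> 0" using e(1) nvd(1) by (metis norm_eq_zero)
  show thesis
  proof (rule that[of e])
    show "P = ngon (card P) v e" unfolding n using nvd(2) e(2) by (rule trans[OF _ sym])
    show "F v e (card P)" unfolding F_def using \<open>e \<noteq> 0\<close> tile_card[OF assms(1)] assms(1) nvd(2) e(2) n by simp
  qed
qed

lemma F_card: "F v d n \<Longrightarrow> card (ngon n v d) = n"
  by (simp add: F_ge2 card_ngon)

lemma tiles_interior: "P \<in> T \<Longrightarrow> Q \<in> T \<Longrightarrow> x \<in> interior (convex hull P) \<Longrightarrow> x \<in> interior (convex hull Q) \<Longrightarrow> P = Q"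
  using tiling unfolding edge_to_edge_regular_tiling_def by blast

lemma F_unique: assumes "F v d n" "F v d m" shows "n = m"
proof -
  have "ngon n v d = ngon m v d"
    using assms by (intro tiles_interior[of _ _ "v + d * (1/2 + \<i>/8)"] witness_interior) (auto simp: F_def)
  then show ?thesis using assms F_card by metis
qed

lemma F_next: "F v d n \<Longrightarrow> F (v + d) (d * rou n) n"
  using ngon_shift[of n v d] by (auto simp: F_def)

lemma F_prev: "F v d n \<Longrightarrow> F (v + d * turn n) (- (d * turn n)) n"
  using ngon_shift_back[of n v d] by (auto simp: F_def)

lemma edge_side:
  assumes "P \<in> T" "{a, b} \<in> poly_edges P"
  shows "(P = ngon (card P) a (b - a) \<and> F a (b - a) (card P)) \<or> (P = ngon (card P) b (a - b) \<and> F b (a - b) (card P))"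
proof -
  have "a \<in> P" "a \<noteq> b" using assms unfolding poly_edges_def by (auto simp: doubleton_eq_iff)
  obtain d where d: "P = ngon (card P) a d" "F a d (card P)" using tile_F[OF assms(1) \<open>a \<in> P\<close>] .
  have "{a, b} \<in> poly_edges (ngon (card P) a d)" by (subst d(1)[symmetric]) (rule assms(2))
  from poly_edges_ngon[OF F_ge2(5)[OF d(2)] F_ge2(3)[OF d(2)] this]
  have "P = ngon (card P) a (b - a) \<or> P = ngon (card P) b (a - b)" unfolding d(1)[symmetric] .
  then show ?thesis
  proof
    assume *: "P = ngon (card P) a (b - a)"
    then have "F a (b - a) (card P)"
      using assms(1) tile_card[OF assms(1)] \<open>a \<noteq> b\<close> unfolding F_def by auto
    with * show ?thesis by blast
  next
    assume *: "P = ngon (card P) b (a - b)"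
    then have "F b (a - b) (card P)"
      using assms(1) tile_card[OF assms(1)] \<open>a \<noteq> b\<close> unfolding F_def by auto
    with * show ?thesis by blast
  qed
qed

text \<open>An edge has only two sides, so \<open>P\<close>, \<open>Q\<close>, \<open>R\<close>
  cannot all meet along one edge: the second shared edge is the other edge of \<open>Q\<close> at
  \<open>v\<close>. As seen from \<open>v\<close>, \<open>Q\<close> lies to the right of it, which
  leaves the left side for \<open>R\<close>.\<close>

lemma fan_step:
  assumes PQR: "P \<in> T" "Q \<in> T" "R \<in> T" "P \<noteq> Q" "Q \<noteq> R" "P \<noteq> R"
    and e: "{v, w} \<in> poly_edges P" "{v, w} \<in> poly_edges Q" "{v, w'} \<in> poly_edges Q" "{v, w'} \<in> poly_edges R"
    and Q: "Q = ngon (card Q) v (w - v)" "F v (w - v) (card Q)"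
  shows "w' - v = (w - v) * turn (card Q)" "R = ngon (card R) v (w' - v)" "F v (w' - v) (card R)"
proof -
  have e': "{v, w'} \<in> poly_edges (ngon (card Q) v (w - v))" using e(3) Q(1) by simp
  have left: "X = Y" if "X = ngon (card X) a d" "Y = ngon (card Y) a d" "F a d (card X)" "F a d (card Y)" for X Y a d
    using F_unique that by metis
  have "w' = v + (w - v) \<or> w' = v + (w - v) * turn (card Q)"
    by (rule poly_edges_ngon_start[OF _ _ e']) (use F_ge2[OF Q(2)] in auto)
  moreover have "w' \<noteq> v + (w - v)"
  proof
    assume "w' = v + (w - v)"
    then have "{v, w} \<in> poly_edges R" using e by simp
    then show False using edge_side[OF PQR(1) e(1)] edge_side[OF PQR(3)] left Q PQR by metis
  qed
  ultimately show 1: "w' - v = (w - v) * turn (card Q)" by auto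
  let ?t = "(w - v) * turn (card Q)"
  have w': "w' = v + ?t" and vw': "v - w' = - ?t" using 1 by (simp_all add: algebra_simps)
  have "ngon (card Q) w' (v - w') = ngon (card Q) v (w - v)"
    using ngon_shift_back[OF F_ge2(1)[OF Q(2)], of v "w - v"]
    unfolding vw' unfolding w' minus_mult_left .
  moreover have "F w' (v - w') (card Q)"
    using F_prev[OF Q(2)] unfolding vw' unfolding w' .
  ultimately have "Q = ngon (card Q) w' (v - w')" "F w' (v - w') (card Q)"
    using Q(1) by (auto intro: trans[OF _ sym])
  then show "R = ngon (card R) v (w' - v)" "F v (w' - v) (card R)"
    using edge_side[OF PQR(3) e(4)] left PQR by metis+
qed

text \<open>Repeated use of \<open>fan_step\<close> puts the tiles in counterclockwise order. There
  are no other tiles at \<open>v\<close>, and by \<open>ngon_inject\<close> a tile has only one flag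
  at \<open>v\<close>, so the list is complete.\<close>

lemma fan4:
  assumes T': "A \<in> T" "B \<in> T" "C \<in> T" "D \<in> T" and dist: "A \<noteq> B" "A \<noteq> C" "A \<noteq> D" "B \<noteq> C" "B \<noteq> D" "C \<noteq> D"
    and all: "{Q \<in> T. v \<in> Q} = {A, B, C, D}"
    and e: "{v, w0} \<in> poly_edges A" "{v, w0} \<in> poly_edges B" "{v, w1} \<in> poly_edges B" "{v, w1} \<in> poly_edges C"
       "{v, w2} \<in> poly_edges C" "{v, w2} \<in> poly_edges D" "{v, w3} \<in> poly_edges D"
    and l: "B = ngon (card B) v (w0 - v)" "F v (w0 - v) (card B)" and w3: "{v, w3} \<in> poly_edges A"
  shows "vt v (w0 - v) [card B, card C, card D, card A]"
proof -
  note s1 = fan_step[OF T'(1,2,3) dist(1,4,2) e(1-4) l]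
  note s2 = fan_step[OF T'(2,3,4) dist(4,6,5) e(3-6) s1(2,3)]
  note s3 = fan_step[OF T'(3,4,1) dist(6) dist(3)[symmetric] dist(2)[symmetric] e(5-7) w3 s2(2,3)]
  have fl: "flags (w0 - v) [card B, card C, card D, card A] =
     {(w0 - v, card B), (w1 - v, card C), (w2 - v, card D), (w3 - v, card A)}"
    by (simp only: flags.simps s1(1) s2(1) s3(1))
  have "(a, m) \<in> flags (w0 - v) [card B, card C, card D, card A]" if F: "F v a m" for a m
  proof -
    have "v \<in> ngon m v a" using F_ge2[OF F] by (simp add: ngon_start)
    then have "ngon m v a \<in> {A, B, C, D}" using all F_ge2[OF F] by blast
    moreover have "a = b \<and> m = card Q" if "ngon m v a = Q" "Q = ngon (card Q) v b" "F v b (card Q)" for Q b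
    proof -
      have "m = card Q" using that F_card F by metis
      moreover from this have "ngon m v a = ngon m v b" using that by simp
      then have "a = b" using ngon_inject F_ge2[OF F] F_ge2[OF that(3)] by blast
      ultimately show ?thesis by simp
    qed
    ultimately show ?thesis using l s1 s2 s3 unfolding fl by blast
  qed
  then show ?thesis unfolding vt_def using l s1 s2 s3 unfolding fl by auto
qed

text \<open>The listing may run either way round. The edge shared by the first two tiles decides: if
  the second tile is on its left as seen from \<open>v\<close>, the list is counterclockwise;
  otherwise the first tile is, and the list is read backwards.\<close>

lemma has_vertex_type_vt:
  assumes "has_vertex_type T v [n0, n1, n2, n3]"
  obtains d where "d \<noteq> 0" "vt v d [n1, n2, n3, n0] \<or> vt v d [n0, n3, n2, n1]"
proof -
  obtain Ps where Ps: "distinct Ps" "set Ps = {P\<in>T. v \<in> P}" "length Ps = length [n0, n1, n2, n3]"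
     "\<forall>i < length Ps. \<exists>w. {v, w} \<in> poly_edges (Ps ! i) \<and> {v, w} \<in> poly_edges (Ps ! ((i + 1) mod length Ps))"
     "map card Ps = [n0, n1, n2, n3]"
    using assms unfolding has_vertex_type_def by (elim exE conjE)
  from Ps(3) obtain A B C D where L: "Ps = [A, B, C, D]"
    by (auto simp: numeral_eq_Suc length_Suc_conv)
  have "\<exists>w. {v, w} \<in> poly_edges A \<and> {v, w} \<in> poly_edges B" using Ps(4)[rule_format, of 0] by (simp add: L)
  then obtain w0 where w0: "{v, w0} \<in> poly_edges A" "{v, w0} \<in> poly_edges B" by (elim exE conjE)
  have "\<exists>w. {v, w} \<in> poly_edges B \<and> {v, w} \<in> poly_edges C" using Ps(4)[rule_format, of 1] by (simp add: L)
  then obtain w1 where w1: "{v, w1} \<in> poly_edges B" "{v, w1} \<in> poly_edges C" by (elim exE conjE)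
  have "\<exists>w. {v, w} \<in> poly_edges C \<and> {v, w} \<in> poly_edges D" using Ps(4)[rule_format, of 2] by (simp add: L)
  then obtain w2 where w2: "{v, w2} \<in> poly_edges C" "{v, w2} \<in> poly_edges D" by (elim exE conjE)
  have "\<exists>w. {v, w} \<in> poly_edges D \<and> {v, w} \<in> poly_edges A" using Ps(4)[rule_format, of 3] by (simp add: L)
  then obtain w3 where w3: "{v, w3} \<in> poly_edges D" "{v, w3} \<in> poly_edges A" by (elim exE conjE)
  have T: "A \<in> T" "B \<in> T" "C \<in> T" "D \<in> T" and D: "A \<noteq> B" "A \<noteq> C" "A \<noteq> D" "B \<noteq> C" "B \<noteq> D" "C \<noteq> D"
    using Ps(1,2) by (auto simp: L)
  have n: "n0 = card A" "n1 = card B" "n2 = card C" "n3 = card D" using Ps(5) by (auto simp: L)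
  have all: "{Q \<in> T. v \<in> Q} = {A, B, C, D}" using Ps(2) by (simp add: L)
  have "w0 \<noteq> v" using w0 by (auto simp: poly_edges_def doubleton_eq_iff)
  have "\<not> (A = ngon (card A) w0 (v - w0) \<and> F w0 (v - w0) (card A) \<and> B = ngon (card B) w0 (v - w0) \<and> F w0 (v - w0) (card B))"
    using F_unique D(1) by metis
  then have "(B = ngon (card B) v (w0 - v) \<and> F v (w0 - v) (card B)) \<or> (A = ngon (card A) v (w0 - v) \<and> F v (w0 - v) (card A))"
    using edge_side[OF T(1) w0(1)] edge_side[OF T(2) w0(2)] by blast
  then show thesis
  proof (elim disjE conjE)
    assume *: "B = ngon (card B) v (w0 - v)" "F v (w0 - v) (card B)"
    have "vt v (w0 - v) [n1, n2, n3, n0]"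
      unfolding n by (rule fan4[OF T D all w0 w1 w2 w3(1) * w3(2)])
    then show thesis using that[of "w0 - v"] \<open>w0 \<noteq> v\<close> by simp
  next
    assume *: "A = ngon (card A) v (w0 - v)" "F v (w0 - v) (card A)"
    have all': "{Q \<in> T. v \<in> Q} = {B, A, D, C}" using all by auto
    have "vt v (w0 - v) [n0, n3, n2, n1]"
      unfolding n by (rule fan4[OF T(2,1,4,3) D(1)[symmetric] D(5,4,3,2) D(6)[symmetric] all' w0(2,1) w3(2,1) w2(2,1) w1(2) * w1(1)])
    then show thesis using that[of "w0 - v"] \<open>w0 \<noteq> v\<close> by simp
  qed
qed

lemma turn_simps: "d * (1 - \<zeta>) * \<zeta> = d" "d * \<i> * \<i> = -d" "d * \<i> * (\<zeta> - 1) * \<i> = d * (1 - \<zeta>)"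
  by (simp_all add: algebra_simps zeta_sq)

lemma type_A: assumes "has_vertex_type T v [3, 4, 4, 6]"
  obtains d where "d \<noteq> 0" "vt v d typeAp \<or> vt v d typeAm"
proof -
  obtain d where d: "d \<noteq> 0" "vt v d [4, 4, 6, 3] \<or> vt v d [3, 6, 4, 4]"
    using has_vertex_type_vt[OF assms] by blast
  \<comment> \<open>\<open>1 - \<zeta>\<close> is the inverse of \<open>\<zeta> = turn 3\<close>:
    stepping back over the triangle brings it to the front.\<close>
  have "flags d [4, 4, 6, 3] = flags (d * (1 - \<zeta>)) typeAp"
    by (simp add: turn_values turn_simps algebra_simps zeta_sq insert_commute)
  moreover have "d * (1 - \<zeta>) \<noteq> 0" using d rou_ne_1[of 6] by simp
  ultimately show thesis using that d unfolding vt_def by metis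
qed

lemma type_B: assumes "has_vertex_type T v [3, 4, 6, 4]"
  obtains d where "d \<noteq> 0" "vt v d typeB"
proof -
  obtain d where d: "d \<noteq> 0" "vt v d [4, 6, 4, 3] \<or> vt v d [3, 4, 6, 4]"
    using has_vertex_type_vt[OF assms] by blast
  have "flags d [4, 6, 4, 3] = flags (d * (1 - \<zeta>)) typeB"
    by (simp add: turn_values turn_simps algebra_simps zeta_sq insert_commute)
  moreover have "d * (1 - \<zeta>) \<noteq> 0" using d rou_ne_1[of 6] by simp
  ultimately show thesis using that d unfolding vt_def by metis
qed

end

section \<open>Tiles sharing vertices\<close>

lemma flags_norm: "(e, m) \<in> flags d X \<Longrightarrow> norm e = norm d"
  by (induction X arbitrary: d) (auto simp: norm_mult)

context tiling_346 begin

lemma vertex_vt: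
  assumes "v \<in> tiling_vertices T"
  obtains d X where "d \<noteq> 0" "vt v d X" "X \<in> {typeAp, typeAm, typeB}"
  using vertex_types[OF assms] type_A[of v] type_B[of v] by (metis insertCI)

lemma fan_cover:
  assumes "flags d ns \<subseteq> {(e, m). F v e m}" "0 \<le> t" "t < sum_list (map angle ns)" "0 \<le> \<rho>" "\<rho> \<le> 7 / 10"
  shows "\<exists>Q\<in>T. v \<in> Q \<and> v + d * (of_real \<rho> * cis t) \<in> convex hull Q"
  using assms
proof (induction ns arbitrary: d t)
  case (Cons n ns)
  have F: "F v d n" using Cons.prems by auto
  show ?case
  proof (cases "t \<le> angle n")
    case True
    then show ?thesis using F_ge2[OF F] ngon_sector[of n t \<rho> v d] Cons.prems ngon_start[of n v d] by auto
  next
    case False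
    have "\<exists>Q\<in>T. v \<in> Q \<and> v + d * turn n * (of_real \<rho> * cis (t - angle n)) \<in> convex hull Q"
      using Cons.prems False by (intro Cons.IH) auto
    moreover have "turn n * cis (t - angle n) = cis t" by (simp add: cis_mult flip: cis_angle)
    then have "d * turn n * (of_real \<rho> * cis (t - angle n)) = d * (of_real \<rho> * cis t)"
      by (metis mult.assoc mult.left_commute)
    ultimately show ?thesis by simp
  qed
qed simp

text \<open>The interior angles of each type add up to \<open>2 * pi\<close>, so the sectors of the
  tiles at \<open>v\<close> fill a disc.\<close>

lemma star_cover:
  assumes "vt v d X" "d \<noteq> 0" "X \<in> {typeAp, typeAm, typeB}" "dist v y \<le> 7 / 10 * norm d"
  shows "\<exists>Q\<in>T. v \<in> Q \<and> y \<in> convex hull Q"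
proof -
  define w where "w = (y - v) / d"
  have y: "y = v + d * w" using assms by (simp add: w_def)
  have w: "w = of_real (norm w) * cis (Arg2pi w)" using Arg2pi_eq[of w] by (simp add: cis_conv_exp)
  have "norm w \<le> 7 / 10" using assms by (simp add: w_def norm_divide dist_norm norm_minus_commute field_simps)
  moreover have "Arg2pi w < sum_list (map angle X)"
    using assms(3) Arg2pi_lt_2pi[of w] by (auto simp: angle_values)
  ultimately show ?thesis
    using fan_cover[of d X v "Arg2pi w" "norm w"] assms(1) Arg2pi_ge_0[of w] w unfolding y vt_def by simp
qed

lemma tile_interior: "F v d n \<Longrightarrow> v + d * (1/2 + \<i>/8) \<in> interior (convex hull (ngon n v d))"
  by (intro witness_interior) (auto simp: F_def)

lemma interior_tile: assumes "P \<in> T" shows "interior (convex hull P) \<noteq> {}"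
proof -
  obtain n v d where P: "d \<noteq> 0" "P = ngon n v d" "n \<ge> 3" by (rule tile_ngon_any[OF assms])
  then have "F v d n" unfolding F_def using tile_card[OF assms] card_ngon[of n d v] assms by auto
  from tile_interior[OF this] show ?thesis unfolding P(2) by blast
qed

lemma near_corner:
  assumes F: "F v d n" and z: "z \<in> frontier (convex hull (ngon n v d))"
  shows "\<exists>u\<in>ngon n v d. dist u z \<le> norm d / 2"
proof -
  let ?P = "ngon n v d"
  obtain a b where ab: "{a, b} \<in> poly_edges ?P" "z \<in> closed_segment a b"
    using frontier_polygon_face[OF finite_ngon _ z] tile_interior[OF F] by (metis empty_iff)
  have P: "?P \<in> T" "card ?P = n" using F_ge2[OF F] F_card[OF F] by auto
  have n2: "n \<ge> 2" using F_ge2[OF F] by simp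
  have mem: "a \<in> ?P" "b \<in> ?P" using ab unfolding poly_edges_def by (auto simp: doubleton_eq_iff)
  have norm: "norm (y - x) = norm d" if h: "?P = ngon n x (y - x)" "F x (y - x) n" "x \<in> ?P" for x y
  proof -
    obtain e where e: "norm e = norm d" "ngon n x e = ?P" using ngon_corner[OF n2 h(3)] .
    have "e \<noteq> 0" using e F_ge2[OF F] by (metis norm_eq_zero)
    have "e = y - x" by (rule ngon_inject[OF n2 \<open>e \<noteq> 0\<close> F_ge2(3)[OF h(2)] trans[OF e(2) h(1)]])
    with e show ?thesis by simp
  qed
  have "norm (b - a) = norm d"
    using edge_side[OF P(1) ab(1)] norm mem unfolding P(2) by (metis norm_minus_commute)
  moreover have "dist a b = dist a z + dist z b"
    using ab(2) by (simp add: between flip: between_mem_segment)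
  ultimately have "dist a z + dist b z = norm d" by (simp add: dist_norm norm_minus_commute)
  then have "dist a z \<le> norm d / 2 \<or> dist b z \<le> norm d / 2" by linarith
  with mem show ?thesis by blast
qed

text \<open>The edges of all flags at the common corner are rotations of one another.\<close>

lemma tiles_share_side:
  assumes "F v d n" "F u e m" "x \<in> ngon n v d" "x \<in> ngon m u e"
  shows "norm d = norm e"
proof -
  have "x \<in> tiling_vertices T" using assms(1,3) F_ge2 tile_vertex by blast
  then obtain d0 X where X: "vt x d0 X" using vertex_vt by metis
  have "norm d = norm d0" if h: "F v d n" "x \<in> ngon n v d" for v d n
  proof -
    obtain e where e: "norm e = norm d" "ngon n x e = ngon n v d" using ngon_corner[OF F_ge2(1)[OF h(1)] h(2)] .
    have "e \<noteq> 0" using e F_ge2[OF h(1)] by (metis norm_eq_zero)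
    then have "F x e n" using h(1) e unfolding F_def by simp
    then have "(e, n) \<in> flags d0 X" using X unfolding vt_def by auto
    with e flags_norm show ?thesis by metis
  qed
  from this[OF assms(1,3)] this[OF assms(2,4)] show ?thesis by simp
qed

text \<open>Connectedness of the plane: the union \<open>W\<close> of the selected tiles contains
  with each point a disc of fixed radius, so \<open>W\<close> and its complement are open. A tile
  that is not selected would then overlap the interior of a selected one.\<close>

lemma sharing_closed_eq_T:
  assumes ST: "S \<subseteq> T" and ne: "S \<noteq> {}"
    and cl: "\<And>P Q. P \<in> S \<Longrightarrow> Q \<in> T \<Longrightarrow> P \<inter> Q \<noteq> {} \<Longrightarrow> Q \<in> S"
  shows "S = T"
proof -
  obtain P0 where P0: "P0 \<in> S" using ne by blast
  obtain n0 v0 d0 where "d0 \<noteq> 0" "P0 = ngon n0 v0 d0" "n0 \<ge> 3" using tile_ngon_any P0 ST by blast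
  define s where "s = norm d0"
  have s: "s > 0" using \<open>d0 \<noteq> 0\<close> by (simp add: s_def)
  \<comment> \<open>A common side length makes the radius uniform; that all tiles have it is derived
    afterwards from this lemma. Tiles sharing a corner have equal sides, so the restricted family is
    still closed.\<close>
  define S' where "S' = {Q \<in> S. \<exists>v d n. F v d n \<and> Q = ngon n v d \<and> norm d = s}"
  have "F v0 d0 n0" unfolding F_def
    using \<open>d0 \<noteq> 0\<close> \<open>P0 = ngon n0 v0 d0\<close> \<open>n0 \<ge> 3\<close> P0 ST tile_card[of P0] card_ngon[of n0 d0 v0] by auto
  then have P0': "P0 \<in> S'" using P0 \<open>P0 = ngon n0 v0 d0\<close> by (auto simp: S'_def s_def)
  have cl': "Q \<in> S'" if PQ: "P \<in> S'" "Q \<in> T" "x \<in> P" "x \<in> Q" for P Q x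
  proof -
    obtain v d n where P: "F v d n" "P = ngon n v d" "norm d = s" using PQ(1) unfolding S'_def by blast
    obtain e where Q: "Q = ngon (card Q) x e" "F x e (card Q)" using tile_F[OF PQ(2,4)] .
    have "x \<in> ngon (card Q) x e" by (subst Q(1)[symmetric]) (rule PQ(4))
    with tiles_share_side[OF P(1) Q(2)] P PQ(3) have "norm e = s" by simp
    moreover have "Q \<in> S" using cl[of P Q] PQ unfolding S'_def by blast
    ultimately show ?thesis unfolding S'_def using Q by blast
  qed
  define W where "W = (\<Union>Q\<in>S'. convex hull Q)"
  \<comment> \<open>\<open>1/2 + 1/5 = 7/10\<close>: a segment shorter than \<open>s / 5\<close>
    that leaves \<open>Q\<close> crosses an edge at distance at most \<open>s / 2\<close> from a
    corner, so its end stays in the disc covered by the tiles at that corner.\<close>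
  have nbhd: "y \<in> W" if x: "x \<in> W" and xy: "dist x y < s / 5" for x y
  proof -
    obtain Q where Q: "Q \<in> S'" "x \<in> convex hull Q" using x unfolding W_def by blast
    show ?thesis
    proof (cases "y \<in> convex hull Q")
      case True with Q show ?thesis by (auto simp: W_def)
    next
      case False
      have "closed_segment x y \<inter> frontier (convex hull Q) \<noteq> {}"
        by (rule connected_Int_frontier) (use Q False in auto)
      then obtain z where z: "z \<in> closed_segment x y" "z \<in> frontier (convex hull Q)" by blast
      obtain v d n where vdn: "F v d n" "Q = ngon n v d" "norm d = s" using Q(1) unfolding S'_def by blast
      obtain u where u: "u \<in> Q" "dist u z \<le> s / 2" using near_corner[OF vdn(1)] z vdn by blast
      have "dist z y \<le> dist x y" using z(1) dist_in_closed_segment by blast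
      then have uy: "dist u y \<le> 7 / 10 * s" using u(2) xy dist_triangle[of u y z] by linarith
      have QT: "Q \<in> T" using Q(1) ST unfolding S'_def by blast
      then obtain d' X where X: "d' \<noteq> 0" "vt u d' X" "X \<in> {typeAp, typeAm, typeB}"
        using vertex_vt[OF tile_vertex[OF _ u(1)]] by blast
      have "norm d' = s"
      proof -
        have "F u d' 3" using X(2,3) unfolding vt_def by auto
        moreover from this have "u \<in> ngon 3 u d'" by (simp add: ngon_start)
        ultimately show ?thesis using tiles_share_side[OF vdn(1)] u(1) vdn by metis
      qed
      with star_cover[OF X(2,1,3), of y] uy obtain R where R: "R \<in> T" "u \<in> R" "y \<in> convex hull R" by auto
      then have "R \<in> S'" using cl' Q(1) u(1) by blast
      with R show ?thesis by (auto simp: W_def)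
    qed
  qed
  have "open W" unfolding open_contains_ball using nbhd s by (metis divide_pos_pos mem_ball subsetI zero_less_numeral)
  moreover have "open (- W)" unfolding open_contains_ball
  proof
    fix x assume "x \<in> - W"
    then have "ball x (s / 5) \<subseteq> - W" using nbhd by (auto simp: dist_commute)
    then show "\<exists>e>0. ball x e \<subseteq> - W" using s by (intro exI[of _ "s / 5"]) auto
  qed
  moreover have "W \<noteq> {}"
  proof -
    have "P0 \<noteq> {}" using \<open>P0 = ngon n0 v0 d0\<close> \<open>n0 \<ge> 3\<close> ngon_start[of n0 v0 d0] by auto
    then show ?thesis using P0' unfolding W_def by auto
  qed
  ultimately have W: "W = UNIV" using clopen[of W] by (auto simp: closed_def)
  have "Q \<in> S" if Q: "Q \<in> T" for Q
  proof -
    note int = interior_tile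
    from int[OF Q] obtain x where x: "x \<in> interior (convex hull Q)" by blast
    obtain P where P: "P \<in> S'" "x \<in> convex hull P" using W unfolding W_def by blast
    have PT: "P \<in> T" using P ST unfolding S'_def by blast
    have "convex hull P \<subseteq> closure (interior (convex hull P))"
      using convex_closure_interior[OF convex_convex_hull int[OF PT]] closure_subset by metis
    then have "interior (convex hull Q) \<inter> interior (convex hull P) \<noteq> {}"
      using x P(2) open_Int_closure_eq_empty[of "interior (convex hull Q)"] by blast
    then have "P = Q" using tiles_interior Q PT by blast
    with P show ?thesis unfolding S'_def by blast
  qed
  with ST show ?thesis by blast
qed

lemma side_unique:
  assumes "F v d n" "F u e m" shows "norm d = norm e"
proof -
  define S where "S = {P. \<exists>v' d' n'. F v' d' n' \<and> P = ngon n' v' d' \<and> norm d' = norm d}"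
  have "S = T"
  proof (rule sharing_closed_eq_T)
    show "S \<subseteq> T" unfolding S_def using F_ge2 by blast
    show "S \<noteq> {}" unfolding S_def using assms(1) by blast
    fix P Q assume PQ: "P \<in> S" "Q \<in> T" "P \<inter> Q \<noteq> {}"
    then obtain x where x: "x \<in> P" "x \<in> Q" by blast
    obtain v' d' n' where P: "F v' d' n'" "P = ngon n' v' d'" "norm d' = norm d" using PQ unfolding S_def by blast
    obtain e' where Q: "Q = ngon (card Q) x e'" "F x e' (card Q)" using tile_F[OF PQ(2) x(2)] .
    have "x \<in> ngon (card Q) x e'" by (subst Q(1)[symmetric]) (rule x(2))
    then have "norm e' = norm d" using tiles_share_side[OF P(1) Q(2)] P x by simp
    with Q show "Q \<in> S" unfolding S_def by blast
  qed
  then have "ngon m u e \<in> S" using F_ge2(4)[OF assms(2)] by simp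
  then obtain v' d' n' where *: "F v' d' n'" "ngon m u e = ngon n' v' d'" "norm d' = norm d" unfolding S_def by blast
  have "u \<in> ngon m u e" using F_ge2[OF assms(2)] by (simp add: ngon_start)
  then show ?thesis using tiles_share_side[OF *(1) assms(2), of u] * by simp
qed

end

section \<open>Propagation of vertex types\<close>

lemma zi_neq [simp]: "\<zeta> \<noteq> 0" "\<zeta> \<noteq> 1" "\<zeta> \<noteq> -1" "\<zeta> \<noteq> \<i>" "\<zeta> \<noteq> - \<i>" 
  using rou_ne_1[of 6] by (auto simp: rou_values complex_eq_iff real_sqrt_eq_iff)

text \<open>A multiple of 60 degrees is not an odd multiple of 30 degrees; this rules out a second
  hexagon at a vertex below.\<close>

lemma zi_neq': "\<zeta> - 1 \<noteq> - (\<zeta> * \<i>)" "1 \<noteq> \<i> * \<zeta>"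
proof -
  have "sqrt (3::real) \<noteq> -1" using real_sqrt_ge_zero[of 3] by linarith
  then show "\<zeta> - 1 \<noteq> - (\<zeta> * \<i>)" "1 \<noteq> \<i> * \<zeta>" by (auto simp: rou_values complex_eq_iff)
qed

text \<open>Rewriting \<open>\<zeta> * \<zeta>\<close> to \<open>\<zeta> - 1\<close> brings every
  polynomial in \<open>\<zeta>\<close> to degree at most 1.\<close>

lemmas zs = algebra_simps zeta_sq zeta_sq'

lemma flags_Ap: "flags d typeAp = {(d, 3), (d * \<zeta>, 4), (d * \<zeta> * \<i>, 4), (- (d * \<zeta>), 6)}"
  by (simp add: turn_values zs)

lemma flags_Am: "flags d typeAm = {(d, 3), (d * \<zeta>, 6), (- d, 4), (- (d * \<i>), 4)}"
  by (simp add: turn_values zs)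

lemma flags_B: "flags d typeB = {(d, 3), (d * \<zeta>, 4), (d * \<zeta> * \<i>, 6), (- (d * \<i>), 4)}"
  by (simp add: turn_values zs)

declare flags.simps [simp del]

context tiling_346 begin

lemma vt_F: "vt v d X \<Longrightarrow> F v e m \<longleftrightarrow> (e, m) \<in> flags d X"
  unfolding vt_def by auto

lemma vt_nz: assumes "vt v d X" "X \<in> {typeAp, typeAm, typeB}" shows "d \<noteq> 0"
proof -
  have "F v d 3" using assms(2) by (auto simp: vt_F[OF assms(1)] flags_Ap flags_Am flags_B)
  then show ?thesis by (simp add: F_ge2)
qed

lemma FAp: assumes "vt v d typeAp" shows "F v d 3" "F v (d * \<zeta>) 4" "F v (d * \<zeta> * \<i>) 4" "F v (- (d * \<zeta>)) 6"
  using vt_F[OF assms] by (auto simp: flags_Ap)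

lemma FAm: assumes "vt v d typeAm" shows "F v d 3" "F v (d * \<zeta>) 6" "F v (- d) 4" "F v (- (d * \<i>)) 4"
  using vt_F[OF assms] by (auto simp: flags_Am)

lemma FB: assumes "vt v d typeB" shows "F v d 3" "F v (d * \<zeta>) 4" "F v (d * \<zeta> * \<i>) 6" "F v (- (d * \<i>)) 4"
  using vt_F[OF assms] by (auto simp: flags_B)

lemma vt_unique:
  assumes "vt v d X" "vt v e Y" "X \<in> {typeAp, typeAm, typeB}" "Y \<in> {typeAp, typeAm, typeB}"
  shows "d = e" "X = Y"
proof -
  have nz: "d \<noteq> 0" using vt_nz assms by blast
  have "F v e 3" using assms(4) by (auto simp: vt_F[OF assms(2)] flags_Ap flags_Am flags_B)
  then have "(e, 3) \<in> flags d X" using vt_F[OF assms(1)] by blast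
  then show de: "d = e" using assms(3) by (auto simp: flags_Ap flags_Am flags_B)
  note vX = assms(1) and vY = assms(2)[folded de]
  show "X = Y"
  proof (rule ccontr)
    assume "X \<noteq> Y"
    with assms(3,4) consider "X = typeAp" "Y = typeAm" | "X = typeAp" "Y = typeB" | "X = typeAm" "Y = typeAp"
      | "X = typeAm" "Y = typeB" | "X = typeB" "Y = typeAp" | "X = typeB" "Y = typeAm" by blast
    then show False
      using vX vY F_unique[of v "d * \<zeta>" 4 6] F_unique[of v "d * \<zeta> * \<i>" 4 6] by cases (auto dest: FAp FAm FB)
  qed
qed

lemma F_types:
  assumes "F v e m" obtains d X where "vt v d X" "X \<in> {typeAp, typeAm, typeB}"
proof -
  have "v \<in> ngon m v e" using F_ge2[OF assms] by (simp add: ngon_start)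
  then have "v \<in> tiling_vertices T" using tile_vertex F_ge2[OF assms] by blast
  then show thesis using vertex_vt that by metis
qed

lemma F3_types:
  assumes "F v d 3" shows "vt v d typeAp \<or> vt v d typeAm \<or> vt v d typeB"
proof -
  obtain e X where X: "vt v e X" "X \<in> {typeAp, typeAm, typeB}" using F_types[OF assms] .
  then have "e = d" using assms by (auto simp: vt_F[OF X(1)] flags_Ap flags_Am flags_B)
  with X show ?thesis by auto
qed

lemma F6_types:
  assumes "F v e 6" shows "vt v (e * (\<zeta> - 1)) typeAp \<or> vt v (e * (1 - \<zeta>)) typeAm \<or> vt v (\<i> * e * (\<zeta> - 1)) typeB"
proof -
  obtain d X where X: "vt v d X" "X \<in> {typeAp, typeAm, typeB}" using F_types[OF assms] .
  from X(2) show ?thesis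
  proof (elim insertE emptyE)
    assume "X = typeAp"
    then have "e = - (d * \<zeta>)" using assms by (auto simp: vt_F[OF X(1)] flags_Ap)
    then have "e * (\<zeta> - 1) = d" by (simp add: zs)
    with X \<open>X = _\<close> show ?thesis by auto
  next
    assume "X = typeAm"
    then have "e = d * \<zeta>" using assms by (auto simp: vt_F[OF X(1)] flags_Am)
    then have "e * (1 - \<zeta>) = d" by (simp add: zs)
    with X \<open>X = _\<close> show ?thesis by auto
  next
    assume "X = typeB"
    then have "e = d * \<zeta> * \<i>" using assms by (auto simp: vt_F[OF X(1)] flags_B)
    then have "\<i> * e * (\<zeta> - 1) = d" by (simp add: zs)
    with X \<open>X = _\<close> show ?thesis by auto
  qed
qed

text \<open>In \<open>typeB\<close> the two squares are separated by the triangle and the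
  hexagon.\<close>

lemma F44_types:
  assumes "F v e 4" "F v (e * \<i>) 4" shows "vt v (- e) typeAm \<or> vt v (e * (1 - \<zeta>)) typeAp"
proof -
  obtain d X where X: "vt v d X" "X \<in> {typeAp, typeAm, typeB}" using F_types[OF assms(1)] .
  have nz: "d \<noteq> 0" using vt_nz X by blast
  from X(2) show ?thesis
  proof (elim insertE emptyE)
    assume "X = typeAp"
    then have "e = d * \<zeta>" using assms nz by (auto simp: vt_F[OF X(1)] flags_Ap)
    then have "e * (1 - \<zeta>) = d" by (simp add: zs)
    with X \<open>X = _\<close> show ?thesis by auto
  next
    assume "X = typeAm"
    then have "e = - d" using assms nz by (auto simp: vt_F[OF X(1)] flags_Am)
    with X \<open>X = _\<close> show ?thesis by auto
  next
    assume "X = typeB"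
    have "d * \<zeta> * \<i> + d * \<i> = d * \<i> * (\<zeta> + 1)" by (simp add: algebra_simps)
    moreover have "\<zeta> + 1 \<noteq> 0" by (simp add: rou_values complex_eq_iff)
    ultimately have "d * \<zeta> * \<i> \<noteq> - (d * \<i>)" using nz by (simp add: eq_neg_iff_add_eq_0)
    moreover have "- (d * \<i> * \<i>) \<noteq> d * \<zeta>" using nz by (simp add: mult.assoc)
    ultimately have False using \<open>X = _\<close> assms nz by (auto simp: vt_F[OF X(1)] flags_B)
    then show ?thesis ..
  qed
qed

lemma F6_unique: assumes "F v e 6" "F v e' 6" shows "e = e'"
proof -
  obtain d X where X: "vt v d X" "X \<in> {typeAp, typeAm, typeB}" using F_types[OF assms(1)] .
  then show ?thesis using assms by (auto simp: vt_F[OF X(1)] flags_Ap flags_Am flags_B)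
qed

lemma F_next': "F v d n \<Longrightarrow> w = v + d \<Longrightarrow> e = d * rou n \<Longrightarrow> F w e n"
  using F_next by simp

lemma F_prev': "F v d n \<Longrightarrow> w = v + d * turn n \<Longrightarrow> e = - (d * turn n) \<Longrightarrow> F w e n"
  using F_prev by simp

lemma F_clash: "F v d n \<Longrightarrow> F v e m \<Longrightarrow> d = e \<Longrightarrow> n \<noteq> m \<Longrightarrow> False"
  using F_unique by blast

section \<open>Neighbours of a vertex and their oriented types\<close>

lemmas rt = turn_values rou_values(1) rou_3

text \<open>At \<open>v + d\<close> the triangle is followed counterclockwise by the hexagon across
  the edge from \<open>v\<close>, and only \<open>typeAm\<close> has \<open>6\<close> right after
  \<open>3\<close>.\<close>

lemma Ap_nb1: assumes "vt v d typeAp" shows "vt (v + d) (d * (\<zeta> - 1)) typeAm"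
proof -
  have a: "F (v + d) (d * (\<zeta> - 1)) 3" by (rule F_next'[OF FAp(1)[OF assms]]) (simp_all add: rt)
  have b: "F (v + d) (- d) 6" by (rule F_prev'[OF FAp(4)[OF assms]]) (simp_all add: rt zs)
  show ?thesis using F3_types[OF a]
  proof (elim disjE)
    assume "vt (v + d) (d * (\<zeta> - 1)) typeAp"
    from F_clash[OF FAp(2)[OF this] b] show ?thesis by (simp add: zs)
  next
    assume "vt (v + d) (d * (\<zeta> - 1)) typeB"
    from F_clash[OF FB(2)[OF this] b] show ?thesis by (simp add: zs)
  qed
qed

text \<open>The mirror image of the preceding situation: the hexagon across the edge comes just
  before the triangle, where the other two types have a square.\<close>

lemma Am_nb1: assumes "vt v d typeAm" shows "vt (v + d * \<zeta>) (- (d * \<zeta>)) typeAp"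
proof -
  let ?x = "v + d * \<zeta>"
  have a: "F ?x (- (d * \<zeta>)) 3" by (rule F_prev'[OF FAm(1)[OF assms]]) (simp_all add: rt)
  have "False" if "F ?x (d * \<zeta> * \<i>) 4"
    by (rule F_clash[OF FAm(2)[OF assms] F_prev'[OF that]]) (simp_all add: rt zs)
  then show ?thesis using F3_types[OF a] FAm(4)[of ?x "- (d * \<zeta>)"] FB(4)[of ?x "- (d * \<zeta>)"] by auto
qed

text \<open>\<open>typeAp\<close> at this corner would make the third corner \<open>typeAm\<close>
  by \<open>Ap_nb1\<close>, but that one is \<open>typeAp\<close> by \<open>Am_nb1\<close>. Thus the
  triangle has one corner of each oriented type.\<close>

lemma Am_nb2: assumes "vt v d typeAm" shows "vt (v + d) (d * (\<zeta> - 1)) typeB"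
proof -
  have a: "F (v + d) (d * (\<zeta> - 1)) 3" by (rule F_next'[OF FAm(1)[OF assms]]) (simp_all add: rt)
  have b: "F (v + d) (- d) 4" by (rule F_prev'[OF FAm(4)[OF assms]]) (simp_all add: rt zs)
  show ?thesis using F3_types[OF a]
  proof (elim disjE)
    assume "vt (v + d) (d * (\<zeta> - 1)) typeAp"
    from Ap_nb1[OF this] have "vt (v + d * \<zeta>) (- (d * \<zeta>)) typeAm" by (simp add: zs)
    from vt_unique(2)[OF this Am_nb1[OF assms]] show ?thesis by simp
  next
    assume "vt (v + d) (d * (\<zeta> - 1)) typeAm"
    from F_clash[OF FAm(2)[OF this] b] show ?thesis by (simp add: zs)
  qed
qed

lemma Ap_nb2: assumes "vt v d typeAp" shows "vt (v + d * \<zeta>) (- (d * \<zeta>)) typeB"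
  using Am_nb2[OF Ap_nb1[OF assms]] by (simp add: zs)

text \<open>Two squares meet at the far end as well. With the wrong orientation, that end would put
  a hexagon at the corner \<open>v + d * \<zeta> + d * \<zeta> * \<i>\<close> of the square, which
  already belongs to the hexagon of the \<open>typeB\<close> vertex \<open>v + d * \<zeta>\<close>;
  no vertex has two.\<close>

lemma Ap_nb3: assumes "vt v d typeAp" shows "vt (v + d * \<zeta> * \<i>) (d * \<zeta>) typeAm"
proof -
  let ?w = "v + d * \<zeta> * \<i>"
  have nz: "d \<noteq> 0" using vt_nz[OF assms] by simp
  have a: "F ?w (- (d * \<zeta>)) 4" by (rule F_next'[OF FAp(3)[OF assms]]) (simp_all add: rt zs)
  have b: "F ?w (- (d * \<zeta>) * \<i>) 4" by (rule F_prev'[OF FAp(2)[OF assms]]) (simp_all add: rt zs)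
  show ?thesis using F44_types[OF a b]
  proof
    assume "vt ?w (- (d * \<zeta>) * (1 - \<zeta>)) typeAp"
    from FAp(4)[OF this] have "F (?w + d * \<zeta>) (d * (\<zeta> - 1)) 6"
      by (rule F_next') (simp_all add: zs)
    moreover have "F (?w + d * \<zeta>) (- (d * \<zeta> * \<i>)) 6"
      by (rule F_prev'[OF FB(3)[OF Ap_nb2[OF assms]]]) (simp_all add: rt zs)
    ultimately have "d * (\<zeta> - 1) = - (d * \<zeta> * \<i>)" by (rule F6_unique)
    then have "d * (\<zeta> - 1) = d * - (\<zeta> * \<i>)" by (simp only: mult_minus_right mult.assoc)
    then have "\<zeta> - 1 = - (\<zeta> * \<i>)" by (rule mult_left_cancel[OF nz, THEN iffD1])
    then show ?thesis using zi_neq' by blast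
  qed simp
qed

lemma Am_nb3: assumes "vt v d typeAm" shows "vt (v - d * \<i>) (d * (1 - \<zeta>)) typeAp"
proof -
  let ?w = "v - d * \<i>"
  have nz: "d \<noteq> 0" using vt_nz[OF assms] by simp
  have a: "F ?w d 4" by (rule F_next'[OF FAm(4)[OF assms]]) (simp_all add: rt zs)
  have b: "F ?w (d * \<i>) 4" by (rule F_prev'[OF FAm(3)[OF assms]]) (simp_all add: rt zs)
  show ?thesis using F44_types[OF a b]
  proof
    assume "vt ?w (- d) typeAm"
    from FAm(2)[OF this] have "F (?w + d) (- d) 6"
      by (rule F_prev') (simp_all add: rt zs)
    moreover have "F (?w + d) (- (d * \<i> * \<zeta>)) 6"
      by (rule F_next'[OF FB(3)[OF Am_nb2[OF assms]]]) (simp_all add: zs)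
    ultimately have "- d = - (d * \<i> * \<zeta>)" by (rule F6_unique)
    then have "d * 1 = d * (\<i> * \<zeta>)" by (simp add: mult.assoc)
    then have "1 = \<i> * \<zeta>" by (rule mult_left_cancel[OF nz, THEN iffD1])
    then show ?thesis using zi_neq' by blast
  qed simp
qed

text \<open>A triangle with a corner of type \<open>[3, 4, 4, 6]\<close> has exactly two of them, so the excluded triangles
  are those with three corners of type \<open>[3, 4, 6, 4]\<close>. Without them every vertex determines its neighbours.\<close>
definition no_BBB :: bool where
  "no_BBB \<longleftrightarrow> (\<forall>v d. vt v d typeB \<longrightarrow> \<not> vt (v + d) (d * (\<zeta> - 1)) typeB)"

context assumes H: no_BBB begin

lemma B_nb1: assumes "vt v d typeB" shows "vt (v + d) (d * (\<zeta> - 1)) typeAp"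
proof -
  have a: "F (v + d) (d * (\<zeta> - 1)) 3" by (rule F_next'[OF FB(1)[OF assms]]) (simp_all add: rt)
  have b: "F (v + d) (- d) 4" by (rule F_prev'[OF FB(4)[OF assms]]) (simp_all add: rt zs)
  show ?thesis using F3_types[OF a]
  proof (elim disjE)
    assume "vt (v + d) (d * (\<zeta> - 1)) typeAm"
    from F_clash[OF FAm(2)[OF this] b] show ?thesis by (simp add: zs)
  next
    assume "vt (v + d) (d * (\<zeta> - 1)) typeB"
    with H assms show ?thesis unfolding no_BBB_def by blast
  qed
qed

lemma B_nb2: assumes "vt v d typeB" shows "vt (v + d * \<zeta>) (- (d * \<zeta>)) typeAm"
  using Ap_nb1[OF B_nb1[OF assms]] by (simp add: zs)

text \<open>The other three sides of the square lead from \<open>v\<close> to this neighbour through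
  vertices whose types are already known.\<close>

lemma B_nb3: assumes "vt v d typeB" shows "vt (v + d * \<zeta> * \<i>) (d * \<zeta>) typeB"
  using Ap_nb2[OF Am_nb3[OF B_nb2[OF assms]]] by (simp add: zs)

lemma B_nb4: assumes "vt v d typeB" shows "vt (v - d * \<i>) (d * (1 - \<zeta>)) typeB"
  using Am_nb2[OF Ap_nb3[OF B_nb1[OF assms]]] by (simp add: zs)

text \<open>The edge separates a square from a hexagon. At its far end \<open>typeAp\<close> would
  have the triangle in place of the square, and \<open>typeB\<close> would propagate back by
  \<open>B_nb4\<close> and make \<open>v\<close> a \<open>typeB\<close> vertex.\<close>

lemma Ap_nb4: assumes "vt v d typeAp" shows "vt (v - d * \<zeta>) (- (d * \<zeta>)) typeAm"
proof -
  let ?w = "v - d * \<zeta>"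
  have a: "F ?w (d * (1 - \<zeta>)) 6" by (rule F_next'[OF FAp(4)[OF assms]]) (simp_all add: zs)
  have b: "F ?w (d * \<zeta>) 4" by (rule F_prev'[OF FAp(3)[OF assms]]) (simp_all add: rt zs)
  show ?thesis using F6_types[OF a]
  proof (elim disjE)
    assume "vt ?w (d * (1 - \<zeta>) * (\<zeta> - 1)) typeAp"
    from F_clash[OF FAp(1)[OF this] b] show ?thesis by (simp add: zs)
  next
    assume "vt ?w (d * (1 - \<zeta>) * (1 - \<zeta>)) typeAm"
    then show ?thesis by (simp add: zs)
  next
    assume "vt ?w (\<i> * (d * (1 - \<zeta>)) * (\<zeta> - 1)) typeB"
    from B_nb4[OF this] have "vt v (d * \<i>) typeB" by (simp add: zs)
    from vt_unique(2)[OF this assms] show ?thesis by simp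
  qed
qed

lemma Am_nb4: assumes "vt v d typeAm" shows "vt (v - d) (d * (\<zeta> - 1)) typeAp"
proof -
  let ?w = "v - d"
  have a: "F ?w d 6" by (rule F_prev'[OF FAm(2)[OF assms]]) (simp_all add: rt zs)
  show ?thesis using F6_types[OF a]
  proof (elim disjE)
    assume "vt ?w (d * (1 - \<zeta>)) typeAm"
    from F_prev'[OF FAm(1)[OF this], of v "- d"] have "F v (- d) 3" by (simp add: rt zs)
    from F_clash[OF this FAm(3)[OF assms]] show ?thesis by simp
  next
    assume "vt ?w (\<i> * d * (\<zeta> - 1)) typeB"
    from B_nb3[OF this] have "vt v (- (\<i> * d)) typeB" by (simp add: zs)
    from vt_unique(2)[OF this assms] show ?thesis by simp
  qed
qed

end

end

section \<open>Symmetries of the tiling\<close>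

lemma flags_scale: "(e, m) \<in> flags d X \<Longrightarrow> (a * e, m) \<in> flags (a * d) X"
  by (induction X arbitrary: d) (auto simp: flags.simps mult.assoc)

lemma ngon_affine: "(\<lambda>z. a * z + c) ` ngon n v d = ngon n (a * v + c) (a * d)"
proof -
  have "a * (v + d * (1 - rou n ^ k) / (1 - rou n)) + c = (a * v + c) + a * d * (1 - rou n ^ k) / (1 - rou n)" for k
    by (simp add: distrib_left mult.assoc)
  then show ?thesis unfolding ngon_def image_image by (simp only:)
qed

text \<open>\<open>\<zeta> ^ 3 = -1\<close> folds the six directions into three up to sign; the sign
  is what a point reflection absorbs.\<close>

lemma zeta_pow_pm: "\<exists>j<3. \<exists>s\<in>{1, -1}. \<zeta> ^ k = s * \<zeta> ^ j"
proof (induction k)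
  case (Suc k)
  then obtain j s where j: "j < 3" "s \<in> {1, -1}" "\<zeta> ^ k = s * \<zeta> ^ j" by blast
  have z3: "\<zeta> ^ 3 = - 1" by (simp add: power3_eq_cube zs)
  show ?case
  proof (cases "j = 2")
    case True
    have "\<zeta> * \<zeta> ^ 2 = -1" using z3 by (simp add: power3_eq_cube power2_eq_square mult.assoc)
    then have "\<zeta> ^ Suc k = - s * \<zeta> ^ 0" using j True by (metis mult.left_commute mult_minus1_right power_0 mult.right_neutral power_Suc)
    then show ?thesis using j(2) by (intro exI[of _ 0]) (auto intro!: bexI[of _ "- s"])
  next
    case False
    then show ?thesis using j by (intro exI[of _ "Suc j"]) auto
  qed
qed (auto intro: exI[of _ 0])

section \<open>Telling the vertex types apart without orientation\<close>

context tiling_346 begin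

text \<open>Two common corners leave only the last alternative of the edge-to-edge condition, and an
  edge contains no corners but its ends.\<close>

lemma shared_corners:
  assumes PQ: "P \<in> T" "Q \<in> T" "P \<noteq> Q" and ab: "a \<noteq> b" "a \<in> P" "a \<in> Q" "b \<in> P" "b \<in> Q"
  shows "{a, b} \<in> poly_edges P" "{a, b} \<in> poly_edges Q"
proof -
  let ?I = "convex hull P \<inter> convex hull Q"
  have I: "a \<in> ?I" "b \<in> ?I" using ab by (auto simp: hull_inc)
  have "\<forall>P\<in>T. \<forall>Q\<in>T. P \<noteq> Q \<longrightarrow> convex hull P \<inter> convex hull Q = {} \<or>
      (\<exists>v\<in>P \<inter> Q. convex hull P \<inter> convex hull Q = {v}) \<or>
      (\<exists>a b. {a, b} \<in> poly_edges P \<and> {a, b} \<in> poly_edges Q \<and> convex hull P \<inter> convex hull Q = closed_segment a b)"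
    using tiling unfolding edge_to_edge_regular_tiling_def by (elim conjE)
  from this[rule_format, OF PQ]
  have "\<exists>c d. {c, d} \<in> poly_edges P \<and> {c, d} \<in> poly_edges Q \<and> ?I = closed_segment c d"
  proof (elim disjE)
    assume "?I = {}" with I show ?thesis by blast
  next
    assume "\<exists>v\<in>P \<inter> Q. ?I = {v}" with I ab(1) show ?thesis by (metis singletonD)
  qed
  then obtain c d where cd: "{c, d} \<in> poly_edges P" "{c, d} \<in> poly_edges Q" "?I = closed_segment c d"
    by (elim exE conjE)
  obtain n v e where P: "P = ngon n v e" "n \<ge> 3" using tile_ngon_any PQ(1) by metis
  have "c \<in> P" "d \<in> P" using cd(1) unfolding poly_edges_def by (auto simp: doubleton_eq_iff)
  then have "x = c \<or> x = d" if "x \<in> P" "x \<in> ?I" for x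
    using poly_edges_corner[of n c v e d x] that P cd(3) by auto
  then have "{a, b} = {c, d}" using I ab by blast
  with cd show "{a, b} \<in> poly_edges P" "{a, b} \<in> poly_edges Q" by auto
qed

text \<open>Symmetries may reverse orientation, so the types are separated by an incidence property
  that all symmetries preserve: it holds at the vertices of type \<open>[3, 4, 4, 6]\<close> and
  fails at those of type \<open>[3, 4, 6, 4]\<close>.\<close>

definition adj36 :: "complex \<Rightarrow> bool" where
  "adj36 v \<longleftrightarrow> (\<exists>P\<in>T. \<exists>Q\<in>T. card P = 3 \<and> card Q = 6 \<and> v \<in> P \<and> v \<in> Q \<and> (\<exists>w. w \<noteq> v \<and> w \<in> P \<and> w \<in> Q))"

lemma adj36_A: assumes "vt v d typeAp \<or> vt v d typeAm" shows "adj36 v"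
  using assms
proof
  assume A: "vt v d typeAp"
  have nz: "d \<noteq> 0" using vt_nz[OF A] by simp
  have "v + d \<in> ngon 6 v (- (d * \<zeta>))" using ngon_last[of 6 v "- (d * \<zeta>)"] by (simp add: turn_values zs)
  moreover have "v + d \<in> ngon 3 v d" by (simp add: ngon_3)
  moreover note F_ge2(4)[OF FAp(1)[OF A]] F_ge2(4)[OF FAp(4)[OF A]] F_card[OF FAp(1)[OF A]] F_card[OF FAp(4)[OF A]]
  moreover have "v \<in> ngon 3 v d" "v \<in> ngon 6 v (- (d * \<zeta>))" by (simp_all add: ngon_start)
  ultimately show ?thesis unfolding adj36_def using nz by (metis add_cancel_left_right)
next
  assume A: "vt v d typeAm"
  have nz: "d * \<zeta> \<noteq> 0" using vt_nz[OF A] by simp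
  have "v + d * \<zeta> \<in> ngon 6 v (d * \<zeta>)" by (simp add: ngon_second)
  moreover have "v + d * \<zeta> \<in> ngon 3 v d" by (simp add: ngon_3)
  moreover note F_ge2(4)[OF FAm(1)[OF A]] F_ge2(4)[OF FAm(2)[OF A]] F_card[OF FAm(1)[OF A]] F_card[OF FAm(2)[OF A]]
  moreover have "v \<in> ngon 3 v d" "v \<in> ngon 6 v (d * \<zeta>)" by (simp_all add: ngon_start)
  ultimately show ?thesis unfolding adj36_def using nz by (metis add_cancel_left_right)
qed

lemma triangle_unique:
  assumes "vt v d X" "X \<in> {typeAp, typeAm, typeB}" "P \<in> T" "v \<in> P" "card P = 3"
  shows "P = ngon 3 v d"
proof -
  obtain e where e: "P = ngon (card P) v e" "F v e (card P)" using tile_F assms by metis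
  then have "(e, 3) \<in> flags d X" using vt_F[OF assms(1)] assms(5) by simp
  then have "e = d" using assms(2) by (auto simp: flags_Ap flags_Am flags_B)
  with e(1) assms(5) show ?thesis by simp
qed

lemma not_adj36_B: assumes B: "vt v d typeB" shows "\<not> adj36 v"
proof
  assume "adj36 v"
  then obtain P Q w where PQ: "P \<in> T" "Q \<in> T" "card P = 3" "card Q = 6" "v \<in> P" "v \<in> Q" "w \<noteq> v" "w \<in> P" "w \<in> Q"
    unfolding adj36_def by blast
  have nz: "d \<noteq> 0" using vt_nz[OF B] by simp
  have P: "P = ngon 3 v d" using triangle_unique[OF B] PQ by simp
  obtain e where e: "Q = ngon (card Q) v e" "F v e (card Q)" using tile_F PQ(2,6) by metis
  then have "(e, 6) \<in> flags d typeB" using vt_F[OF B] PQ(4) by simp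
  then have "e = d * \<zeta> * \<i>" by (auto simp: flags_B)
  then have Q: "Q = ngon 6 v (d * \<zeta> * \<i>)" using e(1) PQ(4) by simp
  have "P \<noteq> Q" using PQ by auto
  then have ed: "{v, w} \<in> poly_edges (ngon 3 v d)" "{v, w} \<in> poly_edges (ngon 6 v (d * \<zeta> * \<i>))"
    using shared_corners[of P Q v w] PQ P Q by auto
  have "w = v + d \<or> w = v + d * \<zeta>" using poly_edges_ngon_start[OF _ nz ed(1)] by (simp add: turn_values)
  then obtain x where x: "w - v = d * x" "x = 1 \<or> x = \<zeta>" by (metis add_diff_cancel_left' mult.right_neutral)
  have "w = v + d * \<zeta> * \<i> \<or> w = v + d * \<zeta> * \<i> * (\<zeta> - 1)"
    using poly_edges_ngon_start[OF _ _ ed(2)] nz by (simp add: turn_values)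
  moreover have "d * \<zeta> * \<i> * (\<zeta> - 1) = d * - \<i>" "d * \<zeta> * \<i> = d * (\<zeta> * \<i>)" by (simp_all add: zs)
  ultimately obtain y where y: "w - v = d * y" "y = \<zeta> * \<i> \<or> y = - \<i>" by (metis add_diff_cancel_left')
  have "x = y" using x(1) y(1) nz by simp
  then have "1 = \<i> * \<zeta> \<or> 1 = - \<i> \<or> \<zeta> = \<zeta> * \<i> \<or> \<zeta> = - \<i>" using x(2) y(2) by (auto simp: mult.commute)
  then show False using zi_neq zi_neq' by (auto simp: complex_eq_iff)
qed

lemma adj36_symmetry:
  assumes f: "f \<in> tiling_symmetries T" and v: "adj36 v" shows "adj36 (f v)"
proof -
  have inj: "inj f" using f unfolding tiling_symmetries_def inj_def by (metis (mono_tags, lifting) dist_eq_0_iff mem_Collect_eq)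
  have T: "f ` P \<in> T" if "P \<in> T" for P using f that unfolding tiling_symmetries_def by blast
  have c: "card (f ` P) = card P" for P using inj by (simp add: card_image inj_on_subset)
  from v obtain P Q w where "P \<in> T" "Q \<in> T" "card P = 3" "card Q = 6" "v \<in> P" "v \<in> Q" "w \<noteq> v" "w \<in> P" "w \<in> Q"
    unfolding adj36_def by blast
  note h = this
  show ?thesis unfolding adj36_def
  proof (rule bexI[OF _ T[OF h(1)]], rule bexI[OF _ T[OF h(2)]], intro conjI exI)
    show "card (f ` P) = 3" "card (f ` Q) = 6" "f v \<in> f ` P" "f v \<in> f ` Q" "f w \<in> f ` P" "f w \<in> f ` Q"
      using h c by auto
    show "f w \<noteq> f v" using h(7) inj by (simp add: inj_eq)
  qed
qed

text \<open>The orbit of a vertex \<open>a\<close> of type \<open>[3, 4, 4, 6]\<close> contains no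
  \<open>typeB\<close> vertex, so all \<open>typeB\<close> vertices lie in the one other orbit. The
  triangle at \<open>a\<close> has a \<open>typeB\<close> corner \<open>b\<close>. A symmetry taking
  \<open>b\<close> to a corner of an all-\<open>typeB\<close> triangle maps the only triangle at
  \<open>b\<close> onto it, and so maps \<open>a\<close> to a \<open>typeB\<close> vertex.\<close>

lemma no_BBB_if_two_uniform:
  assumes K: "two_uniform T" and type1: "\<exists>v\<in>tiling_vertices T. has_vertex_type T v [3, 4, 4, 6]"
  shows no_BBB
  unfolding no_BBB_def
proof (intro allI impI notI)
  fix v d assume B: "vt v d typeB" "vt (v + d) (d * (\<zeta> - 1)) typeB"
  have Bx: "vt (v + d * \<zeta>) (- (d * \<zeta>)) typeB"
  proof -
    have "F (v + d * \<zeta>) (- (d * \<zeta>)) 3" by (rule F_prev'[OF FB(1)[OF B(1)]]) (simp_all add: rt)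
    from F3_types[OF this] show ?thesis
    proof (elim disjE)
      assume "vt (v + d * \<zeta>) (- (d * \<zeta>)) typeAp"
      from Ap_nb1[OF this] have "vt v (d * \<zeta> * (1 - \<zeta>)) typeAm" by (simp add: zs)
      from vt_unique(2)[OF this B(1)] show ?thesis by simp
    next
      assume "vt (v + d * \<zeta>) (- (d * \<zeta>)) typeAm"
      from Am_nb1[OF this] have "vt (v + d) (d * \<zeta> * \<zeta>) typeAp" by (simp add: zs)
      from vt_unique(2)[OF this B(2)] show ?thesis by simp
    qed
  qed
  obtain a where a: "a \<in> tiling_vertices T" "has_vertex_type T a [3, 4, 4, 6]" using type1 by blast
  then obtain e where e: "vt a e typeAp \<or> vt a e typeAm" using type_A by metis
  have adja: "adj36 a" by (rule adj36_A[OF e])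
  obtain b b' where b: "vt b b' typeB" "b \<in> ngon 3 a e"
    using e Ap_nb2[of a e] Am_nb2[of a e] by (auto simp: ngon_3)
  have tri: "F a e 3" using e FAp FAm by blast
  have V: "x \<in> tiling_vertices T" if "vt x y typeB" for x y
    using F_ge2(4)[OF FB(1)[OF that]] ngon_start[of 3 x y] tile_vertex by simp
  define Orb where "Orb = (\<lambda>v. {f v | f. f \<in> tiling_symmetries T})"
  have id: "x \<in> Orb x" for x unfolding Orb_def tiling_symmetries_def by (auto intro!: exI[of _ id])
  have Oa: "Orb a \<noteq> Orb x" if "vt x y typeB" for x y
  proof
    assume "Orb a = Orb x"
    then have "x \<in> Orb a" using id by simp
    then have "adj36 x" using adj36_symmetry adja unfolding Orb_def by auto
    with not_adj36_B that show False by blast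
  qed
  have "card {Orb v | v. v \<in> tiling_vertices T} = 2" using K unfolding two_uniform_def Orb_def by blast
  then obtain p q where pq: "{Orb v | v. v \<in> tiling_vertices T} = {p, q}" by (auto simp: card_2_iff)
  have "Orb a \<in> {p, q}" "Orb b \<in> {p, q}" "Orb v \<in> {p, q}" using a V b B(1) unfolding pq[symmetric] by blast+
  with Oa[OF b(1)] Oa[OF B(1)] have "Orb b = Orb v" by auto
  with id have "v \<in> Orb b" by blast
  then obtain f where f: "f \<in> tiling_symmetries T" "v = f b" unfolding Orb_def by blast
  have inj: "inj f" using f(1) unfolding tiling_symmetries_def inj_def by (metis (mono_tags, lifting) dist_eq_0_iff mem_Collect_eq)
  have "f ` ngon 3 a e \<in> T" using f(1) F_ge2(4)[OF tri] unfolding tiling_symmetries_def by blast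
  moreover have "card (f ` ngon 3 a e) = 3" using inj F_card[OF tri] by (simp add: card_image inj_on_subset)
  moreover have "v \<in> f ` ngon 3 a e" using f b by blast
  ultimately have "f ` ngon 3 a e = ngon 3 v d" using triangle_unique[OF B(1)] by simp
  moreover have "a \<in> ngon 3 a e" by (simp add: ngon_start)
  ultimately have "f a \<in> ngon 3 v d" by blast
  then have "\<not> adj36 (f a)" using not_adj36_B B Bx by (auto simp: ngon_3)
  with adj36_symmetry[OF f(1) adja] show False by blast
qed

end

section \<open>Spreading local data from one vertex to the whole tiling\<close>

context tiling_346 begin

lemma corner_F:
  assumes "F u e n" shows "F (u + e * (1 - rou n ^ k) / (1 - rou n)) (e * rou n ^ k) n"
  using assms ngon_restart[of n u e k] F_ge2[OF assms] unfolding F_def by simp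

text \<open>\<open>M\<close> spreads edge by edge around each tile, and
  \<open>sharing_closed_eq_T\<close> then reaches every tile.\<close>

lemma vertex_induct:
  assumes u: "u \<in> tiling_vertices T" "M u" and step: "\<And>u e n. M u \<Longrightarrow> F u e n \<Longrightarrow> M (u + e)"
    and w: "w \<in> tiling_vertices T"
  shows "M w"
proof -
  have tile: "M x" if P: "P \<in> T" "u \<in> P" "M u" "x \<in> P" for P u x
  proof -
    obtain e where e: "P = ngon (card P) u e" "F u e (card P)" using tile_F P by metis
    let ?n = "card P"
    have r: "rou ?n \<noteq> 1" using rou_ne_1 F_ge2[OF e(2)] by blast
    have "M (u + e * (1 - rou ?n ^ k) / (1 - rou ?n))" for k
    proof (induction k)
      case (Suc k)
      have "u + e * (1 - rou ?n ^ Suc k) / (1 - rou ?n) = (u + e * (1 - rou ?n ^ k) / (1 - rou ?n)) + e * rou ?n ^ k"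
        using r by (simp add: divide_simps) (simp add: algebra_simps)
      then show ?case using step[OF Suc corner_F[OF e(2), of k]] by (simp only:)
    qed (use P in simp)
    moreover have "x \<in> ngon ?n u e" by (subst e(1)[symmetric]) (rule P(4))
    ultimately show ?thesis unfolding ngon_def by auto
  qed
  have "{Q \<in> T. \<forall>x\<in>Q. M x} = T"
  proof (rule sharing_closed_eq_T)
    obtain P where "P \<in> T" "u \<in> P" using u(1) by (auto simp: tiling_vertices_def)
    then show "{Q \<in> T. \<forall>x\<in>Q. M x} \<noteq> {}" using tile u(2) by blast
  next
    fix P Q assume "P \<in> {Q \<in> T. \<forall>x\<in>Q. M x}" "Q \<in> T" "P \<inter> Q \<noteq> {}"
    then show "Q \<in> {Q \<in> T. \<forall>x\<in>Q. M x}" using tile by blast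
  qed blast
  with w show ?thesis unfolding tiling_vertices_def by blast
qed

lemma vt_vertex: assumes "vt v d X" "X \<in> {typeAp, typeAm, typeB}" shows "v \<in> tiling_vertices T"
proof -
  have "F v d 3" using assms(2) by (auto simp: vt_F[OF assms(1)] flags_Ap flags_Am flags_B)
  then show ?thesis using F_ge2(4)[of v d 3] ngon_start[of 3 v d] tile_vertex by simp
qed

context assumes H: no_BBB begin

text \<open>The neighbour lemmas are equivariant: offset and direction of a neighbour are fixed
  multiples of \<open>d\<close>, with a type that depends only on \<open>X\<close>.\<close>

lemma affine_match_step:
  assumes X: "X \<in> {typeAp, typeAm, typeB}" "vt u d X" "vt (a * u + c) (a * d) X" and F: "F u e n"
  shows "\<exists>Y\<in>{typeAp, typeAm, typeB}. \<exists>d. vt (u + e) d Y \<and> vt (a * (u + e) + c) (a * d) Y"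
proof -
  have en: "(e, n) \<in> flags d X" using F vt_F[OF X(2)] by blast
  have *: ?thesis if "vt (u + e) d' Y" "vt w d'' Y" "w = a * (u + e) + c" "d'' = a * d'" "Y \<in> {typeAp, typeAm, typeB}" for d' d'' w Y
    using that by blast
  from X(1) show ?thesis
  proof (elim insertE emptyE)
    assume XA: "X = typeAp"
    note A = X(2,3)[unfolded XA]
    from en consider "e = d" | "e = d * \<zeta>" | "e = d * \<zeta> * \<i>" | "e = - (d * \<zeta>)" by (auto simp: XA flags_Ap)
    then show ?thesis
    proof cases
      case 1 show ?thesis by (rule *[OF Ap_nb1[OF A(1), folded 1] Ap_nb1[OF A(2)]]) (simp_all add: 1 algebra_simps)
    next
      case 2 show ?thesis by (rule *[OF Ap_nb2[OF A(1), folded 2] Ap_nb2[OF A(2)]]) (simp_all add: 2 algebra_simps)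
    next
      case 3 show ?thesis by (rule *[OF Ap_nb3[OF A(1), folded 3] Ap_nb3[OF A(2)]]) (simp_all add: 3 algebra_simps)
    next
      case 4 show ?thesis by (rule *[OF Ap_nb4[OF H A(1), unfolded diff_conv_add_uminus, folded 4] Ap_nb4[OF H A(2)]]) (simp_all add: 4 algebra_simps)
    qed
  next
    assume XA: "X = typeAm"
    note A = X(2,3)[unfolded XA]
    from en consider "e = d" | "e = d * \<zeta>" | "e = - (d * \<i>)" | "e = - d" by (auto simp: XA flags_Am)
    then show ?thesis
    proof cases
      case 1 show ?thesis by (rule *[OF Am_nb2[OF A(1), folded 1] Am_nb2[OF A(2)]]) (simp_all add: 1 algebra_simps)
    next
      case 2 show ?thesis by (rule *[OF Am_nb1[OF A(1), folded 2] Am_nb1[OF A(2)]]) (simp_all add: 2 algebra_simps)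
    next
      case 3 
      have "v - d * \<i> = v + e" for v by (simp add: 3)
      note A1 = Am_nb3[OF A(1), unfolded this]
      show ?thesis by (rule *[OF A1 Am_nb3[OF A(2)]]) (simp_all add: 3 algebra_simps)
    next
      case 4 
      have "v - d = v + e" for v by (simp add: 4)
      note A1 = Am_nb4[OF H A(1), unfolded this]
      show ?thesis by (rule *[OF A1 Am_nb4[OF H A(2)]]) (simp_all add: 4 algebra_simps)
    qed
  next
    assume XA: "X = typeB"
    note A = X(2,3)[unfolded XA]
    from en consider "e = d" | "e = d * \<zeta>" | "e = d * \<zeta> * \<i>" | "e = - (d * \<i>)" by (auto simp: XA flags_B)
    then show ?thesis
    proof cases
      case 1 show ?thesis by (rule *[OF B_nb1[OF H A(1), folded 1] B_nb1[OF H A(2)]]) (simp_all add: 1 algebra_simps)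
    next
      case 2 show ?thesis by (rule *[OF B_nb2[OF H A(1), folded 2] B_nb2[OF H A(2)]]) (simp_all add: 2 algebra_simps)
    next
      case 3 show ?thesis by (rule *[OF B_nb3[OF H A(1), folded 3] B_nb3[OF H A(2)]]) (simp_all add: 3 algebra_simps)
    next
      case 4
      have "v - d * \<i> = v + e" for v by (simp add: 4)
      note A1 = B_nb4[OF H A(1), unfolded this]
      show ?thesis by (rule *[OF A1 B_nb4[OF H A(2)]]) (simp_all add: 4 algebra_simps)
    qed
  qed
qed

lemma affine_match_tile:
  assumes X: "X \<in> {typeAp, typeAm, typeB}" "vt u d X" "vt (a * u + c) (a * d) X" and a: "a \<noteq> 0" and P: "P \<in> T"
  shows "(\<lambda>z. a * z + c) ` P \<in> T"
proof -
  let ?M = "\<lambda>u. \<exists>X\<in>{typeAp, typeAm, typeB}. \<exists>d. vt u d X \<and> vt (a * u + c) (a * d) X"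
  obtain n v e where "P = ngon n v e" "n \<ge> 3" using tile_ngon_any P by metis
  then have "v \<in> P" by (simp add: ngon_start)
  then obtain e where e: "P = ngon (card P) v e" "F v e (card P)" using tile_F P by metis
  have "?M v"
  proof (rule vertex_induct[OF vt_vertex[OF X(2,1)], of ?M])
    show "?M u" using X by blast
    show "?M (u + e)" if M: "?M u" and F: "F u e n" for u e n
    proof -
      obtain X d where *: "X \<in> {typeAp, typeAm, typeB}" "vt u d X" "vt (a * u + c) (a * d) X" using M by blast
      show ?thesis by (rule affine_match_step[OF * F])
    qed
    show "v \<in> tiling_vertices T" using P \<open>v \<in> P\<close> by (rule tile_vertex)
  qed
  then obtain X d where *: "vt v d X" "vt (a * v + c) (a * d) X" by blast
  have "(e, card P) \<in> flags d X" using vt_F[OF *(1)] e(2) by blast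
  then have "F (a * v + c) (a * e) (card P)" using vt_F[OF *(2)] flags_scale by blast
  then have "ngon (card P) (a * v + c) (a * e) \<in> T" by (rule F_ge2)
  then show ?thesis using ngon_affine[of a c "card P" v e] e(1) by simp
qed

lemma affine_match:
  assumes X: "X \<in> {typeAp, typeAm, typeB}" "vt u d X" "vt (a * u + c) (a * d) X" and a: "a \<noteq> 0"
  shows "(\<lambda>P. (\<lambda>z. a * z + c) ` P) ` T = T"
proof
  show "(\<lambda>P. (\<lambda>z. a * z + c) ` P) ` T \<subseteq> T" using affine_match_tile[OF assms] by blast
  show "T \<subseteq> (\<lambda>P. (\<lambda>z. a * z + c) ` P) ` T"
  proof
    fix P assume P: "P \<in> T"
    \<comment> \<open>The inverse map has the same form and matches the same two vertices in the
      opposite direction.\<close>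
    let ?u = "a * u + c" and ?c = "- c / a"
    have uv: "inverse a * ?u + ?c = u" "inverse a * (a * d) = d" using a by (auto simp: field_simps)
    have M: "vt (inverse a * ?u + ?c) (inverse a * (a * d)) X" using X(2) unfolding uv .
    have "(\<lambda>z. inverse a * z + ?c) ` P \<in> T"
      by (rule affine_match_tile[OF X(1,3) M _ P]) (use a in simp)
    moreover have "P = (\<lambda>z. a * z + c) ` ((\<lambda>z. inverse a * z + ?c) ` P)"
      using a by (simp add: image_image field_simps)
    ultimately show "P \<in> (\<lambda>P. (\<lambda>z. a * z + c) ` P) ` T" by blast
  qed
qed

text \<open>Every neighbour lemma multiplies the direction by a power of \<open>\<zeta>\<close>; the
  factor \<open>\<i>\<close> occurs only in positions.\<close>

lemma vertex_direction_step:
  assumes X: "X \<in> {typeAp, typeAm, typeB}" "vt u (d * \<zeta> ^ k) X" and F: "F u e n"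
  shows "\<exists>Y\<in>{typeAp, typeAm, typeB}. \<exists>k. vt (u + e) (d * \<zeta> ^ k) Y"
proof -
  let ?d = "d * \<zeta> ^ k"
  have en: "(e, n) \<in> flags ?d X" using F vt_F[OF X(2)] by blast
  have p: "?d * \<zeta> = d * \<zeta> ^ Suc k" "?d * (\<zeta> - 1) = d * \<zeta> ^ (k + 2)" "- (d * \<zeta> ^ Suc k) = d * \<zeta> ^ (k + 4)" "?d * (1 - \<zeta>) = d * \<zeta> ^ (k + 5)"
  proof -
    have z: "\<zeta> ^ 2 = \<zeta> - 1" "\<zeta> ^ 4 = - \<zeta>" "\<zeta> ^ 5 = 1 - \<zeta>"
      using zeta_sq by (simp_all add: power_numeral_reduce algebra_simps zeta_sq')
    show "?d * \<zeta> = d * \<zeta> ^ Suc k" "?d * (\<zeta> - 1) = d * \<zeta> ^ (k + 2)" "- (d * \<zeta> ^ Suc k) = d * \<zeta> ^ (k + 4)" "?d * (1 - \<zeta>) = d * \<zeta> ^ (k + 5)"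
      unfolding power_Suc2 power_add z by simp_all
  qed
  note m = diff_conv_add_uminus[of u]
  from X(1) show ?thesis
  proof (elim insertE emptyE)
    assume XA: "X = typeAp"
    note A = X(2)[unfolded XA]
    show ?thesis using en Ap_nb1[OF A] Ap_nb2[OF A] Ap_nb3[OF A] Ap_nb4[OF H A] unfolding XA flags_Ap p m
      by blast
  next
    assume XA: "X = typeAm"
    note A = X(2)[unfolded XA]
    show ?thesis using en Am_nb1[OF A] Am_nb2[OF A] Am_nb3[OF A] Am_nb4[OF H A] unfolding XA flags_Am p m
      by blast
  next
    assume XA: "X = typeB"
    note A = X(2)[unfolded XA]
    show ?thesis using en B_nb1[OF H A] B_nb2[OF H A] B_nb3[OF H A] B_nb4[OF H A] unfolding XA flags_B p m
      by blast
  qed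
qed

lemma vertex_directions:
  obtains d where "d \<noteq> 0" "\<And>u. u \<in> tiling_vertices T \<Longrightarrow>
     \<exists>X\<in>{typeAp, typeAm, typeB}. \<exists>j<3. \<exists>s\<in>{1, -1}. vt u (s * (d * \<zeta> ^ j)) X"
proof -
  obtain P where P: "P \<in> T" using tiles_cover by blast
  then obtain n v e where "P = ngon n v e" "n \<ge> 3" using tile_ngon_any by metis
  then have "v \<in> P" by (simp add: ngon_start)
  then have v: "v \<in> tiling_vertices T" using P tile_vertex by blast
  then obtain d X where X: "d \<noteq> 0" "vt v d X" "X \<in> {typeAp, typeAm, typeB}" using vertex_vt by metis
  let ?M = "\<lambda>u. \<exists>X\<in>{typeAp, typeAm, typeB}. \<exists>k. vt u (d * \<zeta> ^ k) X"
  show thesis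
  proof (rule that[OF X(1)])
    fix u assume u: "u \<in> tiling_vertices T"
    have "?M u"
    proof (rule vertex_induct[OF v, of ?M u])
      show "?M v" using X by (intro bexI[of _ X] exI[of _ 0]) auto
      show "?M (u + e)" if M: "?M u" and F: "F u e n" for u e n
      proof -
        obtain X k where *: "X \<in> {typeAp, typeAm, typeB}" "vt u (d * \<zeta> ^ k) X" using M by blast
        show ?thesis by (rule vertex_direction_step[OF * F])
      qed
    qed (rule u)
    then obtain Y k where Y: "Y \<in> {typeAp, typeAm, typeB}" "vt u (d * \<zeta> ^ k) Y" by blast
    obtain j s where j: "j < 3" "s \<in> {1, -1}" "\<zeta> ^ k = s * \<zeta> ^ j" using zeta_pow_pm by blast
    have "vt u (s * (d * \<zeta> ^ j)) Y" using Y(2) j(3) by (simp add: mult.left_commute)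
    then show "\<exists>X\<in>{typeAp, typeAm, typeB}. \<exists>j<3. \<exists>s\<in>{1, -1}. vt u (s * (d * \<zeta> ^ j)) X"
      using Y(1) j(1,2) by blast
  qed
qed

end

end

section \<open>Automorphisms are isometries\<close>

text \<open>\<open>True\<close> is the orientation-preserving case: the plane isometries are the
  maps \<open>\<lambda>z. a * cj s z + c\<close> with \<open>norm a = 1\<close>.\<close>

definition cj :: "bool \<Rightarrow> complex \<Rightarrow> complex" where "cj s x = (if s then x else cnj x)"

lemma cj_simps [simp]: "cj s (x + y) = cj s x + cj s y" "cj s (x * y) = cj s x * cj s y" "cj s (x - y) = cj s x - cj s y"
  "cj s (- x) = - cj s x" "cj s 0 = 0" "cj s 1 = 1" "cj s x = 0 \<longleftrightarrow> x = 0" "norm (cj s x) = norm x"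
  by (auto simp: cj_def)

lemma cnj_turn: "cnj (turn n) = - rou n"
  by (simp add: turn_def rou_def cis_cnj flip: cis_inverse)

lemma cnj_rou: "cnj (rou n) = - turn n"
  by (metis add.inverse_inverse cnj_turn complex_cnj_cnj complex_cnj_minus)

text \<open>The regular \<open>n\<close>-gon with edge from \<open>v\<close> to \<open>v + d\<close>, on the left (\<open>s\<close>) or on the right of it.\<close>
definition sgon :: "bool \<Rightarrow> nat \<Rightarrow> complex \<Rightarrow> complex \<Rightarrow> complex set" where
  "sgon s n v d = (if s then ngon n v d else ngon n (v + d) (- d))"

lemma sgon_False: "n \<ge> 2 \<Longrightarrow> sgon False n v d = ngon n v (- d * rou n)"
  using ngon_shift[of n "v + d" "- d"] by (simp add: sgon_def)

lemma sgon_next: assumes "n \<ge> 2" shows "sgon s n (v + d) (d * cj s (rou n)) = sgon s n v d"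
proof (cases s)
  case True then show ?thesis using ngon_shift[OF assms] by (simp add: sgon_def cj_def)
next
  case False
  have "d * cnj (rou n) = (- d) * turn n" by (simp add: cnj_rou)
  then show ?thesis using ngon_shift_back[OF assms, of "v + d" "- d"] False by (simp add: sgon_def cj_def)
qed

lemma sgon_neighbour:
  assumes n: "n \<in> {3, 4, 6}" and d: "d \<noteq> 0" and e: "{v, w} \<in> poly_edges (sgon s n v d)"
  shows "w = v + d \<or> w = v + d * cj s (turn n)"
proof (cases s)
  case True then show ?thesis using poly_edges_ngon_start[OF n d] e by (simp add: sgon_def cj_def)
next
  case False
  have n2: "n \<ge> 2" using n by auto
  have "{v, w} \<in> poly_edges (ngon n v (- d * rou n))" using e False sgon_False[OF n2] by simp
  then have "w = v + - d * rou n \<or> w = v + - d * rou n * turn n"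
    using d by (intro poly_edges_ngon_start[OF n]) auto
  moreover have "- d * rou n * turn n = - (d * (turn n * rou n))" by (simp only: mult_ac mult_minus_left mult_minus_right)
  then have "- d * rou n * turn n = d" by simp
  ultimately show ?thesis using False by (auto simp: cj_def cnj_turn)
qed

lemma rou_ne_minus1: assumes "n \<ge> 3" shows "rou n \<noteq> - 1"
proof
  assume "rou n = - 1"
  then have "rou n ^ 2 = rou n ^ 0" by simp
  then show False using inj_onD[OF inj_on_rou_pow[of n], of 2 0] assms by auto
qed

section \<open>An automorphism agrees with one isometry, flag by flag\<close>

context tiling_346 begin

definition Fs :: "bool \<Rightarrow> complex \<Rightarrow> complex \<Rightarrow> nat \<Rightarrow> bool" where
  "Fs s v d n \<longleftrightarrow> d \<noteq> 0 \<and> n \<in> {3, 4, 6} \<and> sgon s n v d \<in> T"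

lemma Fs_unique: assumes "Fs s v d n" "Fs s v d m" shows "n = m"
proof (cases s)
  case True then show ?thesis using F_unique[of v d n m] assms by (simp add: Fs_def F_def sgon_def)
next
  case False then show ?thesis using F_unique[of "v + d" "- d" n m] assms by (simp add: Fs_def F_def sgon_def)
qed

lemma edge_side_s:
  assumes "P \<in> T" "{a, b} \<in> poly_edges P"
  shows "\<exists>t. P = sgon t (card P) a (b - a) \<and> Fs t a (b - a) (card P)"
proof -
  have ab: "a \<noteq> b" using assms(2) by (auto simp: poly_edges_def doubleton_eq_iff)
  have n: "card P \<in> {3, 4, 6}" by (rule tile_card[OF assms(1)])
  from edge_side[OF assms] show ?thesis
  proof (elim disjE conjE)
    assume *: "P = ngon (card P) a (b - a)"
    then have "P = sgon True (card P) a (b - a)" by (simp add: sgon_def)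
    moreover from this have "Fs True a (b - a) (card P)" unfolding Fs_def using assms(1) n ab by auto
    ultimately show ?thesis by blast
  next
    assume *: "P = ngon (card P) b (a - b)"
    then have "P = sgon False (card P) a (b - a)" by (simp add: sgon_def)
    moreover from this have "Fs False a (b - a) (card P)" unfolding Fs_def using assms(1) n ab by auto
    ultimately show ?thesis by blast
  qed
qed

text \<open>The tile across the edge is the one preceding counterclockwise at \<open>v\<close>; its
  last edge there is \<open>d\<close>.\<close>

lemma opposite_tile:
  assumes "F v d n"
  obtains e m where "F v e m" "e * turn m = d"
proof -
  obtain d0 X where X: "vt v d0 X" "X \<in> {typeAp, typeAm, typeB}" using F_types[OF assms] .
  have d: "(d, n) \<in> flags d0 X" using vt_F[OF X(1)] assms by blast
  have "\<exists>(e, m) \<in> flags d0 X. e * turn m = d"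
    using X(2) d by (elim insertE emptyE) (auto simp: flags_Ap flags_Am flags_B turn_values zs)
  then show thesis using that vt_F[OF X(1)] by blast
qed

lemma opposite_F: "F v e m \<Longrightarrow> e * turn m = d \<Longrightarrow> F (v + d) (- d) m"
  using F_prev by blast

text \<open>A polygon equal to the one across its edge would run back along that edge after one
  step.\<close>

lemma opposite_ne:
  assumes "F v d n" "F (v + d) (- d) m" shows "ngon n v d \<noteq> ngon m (v + d) (- d)"
proof
  assume eq: "ngon n v d = ngon m (v + d) (- d)"
  then have "n = m" using assms F_card by metis
  then have "ngon n (v + d) (d * rou n) = ngon n (v + d) (- d)" using eq F_ge2[OF assms(1)] by (simp add: ngon_shift)
  then have "d * rou n = - d" using ngon_inject[of n "d * rou n" "- d" "v + d"] F_ge2[OF assms(1)] by simp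
  then have "d * rou n = d * (- 1)" by simp
  then have "rou n = - 1" by (rule mult_left_cancel[OF F_ge2(3)[OF assms(1)], THEN iffD1])
  with rou_ne_minus1 F_ge2[OF assms(1)] show False by blast
qed

text \<open>The rule passes from a tile to its clockwise neighbour at \<open>v\<close>, and these
  steps run cyclically through all four flags.\<close>

lemma flags_rotate:
  assumes F: "F v d n" "M d n" and rot: "\<And>d n e m. M d n \<Longrightarrow> F v d n \<Longrightarrow> F v e m \<Longrightarrow> e * turn m = d \<Longrightarrow> M e m"
    and F': "F v d' n'"
  shows "M d' n'"
proof -
  obtain d0 X where X: "vt v d0 X" "X \<in> {typeAp, typeAm, typeB}" using F_types[OF F(1)] .
  have d: "(d, n) \<in> flags d0 X" "(d', n') \<in> flags d0 X" using vt_F[OF X(1)] F F' by blast+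
  from X(2) show ?thesis
  proof (elim insertE emptyE)
    assume XA: "X = typeAp"
    note A = X(1)[unfolded XA]
    have "M d0 3 \<Longrightarrow> M (- (d0 * \<zeta>)) 6" "M (- (d0 * \<zeta>)) 6 \<Longrightarrow> M (d0 * \<zeta> * \<i>) 4"
      "M (d0 * \<zeta> * \<i>) 4 \<Longrightarrow> M (d0 * \<zeta>) 4" "M (d0 * \<zeta>) 4 \<Longrightarrow> M d0 3"
      by (erule rot; use FAp[OF A] in \<open>simp add: turn_values zs\<close>)+
    then show ?thesis using d F(2) unfolding XA flags_Ap by blast
  next
    assume XA: "X = typeAm"
    note A = X(1)[unfolded XA]
    have "M d0 3 \<Longrightarrow> M (- (d0 * \<i>)) 4" "M (- (d0 * \<i>)) 4 \<Longrightarrow> M (- d0) 4"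
      "M (- d0) 4 \<Longrightarrow> M (d0 * \<zeta>) 6" "M (d0 * \<zeta>) 6 \<Longrightarrow> M d0 3"
      by (erule rot; use FAm[OF A] in \<open>simp add: turn_values zs\<close>)+
    then show ?thesis using d F(2) unfolding XA flags_Am by blast
  next
    assume XA: "X = typeB"
    note A = X(1)[unfolded XA]
    have "M d0 3 \<Longrightarrow> M (- (d0 * \<i>)) 4" "M (- (d0 * \<i>)) 4 \<Longrightarrow> M (d0 * \<zeta> * \<i>) 6"
      "M (d0 * \<zeta> * \<i>) 6 \<Longrightarrow> M (d0 * \<zeta>) 4" "M (d0 * \<zeta>) 4 \<Longrightarrow> M d0 3"
      by (erule rot; use FB[OF A] in \<open>simp add: turn_values zs\<close>)+
    then show ?thesis using d F(2) unfolding XA flags_B by blast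
  qed
qed

context
  fixes g :: "complex \<Rightarrow> complex"
  assumes g: "g \<in> map_auts T"
begin

lemma aut_tile: "P \<in> T \<Longrightarrow> g ` P \<in> T"
  using g unfolding map_auts_def by blast

lemma aut_inj: "inj_on g (tiling_vertices T)"
  using g unfolding map_auts_def bij_betw_def by blast

lemma tile_sub: "P \<in> T \<Longrightarrow> P \<subseteq> tiling_vertices T"
  unfolding tiling_vertices_def by blast

lemma aut_card: "P \<in> T \<Longrightarrow> card (g ` P) = card P"
  using inj_on_subset[OF aut_inj tile_sub] card_image by blast

lemma aut_tile_ne: assumes "P \<in> T" "Q \<in> T" "P \<noteq> Q" shows "g ` P \<noteq> g ` Q"
  using inj_on_image_eq_iff[OF aut_inj tile_sub[OF assms(1)] tile_sub[OF assms(2)]] assms(3) by blast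

lemma aut_edge:
  assumes "F v d n" "F (v + d) (- d) m"
  shows "{g v, g (v + d)} \<in> poly_edges (g ` ngon n v d)" "{g v, g (v + d)} \<in> poly_edges (g ` ngon m (v + d) (- d))"
proof -
  let ?P = "ngon n v d" and ?Q = "ngon m (v + d) (- d)"
  have T: "?P \<in> T" "?Q \<in> T" using F_ge2(4) assms by blast+
  have mem: "v \<in> ?P" "v + d \<in> ?P" "v \<in> ?Q" "v + d \<in> ?Q"
    using F_ge2[OF assms(1)] F_ge2[OF assms(2)] ngon_second[of m "v + d" "- d"] by (auto simp: ngon_start ngon_second)
  have "g v \<noteq> g (v + d)"
    using inj_onD[OF aut_inj, of v "v + d"] mem tile_sub[OF T(1)] F_ge2(3)[OF assms(1)] by auto
  from shared_corners[OF aut_tile[OF T(1)] aut_tile[OF T(2)] aut_tile_ne[OF T opposite_ne[OF assms]] this]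
  show "{g v, g (v + d)} \<in> poly_edges (g ` ?P)" "{g v, g (v + d)} \<in> poly_edges (g ` ?Q)" using mem by auto
qed

text \<open>Agreement of \<open>g\<close> with \<open>\<lambda>z. a * cj s z + c\<close> along a
  flag. The image tile must lie on the side prescribed by \<open>s\<close>, so that a single
  orientation is carried through the tiling.\<close>

definition amatch :: "bool \<Rightarrow> complex \<Rightarrow> complex \<Rightarrow> complex \<Rightarrow> complex \<Rightarrow> nat \<Rightarrow> bool" where
  "amatch s a c v d n \<longleftrightarrow> F v d n \<and> g v = a * cj s v + c \<and> g (v + d) = a * cj s (v + d) + c \<and>
     g ` ngon n v d = sgon s n (g v) (a * cj s d) \<and> Fs s (g v) (a * cj s d) n"

text \<open>The next corner goes to a neighbour of \<open>g (v + d)\<close> in the image polygon; of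
  the two candidates one is already \<open>g v\<close>.\<close>

lemma amatch_next:
  assumes M: "amatch s a c v d n" shows "amatch s a c (v + d) (d * rou n) n"
proof -
  let ?w = "v + d" and ?e = "d * rou n" and ?P = "ngon n v d"
  have F: "F v d n" and gv: "g v = a * cj s v + c" and gw: "g ?w = a * cj s ?w + c"
    and P: "g ` ?P = sgon s n (g v) (a * cj s d)" and Fs: "Fs s (g v) (a * cj s d) n" using M unfolding amatch_def by auto
  have n: "n \<ge> 2" "n \<in> {3, 4, 6}" "n \<ge> 3" using F_ge2[OF F] by auto
  have Fw: "F ?w ?e n" by (rule F_next[OF F])
  have P': "ngon n ?w ?e = ?P" by (rule ngon_shift[OF n(1)])
  have gw': "g ?w = g v + a * cj s d" using gv gw by (simp add: algebra_simps)
  have S: "sgon s n (g ?w) (a * cj s ?e) = sgon s n (g v) (a * cj s d)"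
    using sgon_next[OF n(1), of s "g v" "a * cj s d"] unfolding gw' by (simp add: mult.assoc)
  have nz: "a * cj s ?e \<noteq> 0" using Fs unfolding Fs_def by auto
  obtain e' m where em: "F ?w e' m" "e' * turn m = ?e" using opposite_tile[OF Fw] .
  have "{g ?w, g (?w + ?e)} \<in> poly_edges (sgon s n (g ?w) (a * cj s ?e))"
    using aut_edge(1)[OF Fw opposite_F[OF em]] unfolding P' P S .
  from sgon_neighbour[OF n(2) nz this]
  have "g (?w + ?e) = g ?w + a * cj s ?e"
  proof
    assume "g (?w + ?e) = g ?w + a * cj s ?e * cj s (turn n)"
    also have "a * cj s ?e * cj s (turn n) = a * cj s (d * (turn n * rou n))" by (simp add: mult_ac)
    also have "g ?w + \<dots> = g v" unfolding gw' by simp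
    finally have eq: "g (?w + ?e) = g v" .
    have V: "v \<in> tiling_vertices T" "?w + ?e \<in> tiling_vertices T"
      using tile_sub[OF F_ge2(4)[OF F]] tile_sub[OF F_ge2(4)[OF Fw]] ngon_start[of n v d] ngon_second[OF n(1), of ?w ?e] n by auto
    have "?w + ?e = v" using inj_onD[OF aut_inj eq V(2,1)] .
    then have "d * rou n = d * (- 1)" by (simp add: add.assoc eq_neg_iff_add_eq_0 add.commute)
    then have "rou n = - 1" by (rule mult_left_cancel[OF F_ge2(3)[OF F], THEN iffD1])
    with rou_ne_minus1 n show ?thesis by blast
  qed
  then have "g (?w + ?e) = a * cj s (?w + ?e) + c" unfolding gw by (simp add: algebra_simps)
  moreover have "Fs s (g ?w) (a * cj s ?e) n" using Fs nz unfolding Fs_def S by blast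
  ultimately show ?thesis unfolding amatch_def using Fw gw P S P' by simp
qed

text \<open>Distinct tiles have distinct images and an edge has at most one tile on each side, so
  crossing the edge changes sides in the image too.\<close>

lemma amatch_opposite:
  assumes M: "amatch s a c v d n" and opp: "F (v + d) (- d) m" shows "amatch s a c (v + d) (- d) m"
proof -
  let ?w = "v + d" and ?P = "ngon n v d" and ?Q = "ngon m (v + d) (- d)" and ?e = "a * cj s d"
  have F: "F v d n" and gv: "g v = a * cj s v + c" and gw: "g ?w = a * cj s ?w + c"
    and P: "g ` ?P = sgon s n (g v) ?e" and Fs: "Fs s (g v) ?e n" using M unfolding amatch_def by auto
  have gw': "g ?w - g v = ?e" using gv gw by (simp add: algebra_simps)
  have Q: "?Q \<in> T" using F_ge2 opp by blast
  have c: "card (g ` ?Q) = m" using aut_card[OF Q] F_card[OF opp] by simp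
  obtain t where t: "g ` ?Q = sgon t m (g v) ?e" "Fs t (g v) ?e m"
    using edge_side_s[OF aut_tile[OF Q] aut_edge(2)[OF F opp]] unfolding c gw' by blast
  have "t \<noteq> s"
  proof
    assume "t = s"
    then have "m = n" using t(2) Fs Fs_unique by blast
    then have "g ` ?Q = g ` ?P" using t(1) P \<open>t = s\<close> by simp
    with aut_tile_ne[OF F_ge2(4)[OF F] Q opposite_ne[OF F opp]] show False by simp
  qed
  have "g ?w = g v + ?e" using gw' by (simp add: algebra_simps)
  then have S: "sgon s m (g ?w) (a * cj s (- d)) = sgon t m (g v) ?e"
    using \<open>t \<noteq> s\<close> by (cases s) (auto simp: sgon_def cj_def)
  moreover have "Fs s (g ?w) (a * cj s (- d)) m" using t(2) unfolding Fs_def S by simp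
  ultimately show ?thesis unfolding amatch_def using opp gw gv t(1) by simp
qed

text \<open>\<open>s\<close>, \<open>a\<close> and \<open>c\<close> are read off from a single flag,
  and the match spreads from there. \<open>a\<close> has modulus 1 because all tiles have the same
  side length.\<close>

lemma aut_affine:
  obtains s a c where "norm a = 1" "\<And>v. v \<in> tiling_vertices T \<Longrightarrow> g v = a * cj s v + c"
proof -
  obtain P where P: "P \<in> T" using tiles_cover by blast
  then obtain n v d where nvd: "P = ngon n v d" "n \<ge> 3" using tile_ngon_any by metis
  then have "v \<in> P" by (simp add: ngon_start)
  then have v: "v \<in> tiling_vertices T" using P tile_vertex by blast
  obtain d where d: "P = ngon (card P) v d" "F v d (card P)" using tile_F[OF P \<open>v \<in> P\<close>] .
  let ?n = "card P"
  obtain e' m where em: "F v e' m" "e' * turn m = d" using opposite_tile[OF d(2)] .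
  have c: "card (g ` P) = ?n" using aut_card[OF P] .
  have "{g v, g (v + d)} \<in> poly_edges (g ` P)"
    using aut_edge(1)[OF d(2) opposite_F[OF em]] unfolding d(1)[symmetric] .
  from edge_side_s[OF aut_tile[OF P] this] obtain s where
    s: "g ` P = sgon s ?n (g v) (g (v + d) - g v)" "Fs s (g v) (g (v + d) - g v) ?n" unfolding c by blast
  define a where "a = (g (v + d) - g v) / cj s d"
  define c where "c = g v - a * cj s v"
  have dz: "cj s d \<noteq> 0" using F_ge2[OF d(2)] by simp
  have ad: "a * cj s d = g (v + d) - g v" using dz by (simp add: a_def)
  have M: "amatch s a c v d ?n"
    unfolding amatch_def ad d(1)[symmetric] using d(2) s by (simp add: c_def distrib_left ad)
  \<comment> \<open>A clockwise turn at \<open>u\<close>: cross the edge, then walk one edge of the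
    new tile, which leads back to \<open>u\<close>.\<close>
  have rot: "amatch s a c u e m" if "amatch s a c u d n" "F u d n" "F u e m" "e * turn m = d" for u d n e m
  proof -
    have "amatch s a c (u + d) (- d) m" by (rule amatch_opposite[OF that(1) opposite_F[OF that(3,4)]])
    from amatch_next[OF this] have "amatch s a c u (- (d * rou m)) m" by simp
    moreover have "- (d * rou m) = e" using turn_rou[of m] unfolding that(4)[symmetric] by (simp add: mult.assoc)
    ultimately show ?thesis by simp
  qed
  let ?M = "\<lambda>u. \<forall>e m. F u e m \<longrightarrow> amatch s a c u e m"
  have all: "?M u" if "amatch s a c u e m" for u e m
  proof (intro allI impI)
    fix e' m' assume F': "F u e' m'"
    have "F u e m" using that unfolding amatch_def by blast
    show "amatch s a c u e' m'"
      by (rule flags_rotate[where M = "amatch s a c u", OF \<open>F u e m\<close> that _ F']) (rule rot; assumption)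
  qed
  have V: "?M w" if w: "w \<in> tiling_vertices T" for w
  proof (rule vertex_induct[OF v, of ?M w])
    show "?M v" by (rule all[OF M])
    show "?M (u + e)" if "?M u" "F u e n" for u e n
      using all[OF amatch_next] that by blast
  qed (rule w)
  show thesis
  proof (rule that)
    have "norm (a * cj s d) = norm d"
    proof (cases s)
      case True
      then have "F (g v) (a * cj s d) ?n" using s(2) unfolding ad Fs_def F_def sgon_def by simp
      from side_unique[OF this d(2)] show ?thesis .
    next
      case False
      then have "F (g (v + d)) (- (a * cj s d)) ?n" using s(2) unfolding ad Fs_def F_def sgon_def by auto
      from side_unique[OF this d(2)] show ?thesis by simp
    qed
    then show "norm a = 1" using dz by (simp add: norm_mult)
    fix w assume w: "w \<in> tiling_vertices T"
    then obtain P where "P \<in> T" "w \<in> P" unfolding tiling_vertices_def by blast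
    then obtain e where "F w e (card P)" using tile_F by metis
    then show "g w = a * cj s w + c" using V[OF w] unfolding amatch_def by blast
  qed
qed

end
end

section \<open>Free actions with torus quotient\<close>

text \<open>The uniform lower bound \<open>\<delta>\<close> on displacements stands in for proper
  discontinuity.\<close>

locale free_torus_action =
  fixes p :: "complex \<Rightarrow> complex \<times> complex" and G :: "(complex \<Rightarrow> complex) set" and \<delta> :: real
  assumes quot: "quotient_map euclidean (top_of_set torus) p"
    and fibres: "\<And>x y. p x = p y \<longleftrightarrow> (\<exists>f\<in>G. f x = y)"
    and comp: "\<And>f h. f \<in> G \<Longrightarrow> h \<in> G \<Longrightarrow> f \<circ> h \<in> G"
    and inverse: "\<And>f. f \<in> G \<Longrightarrow> \<exists>h\<in>G. h \<circ> f = id \<and> f \<circ> h = id"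
    and isometry: "\<And>f x y. f \<in> G \<Longrightarrow> dist (f x) (f y) = dist x y"
    and pos: "0 < \<delta>"
    and displacement: "\<And>f x. f \<in> G \<Longrightarrow> f \<noteq> id \<Longrightarrow> \<delta> \<le> dist (f x) x"
begin

lemma surj: "p ` UNIV = torus"
  using quot unfolding quotient_map_def by simp

lemma in_torus: "p x \<in> torus" using surj by blast

lemma open_preimage: "U \<subseteq> torus \<Longrightarrow> open (p -` U) \<longleftrightarrow> openin (top_of_set torus) U"
  using quot unfolding quotient_map_def by (simp add: vimage_def)

lemma cont: "continuous_on UNIV p"
proof -
  have "continuous_map euclidean (top_of_set torus) p" by (rule quotient_imp_continuous_map[OF quot])
  then show ?thesis by (simp add: continuous_map_in_subtopology)
qed

lemma cont_G: "f \<in> G \<Longrightarrow> continuous_on S f"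
  unfolding continuous_on_iff using isometry by metis

lemma open_image: assumes "f \<in> G" "open U" shows "open (f ` U)"
proof -
  obtain h where h: "h \<in> G" "h \<circ> f = id" "f \<circ> h = id" using inverse assms(1) by blast
  have "h (f x) = x" "f (h x) = x" for x using h(2,3) by (simp_all add: fun_eq_iff)
  then have "x \<in> f ` U \<longleftrightarrow> h x \<in> U" for x by (metis imageE imageI)
  then have "f ` U = h -` U" by blast
  then show ?thesis using open_vimage[OF assms(2) cont_G[OF h(1)]] by simp
qed

lemma p_G: "f \<in> G \<Longrightarrow> p (f x) = p x"
  using fibres[of x "f x"] by auto

lemma saturation: "p -` (p ` U) = (\<Union>f\<in>G. f ` U)"
proof (intro equalityI subsetI)
  fix x assume "x \<in> p -` (p ` U)"
  then obtain u where "u \<in> U" "p u = p x" by force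
  then obtain f where "f \<in> G" "f u = x" using fibres[of u x] by blast
  with \<open>u \<in> U\<close> show "x \<in> (\<Union>f\<in>G. f ` U)" by blast
next
  fix x assume "x \<in> (\<Union>f\<in>G. f ` U)"
  then show "x \<in> p -` (p ` U)" using p_G by auto
qed

lemma open_p: assumes "open U" shows "openin (top_of_set torus) (p ` U)"
proof -
  note saturation[of U]
  then have "open (p -` (p ` U))" using open_image assms by auto
  then show ?thesis using open_preimage[of "p ` U"] in_torus by blast
qed

lemma id_if_near: assumes "f \<in> G" "dist (f x) x < \<delta>" shows "f = id"
  using displacement[of f x] assms by force

text \<open>Images of balls of radius \<open>\<delta> / 2\<close> are evenly covered: if the images
  of the ball under two different elements met, a nontrivial element would move some point by less
  than \<open>\<delta>\<close>.\<close>

lemma covering: "covering_space UNIV p torus"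
  unfolding covering_space_def
proof (intro conjI ballI cont surj)
  fix z assume "z \<in> torus"
  then obtain y where y: "z = p y" using surj by blast
  let ?U = "ball y (\<delta> / 2)"
  let ?V = "(\<lambda>f. f ` ?U) ` G"
  have pim: "p ` f ` ?U = p ` ?U" if "f \<in> G" for f
    using p_G[OF that] by (simp add: image_image)
  have near: "f = h" if fh: "f \<in> G" "h \<in> G" "a \<in> ?U" "b \<in> ?U" "f a = h b" for f h a b
  proof -
    obtain k where k: "k \<in> G" "k \<circ> h = id" "h \<circ> k = id" using inverse fh(2) by blast
    have "(k \<circ> f) a = b" using fh(5) k(2) by (metis comp_apply id_apply)
    moreover have "dist a b < \<delta>" using fh(3,4) dist_triangle2[of a b y] by (simp add: dist_commute)
    ultimately have "k \<circ> f = id" using id_if_near[of "k \<circ> f" a] comp[OF k(1) fh(1)] by (simp add: dist_commute)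
    then have "h \<circ> (k \<circ> f) = h" by simp
    then show ?thesis using k(3) by (metis comp_assoc id_comp)
  qed
  show "\<exists>T. z \<in> T \<and> openin (top_of_set torus) T \<and>
          (\<exists>v. \<Union> v = UNIV \<inter> p -` T \<and> (\<forall>u\<in>v. openin (top_of_set UNIV) u) \<and> pairwise disjnt v \<and> (\<forall>u\<in>v. \<exists>q. homeomorphism u T p q))"
  proof (intro exI[of _ "p ` ?U"] conjI exI[of _ ?V])
    show "z \<in> p ` ?U" using y pos by auto
    show "openin (top_of_set torus) (p ` ?U)" by (simp add: open_p)
    show "\<Union> ?V = UNIV \<inter> p -` (p ` ?U)" by (simp add: saturation)
    show "\<forall>u\<in>?V. openin (top_of_set UNIV) u" using open_image by auto
    show "pairwise disjnt ?V"
    proof (rule pairwiseI)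
      fix A B assume "A \<in> ?V" "B \<in> ?V" "A \<noteq> B"
      then show "disjnt A B" using near unfolding disjnt_def by blast
    qed
    show "\<forall>u\<in>?V. \<exists>q. homeomorphism u (p ` ?U) p q"
    proof
      fix u assume "u \<in> ?V"
      then obtain f where f: "f \<in> G" "u = f ` ?U" by blast
      have ou: "open u" using f open_image by auto
      show "\<exists>q. homeomorphism u (p ` ?U) p q"
      proof (rule homeomorphism_injective_open_map)
        show "continuous_on u p" using cont continuous_on_subset by blast
        show "p ` u = p ` ?U" using pim f by simp
        show "inj_on p u"
        proof (rule inj_onI)
          fix a b assume ab: "a \<in> u" "b \<in> u" "p a = p b"
          then obtain h where h: "h \<in> G" "h a = b" using fibres by blast
          obtain x y' where xy: "x \<in> ?U" "y' \<in> ?U" "a = f x" "b = f y'" using ab f by blast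
          have "h \<circ> f = f" by (rule near[OF comp[OF h(1) f(1)] f(1) xy(1,2)]) (use h xy in simp)
          then show "a = b" using h xy by (metis comp_apply)
        qed
        fix W assume "openin (top_of_set u) W"
        then have "open W" "W \<subseteq> u" using ou openin_open_eq by blast+
        then have "openin (top_of_set torus) (p ` W)" by (simp add: open_p)
        moreover have "p ` W \<subseteq> p ` ?U" using image_mono[OF \<open>W \<subseteq> u\<close>, of p] pim[OF f(1)] f(2) by simp
        moreover have "p ` ?U \<subseteq> torus" using in_torus by blast
        ultimately show "openin (top_of_set (p ` ?U)) (p ` W)"
          by (rule openin_subset_trans)
      qed blast
    qed
  qed
qed

text \<open>Logarithms of the same number differ by a multiple of \<open>2 * pi * \<i>\<close>; a
  continuous function with such discrete values on a connected set is constant.\<close>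

lemma log_shift:
  assumes h: "continuous_on UNIV h" "\<And>x. q (p x) = exp (h x)" and f: "f \<in> G"
  obtains c :: complex where "\<And>x. h (f x) = h x + c"
proof -
  let ?k = "\<lambda>x. h (f x) - h x"
  have ck: "continuous_on UNIV ?k"
    by (intro continuous_intros h continuous_on_compose2[OF h(1) cont_G[OF f]]) auto
  have int: "\<exists>n::int. ?k x = of_int n * (2 * of_real pi * \<i>)" for x
  proof -
    have "p (f x) = p x" using fibres f by metis
    then have "exp (?k x) = 1" using h(2) by (metis exp_diff div_self exp_not_eq_zero)
    then obtain n :: int where "Re (?k x) = 0" "Im (?k x) = of_int (2 * n) * pi" using exp_eq_1 by blast
    then show ?thesis by (intro exI[of _ n]) (simp add: complex_eq_iff)
  qed
  have "?k constant_on UNIV"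
  proof (rule continuous_discrete_range_constant[OF connected_UNIV ck])
    fix x :: complex
    have "2 * pi \<le> norm (?k y - ?k x)" if "?k y \<noteq> ?k x" for y
    proof -
      obtain m n :: int where mn: "?k y = of_int m * (2 * of_real pi * \<i>)" "?k x = of_int n * (2 * of_real pi * \<i>)"
        using int by metis
      then have "m \<noteq> n" using that by auto
      then have "1 \<le> \<bar>real_of_int (m - n)\<bar>" by linarith
      moreover have "norm (?k y - ?k x) = \<bar>real_of_int (m - n)\<bar> * (2 * pi)"
        unfolding mn left_diff_distrib[symmetric] of_int_diff[symmetric] norm_mult norm_of_int by (simp del: of_int_diff)
      ultimately show ?thesis using pi_gt_zero by (simp add: mult_le_cancel_right1)
    qed
    then show "\<exists>e>0. \<forall>y. y \<in> UNIV \<and> ?k y \<noteq> ?k x \<longrightarrow> e \<le> norm (?k y - ?k x)"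
      by (intro exI[of _ "2 * pi"]) auto
  qed
  then obtain c where "\<And>x. ?k x = c" unfolding constant_on_def by blast
  then show thesis using that[of c] by (metis add.commute diff_add_cancel)
qed

text \<open>The logarithms of the two components of \<open>p\<close> are shifted by constants under the group, so they agree at
  \<open>f (g x)\<close> and \<open>g (f x)\<close>. Hence \<open>p\<close> maps a path between these points to a null-homotopic loop, and by
  monodromy the path is closed.\<close>
lemma commute:
  assumes f: "f \<in> G" and g: "g \<in> G" shows "f (g x) = g (f x)"
proof -
  have n1: "norm (fst (p z)) = 1" "norm (snd (p z)) = 1" for z
    using in_torus[of z] by (auto simp: torus_def mem_Times_iff)
  obtain h1 where h1: "continuous_on UNIV h1" "\<And>z. fst (p z) = exp (h1 z)"
  proof (rule continuous_logarithm_on_contractible[of UNIV "\<lambda>z. fst (p z)"])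
    show "continuous_on UNIV (\<lambda>z. fst (p z))" by (intro continuous_intros cont)
    show "fst (p z) \<noteq> 0" for z using n1(1)[of z] by auto
  qed (auto simp: convex_imp_contractible)
  obtain h2 where h2: "continuous_on UNIV h2" "\<And>z. snd (p z) = exp (h2 z)"
  proof (rule continuous_logarithm_on_contractible[of UNIV "\<lambda>z. snd (p z)"])
    show "continuous_on UNIV (\<lambda>z. snd (p z))" by (intro continuous_intros cont)
    show "snd (p z) \<noteq> 0" for z using n1(2)[of z] by auto
  qed (auto simp: convex_imp_contractible)
  have re: "Re (h1 z) = 0" "Re (h2 z) = 0" for z
    using n1[of z] h1(2)[of z] h2(2)[of z] by auto
  define y z where "y = f (g x)" and "z = g (f x)"
  define H where "H = (\<lambda>w. (h1 w, h2 w))"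
  have "H z = H y"
  proof -
    obtain a1 where a1: "\<And>x. h1 (f x) = h1 x + a1" using log_shift[OF h1 f] by blast
    obtain b1 where b1: "\<And>x. h1 (g x) = h1 x + b1" using log_shift[OF h1 g] by blast
    obtain a2 where a2: "\<And>x. h2 (f x) = h2 x + a2" using log_shift[OF h2 f] by blast
    obtain b2 where b2: "\<And>x. h2 (g x) = h2 x + b2" using log_shift[OF h2 g] by blast
    show ?thesis unfolding H_def y_def z_def by (simp add: a1 a2 b1 b2)
  qed
  define E where "E = (\<lambda>w::complex \<times> complex. (exp (fst w), exp (snd w)))"
  have EH: "E (H w) = p w" for w unfolding E_def H_def using h1(2) h2(2) by (simp add: prod_eq_iff)
  \<comment> \<open>\<open>H\<close> takes values in this convex set, where paths with the same ends
    are homotopic; \<open>E\<close> carries the homotopy to the torus.\<close>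
  define C where "C = {w::complex \<times> complex. Re (fst w) = 0 \<and> Re (snd w) = 0}"
  have "convex C" unfolding C_def convex_def by auto
  have HC: "H w \<in> C" for w unfolding H_def C_def using re by simp
  have cH: "continuous_on S H" for S unfolding H_def
    by (intro continuous_intros continuous_on_subset[OF h1(1)] continuous_on_subset[OF h2(1)]) auto
  let ?\<gamma> = "linepath y z"
  have "path (H \<circ> ?\<gamma>)" by (rule path_continuous_image) (auto intro: cH)
  moreover have "path_image (H \<circ> ?\<gamma>) \<subseteq> C" using HC by (auto simp: path_image_def)
  moreover have "pathstart (H \<circ> ?\<gamma>) = H y" "pathfinish (H \<circ> ?\<gamma>) = H y"
    using \<open>H z = H y\<close> by (auto simp: pathstart_def pathfinish_def linepath_def)
  moreover have "path (\<lambda>t. H y)" "path_image (\<lambda>t::real. H y) \<subseteq> C"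
      "pathstart (\<lambda>t. H y) = H y" "pathfinish (\<lambda>t. H y) = H y"
    using HC by (auto simp: path_def path_image_def pathstart_def pathfinish_def)
  ultimately have "homotopic_paths C (H \<circ> ?\<gamma>) (\<lambda>t. H y)"
    using convex_imp_simply_connected[OF \<open>convex C\<close>]
    unfolding simply_connected_eq_homotopic_paths by (metis (no_types, lifting))
  moreover have "continuous_on C E" unfolding E_def by (intro continuous_intros)
  moreover have "E \<in> C \<rightarrow> torus" unfolding E_def C_def torus_def by auto
  ultimately have "homotopic_paths torus (E \<circ> (H \<circ> ?\<gamma>)) (E \<circ> (\<lambda>t. H y))"
    by (rule homotopic_paths_continuous_image)
  then have hom: "homotopic_paths torus (p \<circ> ?\<gamma>) (\<lambda>t. p y)" using EH by (simp add: comp_def)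
  have "pathfinish ?\<gamma> = pathfinish (\<lambda>t. y)"
  proof (rule covering_space_monodromy[OF covering _ _ _ _ hom])
    show "path (p \<circ> ?\<gamma>)" "path (\<lambda>t. p y)" using hom homotopic_paths_imp_path by blast+
    show "path_image (p \<circ> ?\<gamma>) \<subseteq> torus" "path_image (\<lambda>t::real. p y) \<subseteq> torus" using in_torus by (auto simp: path_image_def)
    show "path (\<lambda>t. y)" by (simp add: path_def)
    show "pathstart ?\<gamma> = pathstart (\<lambda>t. y)" by (simp add: pathstart_def linepath_def)
  qed auto
  then show ?thesis by (simp add: pathfinish_def linepath_def y_def z_def)
qed

text \<open>The images of the discs of integer radius about \<open>0\<close> form an increasing open
  cover of the compact torus.\<close>

lemma cocompact: obtains N where "\<And>x. \<exists>f\<in>G. norm (f x) < N"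
proof -
  have "compact torus" unfolding torus_def by (intro compact_Times compact_sphere)
  then have ex: "\<exists>D\<subseteq>C. finite D \<and> torus \<subseteq> \<Union>D" if "\<forall>c\<in>C. openin (top_of_set torus) c" "torus \<subseteq> \<Union>C" for C
    using that unfolding compact_eq_openin_cover by blast
  have cov: "torus \<subseteq> \<Union>(range (\<lambda>n::nat. p ` ball 0 (real n)))"
  proof
    fix w assume "w \<in> torus"
    then obtain x where "w = p x" using surj by blast
    moreover obtain n :: nat where "norm x < real n" using reals_Archimedean2 by blast
    ultimately have "w \<in> p ` ball 0 (real n)" by auto
    then show "w \<in> \<Union>(range (\<lambda>n::nat. p ` ball 0 (real n)))" by blast
  qed
  have "\<exists>D\<subseteq>range (\<lambda>n::nat. p ` ball 0 (real n)). finite D \<and> torus \<subseteq> \<Union>D"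
    by (rule ex) (use open_p cov in auto)
  then obtain D where D: "D \<subseteq> range (\<lambda>n::nat. p ` ball 0 (real n))" "finite D" "torus \<subseteq> \<Union>D" by blast
  obtain I :: "nat set" where I: "finite I" "D = (\<lambda>n. p ` ball 0 (real n)) ` I"
    using finite_subset_image[OF D(2,1)] by blast
  show thesis
  proof (rule that[of "real (Max (insert 0 I)) + 1"])
    fix x
    obtain n where n: "n \<in> I" "p x \<in> p ` ball 0 (real n)" using D(3) in_torus[of x] I by blast
    then obtain y where y: "p x = p y" "norm y < real n" by auto
    then obtain f where f: "f \<in> G" "f x = y" using fibres by blast
    have "n \<le> Max (insert 0 I)" using n I by simp
    then show "\<exists>f\<in>G. norm (f x) < real (Max (insert 0 I)) + 1" using f y(2) by (intro bexI[of _ f]) auto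
  qed
qed

end

section \<open>Freely acting automorphisms are translations\<close>

lemma convex_hull_isometry:
  "(\<lambda>z. a * cj s z + c) ` (convex hull P) = convex hull ((\<lambda>z. a * cj s z + c) ` P)"
proof -
  have lin: "linear (\<lambda>z. a * cj s z)"
    by (rule linearI) (auto simp: cj_def distrib_left scaleR_conv_of_real)
  have "(\<lambda>z. a * cj s z + c) ` S = (+) c ` (\<lambda>z. a * cj s z) ` S" for S
    by (simp add: image_image add.commute)
  then show ?thesis by (simp only: convex_hull_linear_image[OF lin] convex_hull_translation)
qed

lemma dist_isometry: "norm a = 1 \<Longrightarrow> dist (a * cj s x + c) (a * cj s y + c) = dist x y"
proof -
  assume "norm a = 1"
  have "a * cj s x + c - (a * cj s y + c) = a * cj s (x - y)" by (simp add: algebra_simps)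
  then have "dist (a * cj s x + c) (a * cj s y + c) = norm (a * cj s (x - y))" by (simp only: dist_norm)
  also have "\<dots> = dist x y" using \<open>norm a = 1\<close> by (simp add: norm_mult dist_norm del: cj_simps(3))
  finally show ?thesis .
qed

context tiling_346 begin

text \<open>A point may lie in several tiles. On each of them the local affine map agrees with the
  global one at the corners, hence on the hull, because the set where two real-affine maps agree is
  convex.\<close>

lemma cell_ext_affine:
  assumes g: "\<And>v. v \<in> tiling_vertices T \<Longrightarrow> g v = a * cj s v + c"
  shows "cell_ext T g = (\<lambda>x. a * cj s x + c)"
proof
  fix x
  obtain P where P: "P \<in> T" "x \<in> convex hull P" using tiles_cover by blast
  define A B where "A = (if s then a else 0)" and "B = (if s then 0 else a)"
  have AB: "a * cj s z + c = A * z + B * cnj z + c" for z by (simp add: A_def B_def cj_def)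
  show "cell_ext T g x = a * cj s x + c"
    unfolding cell_ext_def
  proof (rule the_equality)
    show "\<exists>P\<in>T. x \<in> convex hull P \<and> (\<exists>a' b c'. (\<forall>v\<in>P. g v = a' * v + b * cnj v + c') \<and> a * cj s x + c = a' * x + b * cnj x + c')"
      by (rule bexI[OF _ P(1)], intro conjI P(2) exI[of _ A] exI[of _ B] exI[of _ c] ballI)
         (simp_all only: g[OF tile_vertex[OF P(1)]] AB)
  next
    fix y assume "\<exists>P\<in>T. x \<in> convex hull P \<and> (\<exists>a b c. (\<forall>v\<in>P. g v = a * v + b * cnj v + c) \<and> y = a * x + b * cnj x + c)"
    then obtain Q a' b' c' where Q: "Q \<in> T" "x \<in> convex hull Q" "\<And>v. v \<in> Q \<Longrightarrow> g v = a' * v + b' * cnj v + c'"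
      "y = a' * x + b' * cnj x + c'" by blast
    let ?Z = "{z. (a' - A) * z + (b' - B) * cnj z + (c' - c) = 0}"
    have "convex ?Z"
    proof (rule convexI)
      fix p q u w assume pq: "p \<in> ?Z" "q \<in> ?Z" and uw: "0 \<le> u" "0 \<le> w" "u + w = (1::real)"
      have "(a' - A) * (u *\<^sub>R p + w *\<^sub>R q) + (b' - B) * cnj (u *\<^sub>R p + w *\<^sub>R q) + (of_real (u + w)) * (c' - c)
         = of_real u * ((a' - A) * p + (b' - B) * cnj p + (c' - c)) + of_real w * ((a' - A) * q + (b' - B) * cnj q + (c' - c))"
        by (simp add: scaleR_conv_of_real algebra_simps)
      also have "\<dots> = 0" using pq by simp
      finally show "u *\<^sub>R p + w *\<^sub>R q \<in> ?Z" using uw by simp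
    qed
    moreover have "Q \<subseteq> ?Z"
    proof
      fix v assume v: "v \<in> Q"
      have "a' * v + b' * cnj v + c' = A * v + B * cnj v + c"
        using Q(3)[OF v] g[OF tile_vertex[OF Q(1) v]] AB by metis
      then show "v \<in> ?Z" by (simp add: algebra_simps)
    qed
    ultimately have "convex hull Q \<subseteq> ?Z" by (rule hull_minimal[rotated])
    then have "(a' - A) * x + (b' - B) * cnj x + (c' - c) = 0" using Q(2) by blast
    then show "y = a * cj s x + c" unfolding Q(4) AB by (simp add: algebra_simps)
  qed
qed

end

section \<open>Fixed points and displacements of the extended automorphisms\<close>

locale free_aut_group = tiling_346 +
  fixes \<Gamma> :: "(complex \<Rightarrow> complex) set"
  assumes sub: "is_subgroup_of \<Gamma> (map_auts T)" and free: "acts_freely T \<Gamma>"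
begin

abbreviation "V \<equiv> tiling_vertices T"
abbreviation "ext \<equiv> cell_ext T"

lemma auts: "g \<in> \<Gamma> \<Longrightarrow> g \<in> map_auts T" and G_id: "id \<in> \<Gamma>"
  and G_comp: "g \<in> \<Gamma> \<Longrightarrow> h \<in> \<Gamma> \<Longrightarrow> g \<circ> h \<in> \<Gamma>" and G_inv: "g \<in> \<Gamma> \<Longrightarrow> inv g \<in> \<Gamma>"
  using sub unfolding is_subgroup_of_def by auto

lemma ext_affine:
  assumes "g \<in> \<Gamma>" obtains s a c where "norm a = 1" "ext g = (\<lambda>x. a * cj s x + c)" "\<And>v. v \<in> V \<Longrightarrow> g v = a * cj s v + c"
proof -
  obtain s a c where *: "norm a = 1" "\<And>v. v \<in> V \<Longrightarrow> g v = a * cj s v + c" by (rule aut_affine[OF auts[OF assms]]) (rule that; assumption)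
  show thesis by (rule that[OF *(1) cell_ext_affine[OF *(2)] *(2)])
qed

lemma ext_vertex: assumes "g \<in> \<Gamma>" "v \<in> V" shows "ext g v = g v"
proof -
  obtain s a c where *: "norm a = 1" "ext g = (\<lambda>x. a * cj s x + c)" "\<And>v. v \<in> V \<Longrightarrow> g v = a * cj s v + c"
    by (rule ext_affine[OF assms(1)]) (rule that; assumption)
  show ?thesis unfolding *(2) *(3)[OF assms(2)] ..
qed

lemma ext_form:
  assumes "g \<in> \<Gamma>" obtains s a c where "norm a = 1" "ext g = (\<lambda>x. a * cj s x + c)"
  by (rule ext_affine[OF assms]) (rule that; assumption)

lemma ext_tile: assumes "g \<in> \<Gamma>" "P \<in> T" shows "ext g ` P = g ` P"
  using ext_vertex[OF assms(1) tile_vertex[OF assms(2)]] by (rule image_cong[OF refl])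

lemma G_vertex: assumes "g \<in> \<Gamma>" "v \<in> V" shows "g v \<in> V"
  using auts[OF assms(1)] assms(2) unfolding map_auts_def by (auto dest: bij_betwE)

lemma G_bij: assumes "g \<in> \<Gamma>" shows "bij g"
proof -
  have b: "bij_betw g V V" and out: "\<And>x. x \<notin> V \<Longrightarrow> g x = x" using auts[OF assms] unfolding map_auts_def by auto
  have "bij_betw g (- V) (- V)" using out by (auto simp: bij_betw_def inj_on_def image_iff)
  from bij_betw_combine[OF b this] show ?thesis by simp
qed

lemma ext_id: "ext id = id"
  using cell_ext_affine[of id 1 True 0] by (simp add: cj_def id_def)

lemma ext_comp: assumes "g \<in> \<Gamma>" "h \<in> \<Gamma>" shows "ext (g \<circ> h) = ext g \<circ> ext h"
proof -
  obtain s a c where g: "ext g = (\<lambda>x. a * cj s x + c)" by (rule ext_form[OF assms(1)]) (rule that; assumption)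
  obtain t b d where h: "ext h = (\<lambda>x. b * cj t x + d)" by (rule ext_form[OF assms(2)]) (rule that; assumption)
  have cc: "cj s (cj t x) = cj (s = t) x" for x by (auto simp: cj_def)
  have gh: "(ext g \<circ> ext h) = (\<lambda>x. (a * cj s b) * cj (s = t) x + (a * cj s d + c))"
    by (rule ext) (simp add: g h cc algebra_simps)
  have "(g \<circ> h) v = (ext g \<circ> ext h) v" if "v \<in> V" for v
    using ext_vertex[OF assms(2) that] ext_vertex[OF assms(1) G_vertex[OF assms(2) that]] by simp
  then show ?thesis unfolding gh by (rule cell_ext_affine)
qed

text \<open>Freeness is given for cells only. A fixed point is not a vertex and lies in a tile and
  in its different image, hence inside a common edge. The face of the image tile through this point
  contains that edge and its image, so the edge would be mapped to itself.\<close>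

lemma ext_fixfree:
  assumes g: "g \<in> \<Gamma>" "g \<noteq> id" shows "ext g x \<noteq> x"
proof
  assume fx: "ext g x = x"
  let ?f = "ext g"
  obtain s a c where f: "norm a = 1" "?f = (\<lambda>x. a * cj s x + c)" by (rule ext_form[OF g(1)]) (rule that; assumption)
  have inj: "?f y = ?f z \<Longrightarrow> y = z" for y z using dist_isometry[OF f(1), of s y c z] unfolding f(2) by (metis dist_eq_0_iff)
  have fv: "g v \<noteq> v" if "v \<in> V" for v using free g that unfolding acts_freely_def by blast
  have xV: "x \<notin> V" using fv ext_vertex[OF g(1)] fx by metis
  obtain P where P: "P \<in> T" "x \<in> convex hull P" using tiles_cover by blast
  let ?Q = "g ` P"
  have Q: "?Q \<in> T" "?Q \<noteq> P" using aut_tile[OF auts[OF g(1)] P(1)] free g P(1) unfolding acts_freely_def by blast+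
  have hull: "?f ` (convex hull P) = convex hull ?Q"
    using convex_hull_isometry[of a s c P] ext_tile[OF g(1) P(1)] unfolding f(2) by simp
  have xQ: "x \<in> convex hull ?Q" using imageI[OF P(2), of ?f] fx unfolding hull by simp
  have "\<forall>P\<in>T. \<forall>Q\<in>T. P \<noteq> Q \<longrightarrow> convex hull P \<inter> convex hull Q = {} \<or>
      (\<exists>v\<in>P \<inter> Q. convex hull P \<inter> convex hull Q = {v}) \<or>
      (\<exists>a b. {a, b} \<in> poly_edges P \<and> {a, b} \<in> poly_edges Q \<and> convex hull P \<inter> convex hull Q = closed_segment a b)"
    using tiling unfolding edge_to_edge_regular_tiling_def by (elim conjE)
  from this[rule_format, OF P(1) Q(1) Q(2)[symmetric]]
  have "\<exists>a b. {a, b} \<in> poly_edges P \<and> {a, b} \<in> poly_edges ?Q \<and> convex hull P \<inter> convex hull ?Q = closed_segment a b"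
  proof (elim disjE)
    assume "convex hull P \<inter> convex hull ?Q = {}" with P xQ show ?thesis by blast
  next
    assume "\<exists>v\<in>P \<inter> ?Q. convex hull P \<inter> convex hull ?Q = {v}"
    then obtain v where "v \<in> P" "convex hull P \<inter> convex hull ?Q = {v}" by blast
    moreover have "x \<in> convex hull P \<inter> convex hull ?Q" using P xQ by blast
    ultimately have "x \<in> P" by simp
    with xV P tile_vertex show ?thesis by blast
  qed
  then obtain p q where pq: "{p, q} \<in> poly_edges P" "{p, q} \<in> poly_edges ?Q" "convex hull P \<inter> convex hull ?Q = closed_segment p q"
    by (elim exE conjE)
  have mem: "p \<in> P" "q \<in> P" "p \<in> ?Q" "q \<in> ?Q" "p \<noteq> q"
    using pq(1,2) unfolding poly_edges_def by (auto simp: doubleton_eq_iff)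
  have xo: "x \<in> open_segment p q" using pq(3) P(2) xQ xV mem tile_vertex[OF P(1)] unfolding open_segment_def by auto
  have fp: "?f p = g p" "?f q = g q" using ext_vertex[OF g(1) tile_vertex[OF P(1)]] mem by auto
  have "x \<in> ?f ` closed_segment p q" using fx xo open_closed_segment by (metis imageI)
  also have "?f ` closed_segment p q = closed_segment (g p) (g q)"
    using convex_hull_isometry[of a s c "{p, q}"] fp unfolding segment_convex_hull f(2) by simp
  finally have xo': "x \<in> open_segment (g p) (g q)"
    using xV G_vertex[OF g(1)] tile_vertex[OF P(1)] mem unfolding open_segment_def by blast
  obtain n v d where nvd: "d \<noteq> 0" "?Q = ngon n v d" "n \<ge> 3" using tile_ngon_any Q(1) by metis
  note int = interior_tile[OF Q(1)]
  have "x \<in> frontier (convex hull ?Q)" using pq(2) open_closed_segment[OF xo] unfolding poly_edges_def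
    by (auto simp: doubleton_eq_iff closed_segment_commute)
  moreover have "finite ?Q" unfolding nvd(2) by (rule finite_ngon)
  ultimately obtain y z where yz: "{y, z} \<in> poly_edges ?Q" "x \<in> closed_segment y z" "closed_segment y z face_of (convex hull ?Q)"
    using frontier_polygon_face[OF _ int] by blast
  have yzQ: "y \<in> ?Q" "z \<in> ?Q" using yz(1) unfolding poly_edges_def by (auto simp: doubleton_eq_iff)
  have corner: "w \<in> {y, z}" "w' \<in> {y, z}" if "w \<in> ?Q" "w' \<in> ?Q" "x \<in> open_segment w w'" for w w'
  proof -
    have "w \<in> closed_segment y z" "w' \<in> closed_segment y z"
      using yz(2,3) that(3) hull_inc[OF that(1)] hull_inc[OF that(2)] unfolding face_of_def by blast+
    then show "w \<in> {y, z}" "w' \<in> {y, z}" using poly_edges_corner[of n y v d z] nvd yzQ that by auto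
  qed
  have "{p, q} \<subseteq> {y, z}" using corner[OF mem(3,4) xo] by blast
  moreover have "{g p, g q} \<subseteq> {y, z}" using corner[OF _ _ xo'] mem by blast
  moreover have "g p \<noteq> g q" using inj[of p q] fp mem by auto
  ultimately have "g ` {p, q} = {p, q}" using mem(5) by auto
  moreover have "{p, q} \<in> tiling_edges T" unfolding tiling_edges_def using P pq by blast
  ultimately show False using free g unfolding acts_freely_def by blast
qed

text \<open>With a rotation factor \<open>a \<noteq> 1\<close> the point \<open>c / (1 - a)\<close>
  would be fixed.\<close>

lemma ext_direct:
  assumes "g \<in> \<Gamma>" "ext g = (\<lambda>z. a * z + c)" shows "a = 1"
proof (rule ccontr)
  assume a: "a \<noteq> 1"
  have "g \<noteq> id"
  proof
    assume "g = id"
    then have "(\<lambda>z. a * z + c) = id" using assms(2) ext_id by simp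
    then have "a * 0 + c = 0" "a * 1 + c = 1" by (metis id_apply)+
    with a show False by simp
  qed
  moreover have "ext g (c / (1 - a)) = c / (1 - a)" unfolding assms(2) using a by (simp add: field_simps)
  ultimately show False using ext_fixfree[OF assms(1)] by blast
qed

text \<open>A tile contains a disc of radius \<open>r\<close>, so a translation by less than
  \<open>r\<close> would make it overlap its image. The square of an orientation-reversing element
  is a translation and moves points at most twice as far, whence \<open>r / 2\<close>.\<close>

lemma displacement:
  obtains \<delta> where "0 < \<delta>" "\<And>g x. g \<in> \<Gamma> \<Longrightarrow> ext g \<noteq> id \<Longrightarrow> \<delta> \<le> dist (ext g x) x"
proof -
  obtain P where P: "P \<in> T" using tiles_cover by blast
  from interior_tile[OF P] obtain y where "y \<in> interior (convex hull P)" by blast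
  then obtain r where r: "r > 0" "ball y r \<subseteq> convex hull P" unfolding mem_interior by blast
  have trans: "r \<le> norm c" if g: "g \<in> \<Gamma>" "ext g \<noteq> id" "ext g = (\<lambda>z. z + c)" for g c
  proof (rule ccontr)
    assume "\<not> r \<le> norm c"
    then have "y + c \<in> ball y r" by (simp add: dist_norm)
    then have 1: "y + c \<in> interior (convex hull P)" using r(2) by (meson interior_maximal open_ball subsetD)
    have "(\<lambda>z. z + c) ` ball y r \<subseteq> convex hull (g ` P)"
      using image_mono[OF r(2), of "\<lambda>z. z + c"] convex_hull_isometry[of 1 True c P] ext_tile[OF g(1) P] unfolding g(3)
      by (simp add: cj_def)
    moreover have "ball (y + c) r \<subseteq> (\<lambda>z. z + c) ` ball y r"
    proof
      fix z assume "z \<in> ball (y + c) r"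
      then have "z - c \<in> ball y r" by (simp add: dist_norm algebra_simps)
      then show "z \<in> (\<lambda>z. z + c) ` ball y r" by (rule rev_image_eqI) simp
    qed
    ultimately have "y + c \<in> interior (convex hull (g ` P))"
      using r(1) by (meson centre_in_ball interior_maximal open_ball order_trans subsetD)
    with 1 have "g ` P = P" using tiles_interior[OF P aut_tile[OF auts[OF g(1)] P]] by blast
    moreover have "g \<noteq> id" using g(2) ext_id by blast
    ultimately show False using free g(1) P unfolding acts_freely_def by blast
  qed
  show thesis
  proof (rule that[of "r / 2"])
    show "0 < r / 2" using r by simp
    fix g x assume g: "g \<in> \<Gamma>" "ext g \<noteq> id"
    obtain s a c where f: "norm a = 1" "ext g = (\<lambda>x. a * cj s x + c)" by (rule ext_form[OF g(1)]) (rule that; assumption)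
    show "r / 2 \<le> dist (ext g x) x"
    proof (cases s)
      case True
      then have "a = 1" using ext_direct[OF g(1), of a c] f by (simp add: cj_def)
      then have "ext g = (\<lambda>z. z + c)" using f True by (simp add: cj_def)
      with trans[OF g this] r show ?thesis by (simp add: dist_norm)
    next
      case False
      have na: "a * cnj a = 1" using f(1) by (simp add: complex_norm_square[symmetric])
      have gg: "ext (g \<circ> g) = (\<lambda>z. z + (a * cnj c + c))"
      proof
        fix z
        have "ext (g \<circ> g) z = (a * cnj a) * z + (a * cnj c + c)"
          unfolding ext_comp[OF g(1) g(1)] using False by (simp add: f(2) cj_def algebra_simps)
        then show "ext (g \<circ> g) z = z + (a * cnj c + c)" unfolding na by simp
      qed
      \<comment> \<open>With trivial square the map is a reflection, and it fixes
        \<open>c / 2\<close>.\<close>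
      have "ext (g \<circ> g) \<noteq> id"
      proof
        assume "ext (g \<circ> g) = id"
        then have "a * cnj c + c = 0" unfolding gg by (metis add_0 id_apply)
        then have "a * cnj c = - c" by (simp add: eq_neg_iff_add_eq_0)
        then have "ext g (c / 2) = c / 2" unfolding f(2) using False by (simp add: cj_def)
        moreover have "g \<noteq> id" using g ext_id by blast
        ultimately show False using ext_fixfree[OF g(1)] by blast
      qed
      from trans[OF G_comp[OF g(1) g(1)] this gg] have "r \<le> dist (ext (g \<circ> g) x) x" unfolding gg by (simp add: dist_norm)
      also have "\<dots> \<le> dist (ext g (ext g x)) (ext g x) + dist (ext g x) x"
        unfolding ext_comp[OF g(1) g(1)] by (simp add: dist_triangle)
      also have "dist (ext g (ext g x)) (ext g x) = dist (ext g x) x" unfolding f(2) by (rule dist_isometry[OF f(1)])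
      finally show ?thesis by simp
    qed
  qed
qed

lemma torus_group_translation:
  assumes tor: "quotient_is_torus T \<Gamma>" and g: "g \<in> \<Gamma>"
  obtains u where "\<And>v. v \<in> V \<Longrightarrow> g v = v + u"
proof -
  obtain p where p: "quotient_map euclidean (top_of_set torus) p" "\<And>x y. p x = p y \<longleftrightarrow> (\<exists>g\<in>\<Gamma>. ext g x = y)"
    using tor unfolding quotient_is_torus_def by blast
  obtain \<delta> where \<delta>: "0 < \<delta>" "\<And>g x. g \<in> \<Gamma> \<Longrightarrow> ext g \<noteq> id \<Longrightarrow> \<delta> \<le> dist (ext g x) x" using displacement by blast
  interpret free_torus_action p "ext ` \<Gamma>" \<delta>
  proof
    show "f \<circ> h \<in> ext ` \<Gamma>" if fh: "f \<in> ext ` \<Gamma>" "h \<in> ext ` \<Gamma>" for f h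
    proof -
      obtain k l where "k \<in> \<Gamma>" "f = ext k" "l \<in> \<Gamma>" "h = ext l" using fh by blast
      then show ?thesis using ext_comp[of k l] G_comp[of k l] by (intro image_eqI[of _ _ "k \<circ> l"]) simp_all
    qed
    show "\<exists>h\<in>ext ` \<Gamma>. h \<circ> f = id \<and> f \<circ> h = id" if f: "f \<in> ext ` \<Gamma>" for f
    proof -
      obtain g where g: "g \<in> \<Gamma>" "f = ext g" using f by blast
      have "inv g \<circ> g = id" "g \<circ> inv g = id" using G_bij[OF g(1)] by (simp_all add: bij_is_inj bij_is_surj flip: inj_iff surj_iff)
      then have "ext (inv g) \<circ> f = id" "f \<circ> ext (inv g) = id"
        using ext_comp[OF G_inv[OF g(1)] g(1)] ext_comp[OF g(1) G_inv[OF g(1)]] ext_id g(2) by auto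
      then show ?thesis using G_inv[OF g(1)] by blast
    qed
    show "dist (f x) (f y) = dist x y" if f: "f \<in> ext ` \<Gamma>" for f x y
    proof -
      obtain h where h: "h \<in> \<Gamma>" "f = ext h" using f by blast
      obtain s a c where "norm a = 1" "ext h = (\<lambda>x. a * cj s x + c)" by (rule ext_form[OF h(1)]) (rule that; assumption)
      then show ?thesis unfolding h(2) by (simp only: dist_isometry)
    qed
    show "p x = p y \<longleftrightarrow> (\<exists>f\<in>ext ` \<Gamma>. f x = y)" for x y using p(2) by blast
  qed (use p \<delta> in auto)
  obtain s a c where f: "norm a = 1" "ext g = (\<lambda>x. a * cj s x + c)" "\<And>v. v \<in> V \<Longrightarrow> g v = a * cj s v + c"
    by (rule ext_affine[OF g]) (rule that; assumption)
  have s
  proof (rule ccontr)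
    assume s: "\<not> s"
    have na: "a * cnj a = 1" using f(1) by (simp add: complex_norm_square[symmetric])
    have fz: "ext g z = a * cnj z + c" for z using s f(2) by (simp add: cj_def)
    \<comment> \<open>\<open>D z\<close> is twice the offset of \<open>z\<close> from the glide axis; commutativity makes its modulus invariant.\<close>
    define D where "D = (\<lambda>z. (z - c / 2) - a * cnj (z - c / 2))"
    have Dt: "D (z + u) = D z" if "a * cnj u = u" for z u using that by (simp add: D_def algebra_simps)
    have Df: "D (ext g z) = - D z" for z
    proof -
      have "D (ext g z) = a * cnj z + c / 2 - (a * cnj a) * z - a * cnj c / 2" by (simp add: D_def fz field_simps)
      then show ?thesis unfolding na by (simp add: D_def field_simps)
    qed
    have inv: "norm (D (ext h z)) = norm (D z)" if h: "h \<in> \<Gamma>" for h z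
    proof -
      obtain t b e where e: "norm b = 1" "ext h = (\<lambda>x. b * cj t x + e)" by (rule ext_form[OF h]) (rule that; assumption)
      have com: "ext g (ext h x) = ext h (ext g x)" for x using commute[of "ext g" "ext h" x] g h by blast
      show ?thesis
      proof (cases t)
        case True
        then have "b = 1" using ext_direct[OF h, of b e] e by (simp add: cj_def)
        then have hz: "ext h z = z + e" for z using e True by (simp add: cj_def)
        \<comment> \<open>Commuting with the glide reflection forces the translation to be parallel
          to its axis.\<close>
        have "a * cnj e = e" using com[of 0] unfolding hz fz by simp
        then show ?thesis unfolding hz by (simp add: Dt)
      next
        case False
        then have hz: "ext h z = b * cnj z + e" for z using e by (simp add: cj_def)
        \<comment> \<open>A product of two reversing elements is direct, hence a translation. So
          \<open>h\<close> has the same linear part as \<open>g\<close>, and the two differ by a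
          translation, which commutativity makes parallel to the axis.\<close>
        have "ext (g \<circ> h) = (\<lambda>z. (a * cnj b) * z + (a * cnj e + c))"
          unfolding ext_comp[OF g h] by (rule HOL.ext) (simp add: fz hz algebra_simps)
        then have "a * cnj b = 1" by (rule ext_direct[OF G_comp[OF g h]])
        moreover have "b * cnj b = 1" using e(1) by (simp add: complex_norm_square[symmetric])
        ultimately have ab: "a = b" by (metis mult_right_cancel mult_zero_right zero_neq_one)
        have "a * cnj e + c = a * cnj c + e" using com[of 0] unfolding hz fz ab by simp
        then have "a * cnj (e - c) = e - c" by (simp add: algebra_simps)
        then have "D (ext g z + (e - c)) = D (ext g z)" by (rule Dt)
        moreover have "ext h z = ext g z + (e - c)" unfolding hz fz ab by simp
        ultimately show ?thesis using Df[of z] by simp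
      qed
    qed
    obtain N where N: "\<And>x. \<exists>f\<in>ext ` \<Gamma>. norm (f x) < N" using cocompact by blast
    have bound: "norm (D z) \<le> 2 * (N + norm (c / 2))" for z
    proof -
      obtain h where h: "h \<in> \<Gamma>" "norm (ext h z) < N" using N[of z] by blast
      let ?w = "ext h z - c / 2"
      have "norm (D z) = norm (D (ext h z))" using inv[OF h(1)] by simp
      also have "\<dots> \<le> norm ?w + norm (a * cnj ?w)" unfolding D_def by (rule norm_triangle_ineq4)
      also have "\<dots> = 2 * norm ?w" by (simp only: norm_mult f(1) complex_mod_cnj)
      also have "\<dots> \<le> 2 * (norm (ext h z) + norm (c / 2))" using norm_triangle_ineq4[of "ext h z" "c / 2"] by simp
      finally show ?thesis using h(2) by simp
    qed
    \<comment> \<open>A direction not parallel to the axis; along it \<open>D\<close> grows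
      linearly, against the bound.\<close>
    obtain w where w: "w - a * cnj w \<noteq> 0"
    proof (cases "a = 1")
      case True then show thesis using that[of \<i>] by simp
    next
      case False then show thesis using that[of 1] by simp
    qed
    let ?B = "2 * (N + norm (c / 2)) + norm (D 0)"
    obtain m :: nat where m: "?B / norm (w - a * cnj w) < real m" using reals_Archimedean2 by blast
    have "D (of_nat m * w) = of_nat m * (w - a * cnj w) + D 0" by (simp add: D_def algebra_simps)
    then have "norm (of_nat m * (w - a * cnj w)) \<le> norm (D (of_nat m * w)) + norm (D 0)"
      by (metis add_diff_cancel_right' norm_triangle_ineq4)
    then have "real m * norm (w - a * cnj w) \<le> ?B" using bound[of "of_nat m * w"] by (simp add: norm_mult)
    with m w show False by (simp add: divide_less_eq)
  qed
  then have "a = 1" using ext_direct[OF g, of a c] f by (simp add: cj_def)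
  then show thesis using that[of c] f(3) \<open>s\<close> by (simp add: cj_def)
qed

end

section \<open>Counting vertex orbits\<close>

lemma quot_auts_comp:
  assumes "\<phi> \<in> quot_auts T \<Gamma>" "\<psi> \<in> quot_auts T \<Gamma>" shows "\<phi> \<circ> \<psi> \<in> quot_auts T \<Gamma>"
proof -
  have "(\<lambda>F. (\<phi> \<circ> \<psi>) ` F) ` quot_faces T \<Gamma> = (\<lambda>F. \<phi> ` F) ` (\<lambda>F. \<psi> ` F) ` quot_faces T \<Gamma>"
    by (simp add: image_image image_comp)
  then show ?thesis using assms unfolding quot_auts_def by (auto intro: bij_betw_trans)
qed

text \<open>Elements of \<open>quot_auts\<close> are arbitrary off the vertices of the quotient, so
  a second automorphism in the opposite direction takes the place of an inverse.\<close>

lemma quot_auts_orbit_eq: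
  assumes "\<phi> \<in> quot_auts T \<Gamma>" "\<psi> \<in> quot_auts T \<Gamma>" "\<phi> x = y" "\<psi> y = x"
  shows "{\<phi> x | \<phi>. \<phi> \<in> quot_auts T \<Gamma>} = {\<phi> y | \<phi>. \<phi> \<in> quot_auts T \<Gamma>}"
proof -
  have "{\<phi> y | \<phi>. \<phi> \<in> quot_auts T \<Gamma>} \<subseteq> {\<phi> x | \<phi>. \<phi> \<in> quot_auts T \<Gamma>}" if "\<phi> \<in> quot_auts T \<Gamma>" "\<phi> x = y" for \<phi> x y
  proof
    fix z assume "z \<in> {\<phi> y | \<phi>. \<phi> \<in> quot_auts T \<Gamma>}"
    then obtain \<psi> where "\<psi> \<in> quot_auts T \<Gamma>" "z = \<psi> y" by blast
    then have "\<psi> \<circ> \<phi> \<in> quot_auts T \<Gamma>" "z = (\<psi> \<circ> \<phi>) x" using quot_auts_comp that by auto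
    then show "z \<in> {\<phi> x | \<phi>. \<phi> \<in> quot_auts T \<Gamma>}" by blast
  qed
  from this[OF assms(1,3)] this[OF assms(2,4)] show ?thesis by (rule equalityI[rotated])
qed

text \<open>One chosen representative per label already yields all values of
  \<open>B\<close>.\<close>

lemma card_image_le_classes:
  assumes "finite L" and lab: "\<And>u. u \<in> U \<Longrightarrow> \<exists>l\<in>L. R u l"
    and eq: "\<And>u w l. u \<in> U \<Longrightarrow> w \<in> U \<Longrightarrow> R u l \<Longrightarrow> R w l \<Longrightarrow> B u = B w"
  shows "card (B ` U) \<le> card L"
proof -
  have "B ` U \<subseteq> (\<lambda>l. B (SOME u. u \<in> U \<and> R u l)) ` L"
  proof
    fix b assume "b \<in> B ` U"
    then obtain u where u: "u \<in> U" "b = B u" by blast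
    then obtain l where l: "l \<in> L" "R u l" using lab by blast
    let ?w = "SOME w. w \<in> U \<and> R w l"
    have "?w \<in> U \<and> R ?w l" by (rule someI[of "\<lambda>w. w \<in> U \<and> R w l" u]) (use u l in simp)
    then have "b = B ?w" unfolding u(2) by (intro eq[OF u(1) _ l(2)]) simp_all
    then show "b \<in> (\<lambda>l. B (SOME u. u \<in> U \<and> R u l)) ` L" using l(1) by (rule image_eqI)
  qed
  from surj_card_le[OF \<open>finite L\<close> this] show ?thesis .
qed

section \<open>Symmetries of the tiling acting on the quotient\<close>

context free_aut_group begin

text \<open>A translation commutes with the translations in \<open>\<Gamma>\<close>, and a point
  reflection conjugates each of them to its inverse; either way orbits go to orbits.\<close>

lemma symmetry_quot_aut:
  assumes tor: "quotient_is_torus T \<Gamma>" and e: "e \<in> {1, -1}" and sym: "(\<lambda>P. (\<lambda>z. e * z + c) ` P) ` T = T"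
  shows "(\<lambda>S. (\<lambda>z. e * z + c) ` S) \<in> quot_auts T \<Gamma>"
    and "\<And>x. x \<in> V \<Longrightarrow> (\<lambda>z. e * z + c) ` orb \<Gamma> x = orb \<Gamma> (e * x + c)"
proof -
  let ?\<phi> = "\<lambda>z. e * z + c"
  have inj: "inj ?\<phi>" using e by (auto simp: inj_def)
  have V: "?\<phi> ` V = V"
  proof -
    have "?\<phi> ` \<Union>T = \<Union>((\<lambda>P. ?\<phi> ` P) ` T)" by blast
    then show ?thesis unfolding tiling_vertices_def sym .
  qed
  have conj: "\<exists>h\<in>\<Gamma>. \<forall>x\<in>V. ?\<phi> (g x) = h (?\<phi> x) \<and> g (?\<phi> x) = ?\<phi> (h x)" if g: "g \<in> \<Gamma>" for g
  proof -
    obtain u where u: "\<And>v. v \<in> V \<Longrightarrow> g v = v + u" by (rule torus_group_translation[OF tor g]) (rule that; assumption)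
    have \<phi>V: "?\<phi> x \<in> V" if "x \<in> V" for x using V that by blast
    from e show ?thesis
    proof (elim insertE emptyE)
      assume "e = 1"
      then show ?thesis using \<phi>V u g by (intro bexI[of _ g]) auto
    next
      assume e: "e = - 1"
      have "inv g v = v - u" if v: "v \<in> V" for v
      proof -
        have "g (inv g v) = v" using G_bij[OF g] by (simp add: bij_is_surj surj_f_inv_f)
        moreover have "g (inv g v) = inv g v + u" by (rule u[OF G_vertex[OF G_inv[OF g] v]])
        ultimately show ?thesis by (simp add: algebra_simps)
      qed
      then show ?thesis using \<phi>V u e G_inv[OF g] by (intro bexI[of _ "inv g"]) auto
    qed
  qed
  show orb: "?\<phi> ` orb \<Gamma> x = orb \<Gamma> (?\<phi> x)" if x: "x \<in> V" for x
  proof (intro equalityI subsetI)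
    fix y assume "y \<in> ?\<phi> ` orb \<Gamma> x"
    then obtain g where g: "g \<in> \<Gamma>" "y = ?\<phi> (g x)" unfolding orb_def by blast
    then obtain h where "h \<in> \<Gamma>" "y = h (?\<phi> x)" using conj[OF g(1)] x by blast
    then show "y \<in> orb \<Gamma> (?\<phi> x)" unfolding orb_def by blast
  next
    fix y assume "y \<in> orb \<Gamma> (?\<phi> x)"
    then obtain g where g: "g \<in> \<Gamma>" "y = g (?\<phi> x)" unfolding orb_def by blast
    then obtain h where "h \<in> \<Gamma>" "y = ?\<phi> (h x)" using conj[OF g(1)] x by blast
    then show "y \<in> ?\<phi> ` orb \<Gamma> x" unfolding orb_def by blast
  qed
  have img: "(\<lambda>S. ?\<phi> ` S) ` orb \<Gamma> ` P = orb \<Gamma> ` ?\<phi> ` P" if "P \<subseteq> V" for P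
    unfolding image_image using orb that by (intro image_cong) auto
  have "(\<lambda>S. ?\<phi> ` S) ` quot_vertices T \<Gamma> = quot_vertices T \<Gamma>"
    unfolding quot_vertices_def img[OF subset_refl] V ..
  moreover have "inj_on (\<lambda>S. ?\<phi> ` S) (quot_vertices T \<Gamma>)"
    by (rule inj_onI) (simp only: inj_image_eq_iff[OF inj])
  moreover have "(\<lambda>F. (\<lambda>S. ?\<phi> ` S) ` F) ` quot_faces T \<Gamma> = quot_faces T \<Gamma>"
  proof -
    have "(\<lambda>F. (\<lambda>S. ?\<phi> ` S) ` F) ` quot_faces T \<Gamma> = (\<lambda>P. orb \<Gamma> ` ?\<phi> ` P) ` T"
      unfolding quot_faces_def image_image[of _ "\<lambda>P. orb \<Gamma> ` P"] using img tile_sub[OF auts[OF G_id]] by (intro image_cong) auto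
    also have "\<dots> = (\<lambda>P. orb \<Gamma> ` P) ` (\<lambda>P. ?\<phi> ` P) ` T" by (simp only: image_image)
    finally show ?thesis unfolding sym quot_faces_def .
  qed
  ultimately show "(\<lambda>S. ?\<phi> ` S) \<in> quot_auts T \<Gamma>" unfolding quot_auts_def bij_betw_def by simp
qed

lemma num_vertex_orbits_le_9:
  assumes tor: "quotient_is_torus T \<Gamma>" and H: no_BBB
  shows "num_vertex_orbits_quot T \<Gamma> \<le> 9"
proof -
  obtain d where d: "d \<noteq> 0" "\<And>u. u \<in> V \<Longrightarrow>
     \<exists>X\<in>{typeAp, typeAm, typeB}. \<exists>j<3. \<exists>s\<in>{1, -1}. vt u (s * (d * \<zeta> ^ j)) X"
    using vertex_directions[OF H] by blast
  define L where "L = {typeAp, typeAm, typeB} \<times> {..<3::nat}"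
  define R where "R = (\<lambda>u (X, j). X \<in> {typeAp, typeAm, typeB} \<and> (\<exists>s\<in>{1, -1}. vt u (s * (d * \<zeta> ^ j)) X))"
  define B where "B = (\<lambda>u. {\<phi> (orb \<Gamma> u) | \<phi>. \<phi> \<in> quot_auts T \<Gamma>})"
  have move: "\<exists>\<phi>\<in>quot_auts T \<Gamma>. \<phi> (orb \<Gamma> u) = orb \<Gamma> w" if uw: "u \<in> V" "w \<in> V" and R: "R u l" "R w l" for u w l
  proof -
    obtain X j where l: "l = (X, j)" by fastforce
    note R' = R[unfolded R_def l prod.case]
    obtain s t where s: "X \<in> {typeAp, typeAm, typeB}" "s \<in> {1, -1}" "vt u (s * (d * \<zeta> ^ j)) X"
      and t: "t \<in> {1, -1}" "vt w (t * (d * \<zeta> ^ j)) X"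
      using R' by blast
    \<comment> \<open>The sign makes the two triangle directions agree: \<open>e = 1\<close> gives a
      translation, \<open>e = -1\<close> a point reflection, and the constant term is chosen to take
      \<open>u\<close> to \<open>w\<close>.\<close>
    define e where "e = t * s"
    have e: "e \<in> {1, -1}" "e \<noteq> 0" using s t by (auto simp: e_def)
    have "e * u + (w - e * u) = w" by simp
    moreover have "e * (s * (d * \<zeta> ^ j)) = t * (d * \<zeta> ^ j)" using s(2) by (auto simp: e_def)
    ultimately have "vt (e * u + (w - e * u)) (e * (s * (d * \<zeta> ^ j))) X" using t(2) by (simp only:)
    from affine_match[OF H s(1) s(3) this e(2)]
    have sym: "(\<lambda>P. (\<lambda>z. e * z + (w - e * u)) ` P) ` T = T" .
    have "(\<lambda>z. e * z + (w - e * u)) ` orb \<Gamma> u = orb \<Gamma> w"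
      using symmetry_quot_aut(2)[OF tor e(1) sym uw(1)] by simp
    with symmetry_quot_aut(1)[OF tor e(1) sym] show ?thesis by (intro bexI)
  qed
  have "card (B ` V) \<le> card L"
  proof (rule card_image_le_classes)
    show "finite L" by (simp add: L_def)
    show "\<exists>l\<in>L. R u l" if u: "u \<in> V" for u
    proof -
      obtain X j s where "X \<in> {typeAp, typeAm, typeB}" "j < 3" "s \<in> {1, -1}" "vt u (s * (d * \<zeta> ^ j)) X"
        using d(2)[OF u] by blast
      then show ?thesis unfolding L_def R_def by (intro bexI[of _ "(X, j)"]) auto
    qed
    show "B u = B w" if "u \<in> V" "w \<in> V" "R u l" "R w l" for u w l
    proof -
      obtain \<phi> where "\<phi> \<in> quot_auts T \<Gamma>" "\<phi> (orb \<Gamma> u) = orb \<Gamma> w" using move \<open>u \<in> V\<close> \<open>w \<in> V\<close> \<open>R u l\<close> \<open>R w l\<close> by blast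
      moreover obtain \<psi> where "\<psi> \<in> quot_auts T \<Gamma>" "\<psi> (orb \<Gamma> w) = orb \<Gamma> u" using move \<open>u \<in> V\<close> \<open>w \<in> V\<close> \<open>R u l\<close> \<open>R w l\<close> by blast
      ultimately show ?thesis unfolding B_def by (intro quot_auts_orbit_eq)
    qed
  qed
  also have "card L = 9" by (simp add: L_def card_cartesian_product)
  also have "B ` V = {{\<phi> u | \<phi>. \<phi> \<in> quot_auts T \<Gamma>} | u. u \<in> quot_vertices T \<Gamma>}"
    unfolding B_def quot_vertices_def by blast
  finally show ?thesis unfolding num_vertex_orbits_quot_def .
qed

end

theorem theorem1:
  fixes T :: "complex set set" and \<Gamma> :: "(complex \<Rightarrow> complex) set"
  assumes K: "two_uniform T"
    and types: "\<forall>v\<in>tiling_vertices T.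
                  has_vertex_type T v [3, 4, 4, 6] \<or> has_vertex_type T v [3, 4, 6, 4]"
    and type1: "\<exists>v\<in>tiling_vertices T. has_vertex_type T v [3, 4, 4, 6]"
    and type2: "\<exists>v\<in>tiling_vertices T. has_vertex_type T v [3, 4, 6, 4]"
    and sub: "is_subgroup_of \<Gamma> (map_auts T)"
    and free: "acts_freely T \<Gamma>"
    and tor: "quotient_is_torus T \<Gamma>"
    and poly: "quotient_polyhedral T \<Gamma>"
  shows "num_vertex_orbits_quot T \<Gamma> \<le> 9"
proof -
  interpret free_aut_group T \<Gamma>
    using K types sub free by unfold_locales (auto simp: two_uniform_def)
  show ?thesis by (rule num_vertex_orbits_le_9[OF tor no_BBB_if_two_uniform[OF K type1]])
qed

end
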